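(* Consider the problem, setting and Majorized ADMM described in the context, with $\sigma>0$, $\tau>0$ and self-adjoint positive semidefinite $\mathcal{S},\mathcal{T}$. Suppose that the solution set of the problem is nonempty and that there exists $(\hat u,\hat v)\in\mathrm{ri}(\mathrm{dom}(p)\times\mathrm{dom}(q))$ with $\mathcal{A}^*\hat u+\mathcal{B}^*\hat v=c$. Assume $\mathcal{S},\mathcal{T}$ are chosen such that $\mathcal{Q}_{11}+\sigma\mathcal{A}\mathcal{A}^*+\mathcal{S}\succ0$ and $\mathcal{Q}_{22}+\sigma\mathcal{B}\mathcal{B}^*+\mathcal{T}\succ0$. (i) Assume $\tau\in(0,1]$. If for every $w=(u,v)\in\mathcal{U}\times\mathcal{V}$, $\langle w,[\mathcal{Q}+\mathrm{Diag}(\mathcal{S}+(1-\tau)\sigma\mathcal{A}\mathcal{A}^*,\ \mathcal{T}+(1-\tau)\sigma\mathcal{B}\mathcal{B}^* )]w\rangle=0$ implies $\|u\|\|v\|=0$, then $\{(u^k,v^k)\}$ converges to an optimal solution $(u^\infty,v^\infty)$ of the problem and $\{x^k\}$ converges to a multiplier $x^\infty$ such that $(u^\infty,v^\infty,x^\infty)$ satisfies the KKT condition. (ii) Assume $\tau\in(0,\frac{1+\sqrt5}{2})$. If $\mathcal{M}:=\frac14\mathcal{Q}+\mathrm{Diag}(\mathcal{S}-\eta\mathcal{D}_1,\ \mathcal{T}-\eta\mathcal{D}_2)\succeq0$, $\frac14\mathcal{Q}_{11}+\mathcal{S}+\sigma\mathcal{A}\mathcal{A}^*-\eta\mathcal{D}_1\succ0$,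 $\frac14\mathcal{Q}_{22}+\mathcal{T}+\sigma\mathcal{B}\mathcal{B}^*-\eta\mathcal{D}_2\succ0$, and for every $w=(u,v)$, $\langle w,[\mathcal{M}+\sigma\mathrm{Diag}(\mathcal{A}\mathcal{A}^*,\mathcal{B}\mathcal{B}^* )]w\rangle=0$ implies $\|u\|\|v\|=0$, then $\{(u^k,v^k)\}$ converges to an optimal solution $(u^\infty,v^\infty)$ of the problem and $\{x^k\}$ converges to a multiplier $x^\infty$ such that $(u^\infty,v^\infty,x^\infty)$ satisfies the KKT condition.
   Context: $\mathcal{U},\mathcal{V},\mathcal{X}$ are real finite-dimensional Euclidean spaces. $p:\mathcal{U}\to(-\infty,\infty]$ and $q:\mathcal{V}\to(-\infty,\infty]$ are closed proper convex functions; $\phi:\mathcal{U}\times\mathcal{V}\to\mathbb{R}$ is a smooth convex function with globally Lipschitz continuous gradient; $\mathcal{A}:\mathcal{X}\to\mathcal{U}$, $\mathcal{B}:\mathcal{X}\to\mathcal{V}$ are linear, $c\in\mathcal{X}$. The problem is $\min_{u,v}\ p(u)+q(v)+\phi(u,v)$ subject to $\mathcal{A}^*u+\mathcal{B}^*v=c$. Write $w=(u,v)$. For self-adjoint positive semidefinite $\mathcal{G}$, $\|z\|_{\mathcal{G}}^2=\langle z,\mathcal{G}z\rangle$. $\partial^2\phi(w)$ is Clarke's generalized Hessian (convex hull of limits of $\nabla^2\phi(w^j)$, $w^j\to w$, at points where $\nabla^2\phi$ exists). $\mathcal{Q},\mathcal{H}$ are self-adjoint positive semidefinite operators on $\mathcal{U}\times\mathcal{V}$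 with $\mathcal{Q}\preceq\mathcal{W}\preceq\mathcal{Q}+\mathcal{H}$ for all $\mathcal{W}\in\partial^2\phi(w)$, all $w$; $\mathcal{H}=\mathrm{Diag}(\mathcal{D}_1,\mathcal{D}_2)$ with $\mathcal{D}_1,\mathcal{D}_2$ self-adjoint positive semidefinite. Blocks: $\mathcal{Q}=\begin{pmatrix}\mathcal{Q}_{11}&\mathcal{Q}_{12}\\ \mathcal{Q}_{12}^*&\mathcal{Q}_{22}\end{pmatrix}$, similarly for $\mathcal{W}$. $\eta\in[0,1]$ is a constant with $|\langle u,(\mathcal{W}_{12}-\mathcal{Q}_{12})v\rangle|\le\frac{\eta}{2}(\|u\|_{\mathcal{D}_1}^2+\|v\|_{\mathcal{D}_2}^2)$ for all $\mathcal{W}\in\partial^2\phi(z)$, all $z$, all $u\in\mathcal{U},v\in\mathcal{V}$. KKT condition for $(\bar u,\bar v,\bar x)$: $0\in\nabla\phi(\bar w)+\begin{pmatrix}\partial p(\bar u)+\mathcal{A}\bar x\\ \partial q(\bar v)+\mathcal{B}\bar x\end{pmatrix}$ and $\mathcal{A}^*\bar u+\mathcal{B}^*\bar v=c$. Majorized ADMM: $\hat\phi(w;w')=\phi(w')+\langle\nabla\phi(w'),w-w'\rangle+\frac12\|w-w'\|^2_{\mathcal{Q}+\mathcal{H}}$, $\widehat{\mathcal{L}}_\sigma(w;(x,w'))=p(u)+q(v)+\hat\phi(w;w')+\langle x,\mathcal{A}^*u+\mathcal{B}^*v-c\rangle+\frac{\sigma}{2}\|\mathcal{A}^*u+\mathcal{B}^*v-c\|^2$.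 Given $(u^0,v^0,x^0)\in\mathrm{dom}(p)\times\mathrm{dom}(q)\times\mathcal{X}$, for $k=0,1,\dots$: $u^{k+1}=\arg\min_u\{\widehat{\mathcal{L}}_\sigma(u,v^k;(x^k,w^k))+\frac12\|u-u^k\|_{\mathcal{S}}^2\}$; $v^{k+1}=\arg\min_v\{\widehat{\mathcal{L}}_\sigma(u^{k+1},v;(x^k,w^k))+\frac12\|v-v^k\|_{\mathcal{T}}^2\}$; $x^{k+1}=x^k+\tau\sigma(\mathcal{A}^*u^{k+1}+\mathcal{B}^*v^{k+1}-c)$. *)

theory Defs
  imports "HOL-Analysis.Analysis"
begin

text \<open>Linear operators on Euclidean spaces are represented as functions (with linearity
  assumed / part of the definitions); the generalized Hessian uses bounded linear
  functions (blinfun) so that limits of Hessians make sense.\<close>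

definition self_adjoint :: "('a::real_inner \<Rightarrow> 'a) \<Rightarrow> bool" where
  "self_adjoint f \<longleftrightarrow> linear f \<and> (\<forall>x y. inner (f x) y = inner x (f y))"

definition psd_op :: "('a::real_inner \<Rightarrow> 'a) \<Rightarrow> bool" where
  "psd_op f \<longleftrightarrow> self_adjoint f \<and> (\<forall>x. 0 \<le> inner x (f x))"

definition pd_op :: "('a::real_inner \<Rightarrow> 'a) \<Rightarrow> bool" where
  "pd_op f \<longleftrightarrow> self_adjoint f \<and> (\<forall>x. x \<noteq> 0 \<longrightarrow> 0 < inner x (f x))"

definition loewner_le :: "('a::real_inner \<Rightarrow> 'a) \<Rightarrow> ('a \<Rightarrow> 'a) \<Rightarrow> bool" where
  "loewner_le f g \<longleftrightarrow> (\<forall>x. inner x (f x) \<le> inner x (g x))"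

definition blk11 :: "('u::real_vector \<times> 'v::real_vector \<Rightarrow> 'u \<times> 'v) \<Rightarrow> 'u \<Rightarrow> 'u" where
  "blk11 M a = fst (M (a, 0))"
definition blk12 :: "('u::real_vector \<times> 'v::real_vector \<Rightarrow> 'u \<times> 'v) \<Rightarrow> 'v \<Rightarrow> 'u" where
  "blk12 M b = fst (M (0, b))"
definition blk22 :: "('u::real_vector \<times> 'v::real_vector \<Rightarrow> 'u \<times> 'v) \<Rightarrow> 'v \<Rightarrow> 'v" where
  "blk22 M b = snd (M (0, b))"
definition Diag :: "('u \<Rightarrow> 'u) \<Rightarrow> ('v \<Rightarrow> 'v) \<Rightarrow> 'u \<times> 'v \<Rightarrow> 'u \<times> 'v" where
  "Diag F G = (\<lambda>(a, b). (F a, G b))"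

definition edom :: "('a \<Rightarrow> ereal) \<Rightarrow> 'a set" where
  "edom f = {x. f x < \<infinity>}"

definition closed_proper_convex :: "('a::real_normed_vector \<Rightarrow> ereal) \<Rightarrow> bool" where
  "closed_proper_convex f \<longleftrightarrow>
     (\<forall>x. f x \<noteq> -\<infinity>) \<and> edom f \<noteq> {} \<and>
     convex {(x, t::real). f x \<le> ereal t} \<and> closed {(x, t::real). f x \<le> ereal t}"

definition subdiff :: "('a::real_inner \<Rightarrow> ereal) \<Rightarrow> 'a \<Rightarrow> 'a set" where
  "subdiff f x = {g. f x < \<infinity> \<and> (\<forall>y. f x + ereal (inner g (y - x)) \<le> f y)}"

text \<open>Clarke's generalized Hessian of \<phi>, given its gradient g: convex hull of limits of
  Hessians (derivatives of g) at points w^j \<longrightarrow> w where g is differentiable.\<close>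
definition gen_hessian :: "('a::euclidean_space \<Rightarrow> 'a) \<Rightarrow> 'a \<Rightarrow> ('a \<Rightarrow>\<^sub>L 'a) set" where
  "gen_hessian g w = convex hull
     {H. \<exists>ws Hs. (\<forall>j. (g has_derivative blinfun_apply (Hs j)) (at (ws j))) \<and>
                  ws \<longlonglongrightarrow> w \<and> Hs \<longlonglongrightarrow> H}"

definition is_optimal ::
  "('u::euclidean_space \<Rightarrow> ereal) \<Rightarrow> ('v::euclidean_space \<Rightarrow> ereal) \<Rightarrow> ('u \<times> 'v \<Rightarrow> real) \<Rightarrow>
   ('x::euclidean_space \<Rightarrow> 'u) \<Rightarrow> ('x \<Rightarrow> 'v) \<Rightarrow> 'x \<Rightarrow> 'u \<Rightarrow> 'v \<Rightarrow> bool" where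
  "is_optimal p q \<phi> A B c u v \<longleftrightarrow>
     adjoint A u + adjoint B v = c \<and>
     (\<forall>u' v'. adjoint A u' + adjoint B v' = c \<longrightarrow>
        p u + q v + ereal (\<phi> (u, v)) \<le> p u' + q v' + ereal (\<phi> (u', v')))"

definition is_KKT ::
  "('u::euclidean_space \<Rightarrow> ereal) \<Rightarrow> ('v::euclidean_space \<Rightarrow> ereal) \<Rightarrow> ('u \<times> 'v \<Rightarrow> 'u \<times> 'v) \<Rightarrow>
   ('x::euclidean_space \<Rightarrow> 'u) \<Rightarrow> ('x \<Rightarrow> 'v) \<Rightarrow> 'x \<Rightarrow> 'u \<Rightarrow> 'v \<Rightarrow> 'x \<Rightarrow> bool" where
  "is_KKT p q g A B c u v x \<longleftrightarrow>
     (\<exists>gp \<in> subdiff p u. \<exists>gq \<in> subdiff q v.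
        0 = g (u, v) + (gp + A x, gq + B x)) \<and>
     adjoint A u + adjoint B v = c"

definition Lhat ::
  "('u::euclidean_space \<Rightarrow> ereal) \<Rightarrow> ('v::euclidean_space \<Rightarrow> ereal) \<Rightarrow> ('u \<times> 'v \<Rightarrow> real) \<Rightarrow>
   ('u \<times> 'v \<Rightarrow> 'u \<times> 'v) \<Rightarrow> ('u \<times> 'v \<Rightarrow> 'u \<times> 'v) \<Rightarrow> ('u \<times> 'v \<Rightarrow> 'u \<times> 'v) \<Rightarrow>
   ('x::euclidean_space \<Rightarrow> 'u) \<Rightarrow> ('x \<Rightarrow> 'v) \<Rightarrow> 'x \<Rightarrow> real \<Rightarrow>
   'u \<Rightarrow> 'v \<Rightarrow> 'x \<Rightarrow> 'u \<times> 'v \<Rightarrow> ereal" where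
  "Lhat p q \<phi> g Q H A B c \<sigma> u v x w' =
     p u + q v + ereal (\<phi> w' + inner (g w') ((u, v) - w')
       + 1/2 * inner ((u, v) - w') (Q ((u, v) - w') + H ((u, v) - w'))
       + inner x (adjoint A u + adjoint B v - c)
       + \<sigma> / 2 * (norm (adjoint A u + adjoint B v - c))\<^sup>2)"

definition converges_to_KKT ::
  "('u::euclidean_space \<Rightarrow> ereal) \<Rightarrow> ('v::euclidean_space \<Rightarrow> ereal) \<Rightarrow> ('u \<times> 'v \<Rightarrow> real) \<Rightarrow>
   ('u \<times> 'v \<Rightarrow> 'u \<times> 'v) \<Rightarrow> ('x::euclidean_space \<Rightarrow> 'u) \<Rightarrow> ('x \<Rightarrow> 'v) \<Rightarrow> 'x \<Rightarrow>
   (nat \<Rightarrow> 'u) \<Rightarrow> (nat \<Rightarrow> 'v) \<Rightarrow> (nat \<Rightarrow> 'x) \<Rightarrow> bool" where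
  "converges_to_KKT p q \<phi> g A B c u v x \<longleftrightarrow>
     (\<exists>ui vi xi. u \<longlonglongrightarrow> ui \<and> v \<longlonglongrightarrow> vi \<and> x \<longlonglongrightarrow> xi \<and>
        is_optimal p q \<phi> A B c ui vi \<and> is_KKT p q g A B c ui vi xi)"

end

theory Submission
  imports Defs
begin

text \<open>
  Write \<open>\<Delta>u, \<Delta>v\<close> for the increments of one step, \<open>r\<close> for the constraint residual and measure errors from
  a KKT point, which exists by the relative interior condition. Monotonicity of \<open>\<partial>p\<close> and \<open>\<partial>q\<close>, together
  with the quadratic bounds \<open>Q\<close> and \<open>Q + H\<close> on \<open>\<phi>\<close>, makes
  \<open>\<Psi> = |x|\<^sup>2 / (\<tau>\<sigma>) + |u|\<^sup>2\<close> in \<open>D1 + S\<close> plus \<open>|v|\<^sup>2\<close> in \<open>Q22 + D2 + T + \<sigma>BB*\<close> decrease up to the cross term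
  \<open>2\<sigma>\<langle>B*\<Delta>v, r\<rangle>\<close>. For \<open>\<tau> \<le> 1\<close> a square is completed. For larger \<open>\<tau>\<close> the cross term is estimated by
  monotonicity of \<open>\<partial>q\<close> at two consecutive iterates, and \<open>\<Psi>\<close> is augmented by 3/2 of the \<open>Q\<close>-error and by the
  last increments. The definiteness hypotheses make the dissipated quadratic form positive
  definite, hence the increments and the residual vanish in the limit, cluster points are KKT points, and
  recentring the Lyapunov function at a cluster point yields convergence of the whole sequence.

  The Hessian bounds are only known where the Lipschitz gradient is differentiable; passing to the
  bounds on \<open>\<phi>\<close> needs Rademacher's theorem. In one dimension the derivative is a Radon-Nikodym density, in
  general one integrates along lines. Averaging over a small ball then gives the mean value inequality.
\<close>

section \<open>Rademacher's theorem\<close>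

text \<open>Averaging is needed because one segment may lie entirely in the null set where the
  gradient is not differentiable. Symmetry of a Hessian existing at a single point is needed too:
  the \<eta>-bound concerns the block from \<open>v\<close> to \<open>u\<close>, while comparing two
  \<open>v\<close>-steps tests the transposed block. The \<open>Q\<close>-errors in the descent
  estimate are taken at mixed points with new \<open>u\<close> and old \<open>v\<close>. For \<tau>
  \<le> 1 they therefore control the staggered increments \<open>(du (Suc k), dv k)\<close>; in the
  other range the increments \<open>(du (Suc k), dv (Suc k))\<close> are reached. \<Psi> does not
  see the whole \<open>u\<close>-error. What is missing is recovered from the dissipated
  \<open>Q\<close>-errors and from the residual, so that Lyapunov values bound the iterates only at
  a later index. The limit (1 + sqrt 5) / 2 is the positive root of 1 + \<tau> - \<tau>^2, which is
  the margin left by a Young inequality; the 1/4 in M is what a sum-of-squares identity leaves of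
  \<open>Q\<close>.\<close>

lemma negligible_imp_AE_lborel:
  assumes "negligible N" and "\<And>x. x \<notin> N \<Longrightarrow> P x"
  shows "AE x in lborel. P x"
proof -
  have "AE x in lebesgue. x \<notin> N"
    using assms(1) by (simp add: AE_not_in negligible_iff_null_sets)
  then have "AE x in lborel. x \<notin> N"
    by (simp add: AE_completion_iff)
  then show ?thesis using assms(2) by auto
qed

text \<open>Adding a multiple of the identity makes \<open>f\<close> strictly increasing, so that
  its Stieltjes measure is the image of Lebesgue measure under the inverse function. The measure has
  a density because Lipschitz maps preserve null sets, and Lebesgue differentiation of the density
  yields the limit.\<close>

lemma lipschitz_AE_convergent_quotients:
  fixes f :: "real \<Rightarrow> real"
  assumes lip: "\<And>s t. \<bar>f s - f t\<bar> \<le> M * \<bar>s - t\<bar>"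
  shows "AE t in lborel. convergent (\<lambda>n. (f (t + 1 / Suc n) - f t) * Suc n)"
proof -
  \<comment> \<open>The slope \<open>M + 1\<close> makes \<open>G\<close> grow at rate at least 1,
    which gives injectivity and surjectivity at once.\<close>
  define G where "G t = f t + (M + 1) * t" for t
  have M0: "0 \<le> M" using lip[of 0 1] by (smt (verit) abs_ge_zero mult_cancel_left1)
  have Gdiff: "t - s \<le> G t - G s" if "s \<le> t" for s t
    using lip[of s t] that unfolding G_def by (auto simp: algebra_simps)
  have Glip: "\<bar>G t - G s\<bar> \<le> (2 * M + 1) * \<bar>t - s\<bar>" for s t
  proof -
    have "\<bar>G t - G s\<bar> \<le> \<bar>f t - f s\<bar> + \<bar>(M + 1) * (t - s)\<bar>"
      unfolding G_def by (simp add: algebra_simps)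
    also have "\<dots> \<le> M * \<bar>t - s\<bar> + (M + 1) * \<bar>t - s\<bar>"
      using lip[of t s] M0 by (simp add: abs_mult)
    finally show ?thesis by (simp add: algebra_simps)
  qed
  have Gmono: "strict_mono G" using Gdiff by (smt (verit) strict_monoI)
  have "(2 * M + 1)-lipschitz_on UNIV G"
    by (rule lipschitz_onI) (use Glip M0 in \<open>auto simp: dist_real_def\<close>)
  then have Gcont: "continuous_on UNIV G" by (rule lipschitz_on_continuous_on)
  have Gsurj: "\<exists>t. G t = y" for y
  proof -
    define b where "b = \<bar>y - G 0\<bar>"
    have "G (- b) \<le> y" "y \<le> G b" "- b \<le> b"
      using Gdiff[of 0 b] Gdiff[of "-b" 0] unfolding b_def by auto
    then show ?thesis
      using IVT'[of G "-b" y b] Gcont continuous_on_subset by blast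
  qed
  define K where "K = inv G"
  have GK: "G (K y) = y" for y
    unfolding K_def using Gsurj by (metis f_inv_into_f rangeI)
  have KG: "K (G t) = t" for t
    unfolding K_def using Gmono by (simp add: strict_mono_imp_inj_on inv_f_f)
  have "mono K"
    by (rule monoI) (metis GK Gmono strict_mono_less_eq)
  then have Kmeas [measurable]: "K \<in> borel_measurable borel" by (rule borel_measurable_mono)
  \<comment> \<open>The Stieltjes measure of \<open>G\<close>: the preimage of \<open>{a..b}\<close>
    under \<open>K\<close> is \<open>{G a..G b}\<close>.\<close>
  define N where "N = distr lborel borel K"
  have ac: "absolutely_continuous lborel N"
    unfolding absolutely_continuous_def
  proof
    fix X assume X: "X \<in> null_sets (lborel :: real measure)"
    then have Xb [measurable]: "X \<in> sets borel" by auto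
    have "negligible (G ` X)"
    proof (rule negligible_locally_Lipschitz_image)
      show "negligible X"
        using X by (simp add: negligible_iff_null_sets null_sets_completionI)
      show "\<exists>T B. open T \<and> t \<in> T \<and> (\<forall>y\<in>X \<inter> T. norm (G y - G t) \<le> B * norm (y - t))" for t
        using Glip by (intro exI[of _ UNIV]) auto
    qed auto
    moreover have "K -` X = G ` X"
      using GK KG by (metis (no_types, lifting) image_eqI subsetI subset_antisym vimageE vimageI image_subset_iff)
    moreover have "K -` X \<in> sets borel" using measurable_sets[OF Kmeas Xb] by simp
    ultimately have "K -` X \<in> null_sets lborel"
      by (simp add: negligible_iff_null_sets null_sets_completion_iff)
    then show "X \<in> null_sets N"
      by (simp add: N_def null_sets_def emeasure_distr)
  qed
  obtain h where h [measurable]: "h \<in> borel_measurable lborel" and hN: "density lborel h = N"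
    using sigma_finite_measure.Radon_Nikodym[OF sigma_finite_lborel ac] by (auto simp: N_def)
  have hint: "(\<integral>\<^sup>+ t. h t * indicator {a..b} t \<partial>lborel) = ennreal (G b - G a)" if "a \<le> b" for a b
  proof -
    have "K -` {a..b} = {G a..G b}"
      using GK KG Gmono \<open>mono K\<close> by (auto simp: strict_mono_less_eq) (metis GK Gmono strict_mono_less_eq)+
    then have "emeasure N {a..b} = ennreal (G b - G a)"
      using Gmono that by (simp add: N_def emeasure_distr strict_mono_less_eq)
    then show ?thesis
      unfolding hN[symmetric] by (simp add: emeasure_density)
  qed
  have hfin: "AE t in lborel. h t \<noteq> \<infinity>"
  proof -
    have "AE t in lborel. h t * indicator {- real n..real n} t \<noteq> \<infinity>" for n
      by (rule nn_integral_PInf_AE) (use hint[of "- real n" "real n"] in auto)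
    then have "AE t in lborel. \<forall>n. h t * indicator {- real n..real n} t \<noteq> \<infinity>"
      by (simp add: AE_all_countable)
    then show ?thesis
    proof (rule AE_mp, intro AE_I2 impI)
      fix t assume *: "\<forall>n. h t * indicator {- real n..real n} t \<noteq> \<infinity>"
      obtain n where "\<bar>t\<bar> \<le> real n" using real_arch_simple by blast
      then show "h t \<noteq> \<infinity>" using *[rule_format, of n] by (auto simp: abs_le_iff)
    qed
  qed
  \<comment> \<open>\<open>enn2real\<close> sends \<infinity> to 0; by \<open>hfin\<close> this
    alters \<open>h\<close> only on a null set.\<close>
  define h' where "h' t = enn2real (h t)" for t
  have h'int: "(h' has_integral (G b - G a)) {a..b}" if "a \<le> b" for a b
  proof -
    have "(\<integral>\<^sup>+ t. ennreal (h' t * indicator {a..b} t) \<partial>lborel) = (\<integral>\<^sup>+ t. h t * indicator {a..b} t \<partial>lborel)"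
      by (rule nn_integral_cong_AE, use hfin in eventually_elim)
        (auto simp: h'_def ennreal_enn2real_if indicator_def)
    then have "((\<lambda>t. h' t * indicator {a..b} t) has_integral (G b - G a)) UNIV"
      using Gmono that hint[OF that]
      by (intro nn_integral_has_integral) (auto simp: h'_def strict_mono_less_eq)
    moreover have "(\<lambda>t. h' t * indicator {a..b} t) = (\<lambda>t. if t \<in> {a..b} then h' t else 0)"
      by (auto simp: indicator_def)
    ultimately show ?thesis by (simp only: has_integral_restrict_UNIV)
  qed
  have "h' integrable_on cbox a b" for a b
    using h'int[of a b] by (cases "a \<le> b") (auto simp: integrable_on_def)
  \<comment> \<open>Differentiation over intervals with left end \<open>t\<close>: their averages
    are exactly the right difference quotients of \<open>G\<close>.\<close>
  from integrable_ccontinuous_explicit[OF this] obtain N0 where N0: "negligible N0" and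
    lim: "\<And>t e. \<lbrakk>t \<notin> N0; 0 < e\<rbrakk> \<Longrightarrow>
       \<exists>d>0. \<forall>k. 0 < k \<and> k < d \<longrightarrow> norm (integral (cbox t (t + k *\<^sub>R One)) h' /\<^sub>R k ^ DIM(real) - h' t) < e"
    by metis
  have "convergent (\<lambda>n. (f (t + 1 / Suc n) - f t) * Suc n)" if tN: "t \<notin> N0" for t
  proof -
    have "(\<lambda>n. (G (t + 1 / Suc n) - G t) * Suc n) \<longlonglongrightarrow> h' t"
    proof (rule LIMSEQ_I)
      fix e :: real assume "0 < e"
      then obtain d where d: "d > 0"
        "\<And>k. 0 < k \<and> k < d \<longrightarrow> norm (integral (cbox t (t + k *\<^sub>R One)) h' /\<^sub>R k ^ DIM(real) - h' t) < e"
        using lim[OF tN] by blast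
      obtain n0 where n0: "1 / Suc n0 < d" using d(1) nat_approx_posE by blast
      show "\<exists>no. \<forall>n\<ge>no. norm ((G (t + 1 / Suc n) - G t) * Suc n - h' t) < e"
      proof (intro exI[of _ n0] allI impI)
        fix n assume "n0 \<le> n"
        then have "1 / real (Suc n) \<le> 1 / Suc n0" by (simp add: frac_le)
        with n0 have "1 / real (Suc n) < d" by simp
        moreover have "integral {t..t + 1 / real (Suc n)} h' = G (t + 1 / Suc n) - G t"
          by (rule integral_unique[OF h'int]) simp
        ultimately show "norm ((G (t + 1 / Suc n) - G t) * Suc n - h' t) < e"
          using d(2)[of "1 / real (Suc n)"] by (simp del: of_nat_Suc add: mult.commute)
      qed
    qed
    then have "(\<lambda>n. (G (t + 1 / Suc n) - G t) * Suc n - (M + 1)) \<longlonglongrightarrow> h' t - (M + 1)"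
      by (intro tendsto_intros)
    moreover have "(G (t + 1 / Suc n) - G t) * Suc n - (M + 1) = (f (t + 1 / Suc n) - f t) * Suc n" for n
      unfolding G_def by (simp add: field_simps)
    ultimately show ?thesis by (auto simp: convergent_def)
  qed
  with N0 show ?thesis by (rule negligible_imp_AE_lborel)
qed

section \<open>Directional difference quotients of a Lipschitz function\<close>

definition dquot :: "('a::real_vector \<Rightarrow> real) \<Rightarrow> 'a \<Rightarrow> 'a \<Rightarrow> nat \<Rightarrow> real" where
  "dquot f d x n = (f (x + (1 / real (Suc n)) *\<^sub>R d) - f x) * real (Suc n)"

text \<open>Restricting to the step lengths \<open>1 / Suc n\<close> makes the limit Borel
  measurable. Where the quotients diverge, \<open>lim\<close> is an unspecified value;
  \<open>AE_convergent_dquot\<close> confines this to a null set.\<close>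

definition dird :: "('a::real_vector \<Rightarrow> real) \<Rightarrow> 'a \<Rightarrow> 'a \<Rightarrow> real" where
  "dird f d x = lim (dquot f d x)"

lemma measurable_dquot [measurable]:
  fixes f :: "'a::euclidean_space \<Rightarrow> real"
  assumes [measurable]: "f \<in> borel_measurable borel"
  shows "(\<lambda>x. dquot f d x n) \<in> borel_measurable borel"
  unfolding dquot_def by measurable

lemma measurable_dird [measurable]:
  fixes f :: "'a::euclidean_space \<Rightarrow> real"
  assumes [measurable]: "f \<in> borel_measurable borel"
  shows "dird f d \<in> borel_measurable borel"
proof -
  have "(\<lambda>x. lim (\<lambda>n. dquot f d x n)) \<in> borel_measurable borel"
    by (rule borel_measurable_lim_metric) measurable
  then show ?thesis by (simp add: dird_def[abs_def])
qed

lemma lborel_integral_translation: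
  fixes F :: "'a::euclidean_space \<Rightarrow> real"
  assumes [measurable]: "F \<in> borel_measurable borel"
  shows "(\<integral>x. F (c + x) \<partial>lborel) = (\<integral>x. F x \<partial>lborel)"
proof -
  have "(\<integral>x. F x \<partial>lborel) = (\<integral>x. F x \<partial>distr lborel borel ((+) c))"
    by (simp add: lborel_distr_plus)
  also have "\<dots> = (\<integral>x. F (c + x) \<partial>lborel)"
    by (rule integral_distr) auto
  finally show ?thesis by simp
qed

lemma integrable_indicator_cbox: "integrable lborel (indicator (cbox a b) :: 'a::euclidean_space \<Rightarrow> real)"
  using emeasure_lborel_cbox_finite[of a b] by (simp add: integrable_indicator_iff less_top)

locale lipschitz_fun =
  fixes f :: "'a::euclidean_space \<Rightarrow> real" and L :: real
  assumes lip: "\<And>x y. \<bar>f x - f y\<bar> \<le> L * norm (x - y)"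
begin

lemma L_nonneg: "0 \<le> L"
proof -
  obtain b :: 'a where "b \<in> Basis" using nonempty_Basis by blast
  then have "\<bar>f b - f 0\<bar> \<le> L" using lip[of b 0] by simp
  then show ?thesis by linarith
qed

lemma continuous: "continuous_on S f"
proof -
  have "L-lipschitz_on S f"
    by (rule lipschitz_onI) (use lip L_nonneg in \<open>auto simp: dist_norm\<close>)
  then show ?thesis by (rule lipschitz_on_continuous_on)
qed

lemma measurable_f [measurable]: "f \<in> borel_measurable borel"
  by (intro borel_measurable_continuous_onI continuous)

lemma dquot_bound: "\<bar>dquot f d x n\<bar> \<le> L * norm d"
proof -
  have "\<bar>dquot f d x n\<bar> \<le> (L * norm ((1 / real (Suc n)) *\<^sub>R d)) * real (Suc n)"
    using lip[of "x + (1 / real (Suc n)) *\<^sub>R d" x] unfolding dquot_def abs_mult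
    by (intro mult_mono) auto
  also have "\<dots> = L * norm d" by (simp add: field_simps)
  finally show ?thesis .
qed

lemma AE_convergent_dquot: "AE x in lborel. convergent (dquot f d x)"
proof -
  \<comment> \<open>Divergence is expressed through \<open>Cauchy\<close> so that the set is Borel,
    as the exchange of integrals requires.\<close>
  define N where "N = {x. \<not> Cauchy (dquot f d x)}"
  have "{x \<in> space borel. Cauchy (\<lambda>n. dquot f d x n)} \<in> sets borel"
    by (rule sets_Collect_Cauchy) measurable
  then have "space borel - {x \<in> space borel. Cauchy (\<lambda>n. dquot f d x n)} \<in> sets borel"
    by (rule sets.compl_sets)
  moreover have "space borel - {x \<in> space borel. Cauchy (\<lambda>n. dquot f d x n)} = N"
    by (auto simp: N_def)
  ultimately have N [measurable]: "N \<in> sets borel" by (simp only:)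
  have line: "AE t in lborel. x + t *\<^sub>R d \<notin> N" for x
  proof -
    have "AE t in lborel. convergent (\<lambda>n. (f (x + (t + 1 / real (Suc n)) *\<^sub>R d) - f (x + t *\<^sub>R d)) * real (Suc n))"
    proof (rule lipschitz_AE_convergent_quotients[where M = "L * norm d"])
      fix s t :: real
      have "x + s *\<^sub>R d - (x + t *\<^sub>R d) = (s - t) *\<^sub>R d" by (simp add: algebra_simps)
      then show "\<bar>f (x + s *\<^sub>R d) - f (x + t *\<^sub>R d)\<bar> \<le> L * norm d * \<bar>s - t\<bar>"
        using lip[of "x + s *\<^sub>R d" "x + t *\<^sub>R d"] by (simp add: mult_ac)
    qed
    then show ?thesis
    proof eventually_elim
      case (elim t)
      then have "convergent (dquot f d (x + t *\<^sub>R d))"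
        by (simp add: dquot_def[abs_def] scaleR_add_left add.assoc)
      then show ?case by (simp add: N_def convergent_Cauchy)
    qed
  qed
  have shift: "(\<integral>\<^sup>+ x. indicator N (x + t *\<^sub>R d) \<partial>lborel) = emeasure lborel N" for t
  proof -
    have "emeasure lborel N = (\<integral>\<^sup>+ x. indicator N x \<partial>distr lborel borel ((+) (t *\<^sub>R d)))"
      by (simp add: lborel_distr_plus)
    also have "\<dots> = (\<integral>\<^sup>+ x. indicator N (t *\<^sub>R d + x) \<partial>lborel)"
      by (rule nn_integral_distr) auto
    finally show ?thesis by (simp add: add.commute)
  qed
  \<comment> \<open>Averaging \<open>N\<close> over its translates along \<open>d\<close> and exchanging the integrals reduces to the lines.\<close>
  have "emeasure lborel N = (\<integral>\<^sup>+ t. indicator {0..1::real} t * emeasure lborel N \<partial>lborel)"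
    by (subst nn_integral_multc) auto
  also have "\<dots> = (\<integral>\<^sup>+ t. (\<integral>\<^sup>+ x. indicator {0..1::real} t * indicator N (x + t *\<^sub>R d) \<partial>lborel) \<partial>lborel)"
    by (subst nn_integral_cmult) (auto simp: shift)
  also have "\<dots> = (\<integral>\<^sup>+ x. (\<integral>\<^sup>+ t. indicator {0..1::real} t * indicator N (x + t *\<^sub>R d) \<partial>lborel) \<partial>lborel)"
    by (rule lborel_pair.Fubini') measurable
  also have "\<dots> = 0"
  proof -
    have "(\<integral>\<^sup>+ t. indicator {0..1::real} t * indicator N (x + t *\<^sub>R d) \<partial>lborel) = 0" for x
      by (subst nn_integral_0_iff_AE) (use line[of x] in \<open>auto simp: indicator_def elim!: AE_mp\<close>)
    then show ?thesis by simp
  qed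
  finally have "N \<in> null_sets lborel" by auto
  then have "AE x in lborel. x \<notin> N" by (rule AE_not_in)
  then show ?thesis by (simp add: N_def Cauchy_convergent_iff)
qed

lemma dquot_tendsto_dird: "convergent (dquot f d x) \<Longrightarrow> dquot f d x \<longlonglongrightarrow> dird f d x"
  by (simp add: convergent_LIMSEQ_iff dird_def)

lemma dird_bound: "convergent (dquot f d x) \<Longrightarrow> \<bar>dird f d x\<bar> \<le> L * norm d"
  by (rule LIMSEQ_le_const2[OF tendsto_rabs[OF dquot_tendsto_dird]]) (use dquot_bound in auto)

text \<open>Between step lengths \<open>h \<le> k\<close> the function changes by at most a multiple
  of \<open>k - h\<close>. If \<open>k\<close> is the next reciprocal of an integer above
  \<open>h\<close>, this is of order \<open>h^2\<close>, so the sequence already determines the full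
  right-hand limit.\<close>

lemma right_limit_of_dquot:
  assumes lim: "dquot f d x \<longlonglongrightarrow> l"
  shows "((\<lambda>h. (f (x + h *\<^sub>R d) - f x) / h) \<longlongrightarrow> l) (at_right 0)"
proof (rule tendstoI)
  fix e :: real assume e: "0 < e"
  define C where "C = L * norm d + \<bar>l\<bar>"
  have C: "0 \<le> C" using L_nonneg by (simp add: C_def)
  obtain n0 where n0: "\<And>n. n \<ge> n0 \<Longrightarrow> \<bar>dquot f d x n - l\<bar> < e / 4"
    using LIMSEQ_D[OF lim, of "e / 4"] e by auto
  \<comment> \<open>The first bound forces \<open>n \<ge> n0\<close>; the second makes the Lipschitz
    error \<open>2 * C * h * h\<close> smaller than \<open>e / 2 * h\<close>.\<close>
  define \<delta> where "\<delta> = min (1 / (real n0 + 2)) (e / (4 * (C + 1)))"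
  have "\<delta> > 0" using e C by (simp add: \<delta>_def)
  moreover have "dist ((f (x + h *\<^sub>R d) - f x) / h) l < e" if h: "0 < h" "h < \<delta>" for h
  proof -
    \<comment> \<open>\<open>Suc n\<close> is the floor of \<open>1 / h\<close>, hence
      \<open>1 / (n + 2) < h \<le> 1 / (n + 1)\<close>.\<close>
    define n where "n = nat \<lfloor>1 / h\<rfloor> - 1"
    define k where "k = 1 / real (Suc n)"
    have "1 / (1 / (real n0 + 2)) < 1 / h"
      using h by (intro divide_strict_left_mono) (auto simp: \<delta>_def)
    then have hn: "real n0 + 2 < 1 / h" by simp
    then have fl: "int n0 + 2 \<le> \<lfloor>1 / h\<rfloor>" by (simp add: le_floor_iff)
    have Sn: "real (Suc n) = of_int \<lfloor>1 / h\<rfloor>"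
      using fl unfolding n_def by (auto simp: of_nat_diff nat_eq_iff)
    have n_ge: "n \<ge> n0" using fl unfolding n_def by linarith
    have "real (Suc n) \<le> 1 / h" "1 / h < real (Suc n) + 1" unfolding Sn by linarith+
    then have 1: "h * real (Suc n) \<le> 1" "1 < h * (real (Suc n) + 1)"
      using h(1) by (auto simp: field_simps)
    have "h \<le> k" using 1 unfolding k_def by (simp add: field_simps)
    have k2: "k \<le> 2 * h"
    proof -
      have "1 \<le> h * (real (Suc n) + real (Suc n))"
      proof -
        have "h * (real (Suc n) + real (Suc n)) = h * (real (Suc n) + 1) + h * real n"
          by (simp add: algebra_simps)
        moreover have "0 \<le> h * real n" using h(1) by simp
        ultimately show ?thesis using 1(2) by linarith
      qed
      then show ?thesis unfolding k_def by (simp add: field_simps)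
    qed
    have kh: "k - h \<le> k * h"
    proof -
      have "k - h = k * (1 - h * real (Suc n))"
        by (simp add: k_def right_diff_distrib del: of_nat_Suc)
      also have "\<dots> \<le> k * h"
        using 1(2) by (intro mult_left_mono) (auto simp: k_def algebra_simps)
      finally show ?thesis .
    qed
    have "\<bar>f (x + h *\<^sub>R d) - f (x + k *\<^sub>R d)\<bar> \<le> L * norm ((h - k) *\<^sub>R d)"
      using lip[of "x + h *\<^sub>R d" "x + k *\<^sub>R d"] by (simp add: algebra_simps)
    also have "\<dots> = (L * norm d) * (k - h)" using \<open>h \<le> k\<close> by simp
    finally have a: "\<bar>f (x + h *\<^sub>R d) - f (x + k *\<^sub>R d)\<bar> \<le> (L * norm d) * (k - h)" .
    have "dquot f d x n * k = f (x + k *\<^sub>R d) - f x"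
      by (simp add: dquot_def k_def)
    then have "f (x + k *\<^sub>R d) - f x - k * l = (dquot f d x n - l) * k" by (simp add: algebra_simps)
    then have "\<bar>f (x + k *\<^sub>R d) - f x - k * l\<bar> = \<bar>dquot f d x n - l\<bar> * k"
      by (simp add: abs_mult k_def)
    also have "\<dots> \<le> (e / 4) * k" using n0[OF n_ge] by (intro mult_right_mono) (auto simp: k_def)
    also have "\<dots> \<le> (e / 4) * (2 * h)" using k2 e by (intro mult_left_mono) auto
    finally have b: "\<bar>f (x + k *\<^sub>R d) - f x - k * l\<bar> \<le> e / 2 * h" by simp
    have c: "\<bar>(k - h) * l\<bar> = \<bar>l\<bar> * (k - h)" using \<open>h \<le> k\<close> by (simp add: abs_mult)
    have "\<bar>f (x + h *\<^sub>R d) - f x - h * l\<bar> \<le> e / 2 * h + C * (k - h)"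
    proof -
      have "f (x + h *\<^sub>R d) - f x - h * l = (f (x + h *\<^sub>R d) - f (x + k *\<^sub>R d))
          + (f (x + k *\<^sub>R d) - f x - k * l) + (k - h) * l"
        by (simp add: algebra_simps)
      moreover have "C * (k - h) = L * norm d * (k - h) + \<bar>l\<bar> * (k - h)"
        by (simp add: C_def algebra_simps)
      moreover have "\<bar>r + s + t\<bar> \<le> \<bar>r\<bar> + \<bar>s\<bar> + \<bar>t\<bar>" for r s t :: real by linarith
      ultimately show ?thesis using a b c by (smt (verit))
    qed
    also have "\<dots> \<le> e / 2 * h + C * (2 * h * h)"
    proof -
      have "k - h \<le> 2 * h * h" using kh k2 h(1) by (meson mult_right_mono order_trans less_imp_le)
      then show ?thesis using C by (simp add: mult_left_mono)
    qed
    also have "\<dots> < e * h"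
    proof -
      have "h * (4 * (C + 1)) < e" using h C by (auto simp: \<delta>_def field_simps)
      then have "4 * C * h < e" using h(1) by (simp add: algebra_simps)
      then have "2 * C * h < e / 2" by simp
      then have "2 * C * h * h < e / 2 * h" using h(1) by (intro mult_strict_right_mono)
      then show ?thesis by (simp add: algebra_simps)
    qed
    finally have "\<bar>f (x + h *\<^sub>R d) - f x - h * l\<bar> / h < e" using h(1) by (simp add: field_simps)
    moreover have "(f (x + h *\<^sub>R d) - f x) / h - l = (f (x + h *\<^sub>R d) - f x - h * l) / h"
      using h(1) by (simp add: field_simps)
    ultimately show ?thesis using h(1) by (simp add: dist_real_def abs_divide)
  qed
  ultimately show "\<forall>\<^sub>F h in at_right 0. dist ((f (x + h *\<^sub>R d) - f x) / h) l < e"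
    unfolding eventually_at_right_field by (intro exI[of _ \<delta>]) auto
qed

text \<open>The steps \<open>s / Suc n\<close> are in general not of the form
  \<open>1 / Suc m\<close>, whence the appeal to the full right-hand limit. Negative factors are
  reached only after integration, through additivity.\<close>

lemma dird_scale:
  assumes "convergent (dquot f d x)" and s: "0 < s"
  shows "dird f (s *\<^sub>R d) x = s * dird f d x"
proof -
  have "filterlim (\<lambda>n. s / real (Suc n)) (at_right 0) sequentially"
    using tendsto_mult_right_zero[OF LIMSEQ_inverse_real_of_nat, of s] s
    by (intro tendsto_imp_filterlim_at_right) (auto simp: field_simps)
  from filterlim_compose[OF right_limit_of_dquot[OF dquot_tendsto_dird[OF assms(1)]] this]
  have "(\<lambda>n. s * ((f (x + (s / real (Suc n)) *\<^sub>R d) - f x) / (s / real (Suc n)))) \<longlonglongrightarrow> s * dird f d x"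
    by (rule tendsto_mult_left)
  moreover have "s * ((f (x + (s / real (Suc n)) *\<^sub>R d) - f x) / (s / real (Suc n))) = dquot f (s *\<^sub>R d) x n" for n
    using s by (simp add: dquot_def field_simps)
  ultimately have "dquot f (s *\<^sub>R d) x \<longlonglongrightarrow> s * dird f d x" by (simp add: fun_eq_iff[symmetric])
  then show ?thesis by (simp add: dird_def limI)
qed

text \<open>Prepares additivity in the direction: translation invariance will move a shift of the
  argument of \<open>dquot\<close> onto the box, and the indicators of the shifted boxes converge
  off the frontier, a null set.\<close>

lemma integral_shifted_dquot_tendsto:
  "(\<lambda>n. \<integral>x. indicator (cbox a b) (x - (1 / real (Suc n)) *\<^sub>R d) * dquot f e x n \<partial>lborel)
     \<longlonglongrightarrow> (\<integral>x. indicator (cbox a b) x * dird f e x \<partial>lborel)"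
proof -
  obtain R where R: "cbox a b \<subseteq> cball 0 R"
    using bounded_cbox[of a b] by (force simp: bounded_iff)
  have ind: "(\<lambda>n. indicator (cbox a b) (x - (1 / real (Suc n)) *\<^sub>R d) :: real) \<longlonglongrightarrow> indicator (cbox a b) x"
    if "x \<notin> frontier (cbox a b)" for x
  proof -
    have "(\<lambda>n. x - inverse (real (Suc n)) *\<^sub>R d) \<longlonglongrightarrow> x - 0 *\<^sub>R d"
      by (intro tendsto_intros LIMSEQ_inverse_real_of_nat)
    then have lim: "(\<lambda>n. x - (1 / real (Suc n)) *\<^sub>R d) \<longlonglongrightarrow> x" by (simp add: inverse_eq_divide)
    show ?thesis
    proof (cases "x \<in> interior (cbox a b)")
      case True
      then have "\<forall>\<^sub>F n in sequentially. x - (1 / real (Suc n)) *\<^sub>R d \<in> interior (cbox a b)"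
        using topological_tendstoD[OF lim open_interior] by blast
      then have "\<forall>\<^sub>F n in sequentially.
          indicator (cbox a b) (x - (1 / real (Suc n)) *\<^sub>R d) = (indicator (cbox a b) x :: real)"
        by eventually_elim (use True interior_subset in \<open>force simp: indicator_def\<close>)
      then show ?thesis by (rule tendsto_eventually)
    next
      case False
      with that have "x \<in> - cbox a b" by (auto simp: frontier_def closure_closed)
      then have "\<forall>\<^sub>F n in sequentially. x - (1 / real (Suc n)) *\<^sub>R d \<in> - cbox a b"
        using topological_tendstoD[OF lim open_Compl[OF closed_cbox]] by blast
      then have "\<forall>\<^sub>F n in sequentially.
          indicator (cbox a b) (x - (1 / real (Suc n)) *\<^sub>R d) = (indicator (cbox a b) x :: real)"
        by eventually_elim (use \<open>x \<in> - cbox a b\<close> in \<open>auto simp: indicator_def\<close>)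
      then show ?thesis by (rule tendsto_eventually)
    qed
  qed
  show ?thesis
  proof (rule integral_dominated_convergence[where w = "\<lambda>x. L * norm e * indicator (cball 0 (R + norm d)) x"])
    show "AE x in lborel. (\<lambda>n. indicator (cbox a b) (x - (1 / real (Suc n)) *\<^sub>R d) * dquot f e x n)
            \<longlonglongrightarrow> indicator (cbox a b) x * dird f e x"
    proof -
      have "AE x in lborel. x \<notin> frontier (cbox a b)"
        by (rule negligible_imp_AE_lborel[OF negligible_convex_frontier[OF convex_box(1)]])
      with AE_convergent_dquot[of e] show ?thesis
        by eventually_elim (intro tendsto_mult ind dquot_tendsto_dird)
    qed
    show "integrable lborel (\<lambda>x. L * norm e * indicator (cball 0 (R + norm d)) x)"
      by (intro integrable_mult_right) (use emeasure_lborel_cball_finite[of 0 "R + norm d"] in \<open>simp add: integrable_indicator_iff less_top\<close>)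
    show "AE x in lborel. norm (indicator (cbox a b) (x - (1 / real (Suc n)) *\<^sub>R d) * dquot f e x n)
             \<le> L * norm e * indicator (cball 0 (R + norm d)) x" for n
    proof (rule AE_I2)
      fix x
      have "x \<in> cball 0 (R + norm d)" if "x - (1 / real (Suc n)) *\<^sub>R d \<in> cbox a b"
      proof -
        have "norm (x - (1 / real (Suc n)) *\<^sub>R d) \<le> R" using that R by auto
        moreover have "norm ((1 / real (Suc n)) *\<^sub>R d) \<le> norm d"
          by (simp add: divide_le_eq mult_le_cancel_left1)
        ultimately show ?thesis
          using norm_triangle_sub[of x "(1 / real (Suc n)) *\<^sub>R d"] by simp
      qed
      then show "norm (indicator (cbox a b) (x - (1 / real (Suc n)) *\<^sub>R d) * dquot f e x n)
             \<le> L * norm e * indicator (cball 0 (R + norm d)) x"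
        using dquot_bound[of e x n] L_nonneg by (simp split: split_indicator)
    qed
  qed measurable
qed

lemma integrable_dird: "integrable lborel (\<lambda>x. indicator (cbox a b) x * dird f e x)"
proof (rule Bochner_Integration.integrable_bound[where f = "\<lambda>x. L * norm e * indicator (cbox a b) x"])
  show "AE x in lborel. norm (indicator (cbox a b) x * dird f e x) \<le> norm (L * norm e * indicator (cbox a b) x)"
    using AE_convergent_dquot[of e]
    by eventually_elim (use dird_bound L_nonneg in \<open>auto simp: indicator_def\<close>)
qed (auto intro!: integrable_mult_right integrable_indicator_cbox simp del: integrable_mult_right_iff)

text \<open>Additivity in \<open>d\<close> is not yet available pointwise. But a step along
  \<open>d + e\<close> is a step along \<open>d\<close> followed by one along \<open>e\<close> from
  a shifted point, and under the integral the shift disappears in the limit.\<close>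

lemma linear_integral_dird: "linear (\<lambda>d. \<integral>x. indicator (cbox a b) x * dird f d x \<partial>lborel)"
proof -
  define I where "I d = (\<integral>x. indicator (cbox a b) x * dird f d x \<partial>lborel)" for d
  have add: "I (d + e) = I d + I e" for d e
  proof -
    have int: "integrable lborel (\<lambda>x. indicator (cbox a b) x * dquot f d (c + x) n)" for d c n
      by (rule Bochner_Integration.integrable_bound[where f = "\<lambda>x. L * norm d * indicator (cbox a b) x"])
        (auto intro!: integrable_mult_right integrable_indicator_cbox AE_I2 simp: dquot_bound L_nonneg indicator_eq_0_iff split: split_indicator simp del: integrable_mult_right_iff)
    have "(\<integral>x. indicator (cbox a b) x * dquot f (d + e) x n \<partial>lborel)
       = (\<integral>x. indicator (cbox a b) (x - (1 / real (Suc n)) *\<^sub>R d) * dquot f e x n \<partial>lborel)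
         + (\<integral>x. indicator (cbox a b) x * dquot f d x n \<partial>lborel)" (is "?l n = ?r n + ?s n") for n
    proof -
      have "dquot f (d + e) x n = dquot f e ((1 / real (Suc n)) *\<^sub>R d + x) n + dquot f d x n" for x
        by (simp add: dquot_def algebra_simps)
      then have "?l n = (\<integral>x. indicator (cbox a b) x * dquot f e ((1 / real (Suc n)) *\<^sub>R d + x) n
           + indicator (cbox a b) x * dquot f d x n \<partial>lborel)"
        by (simp only: distrib_left)
      also have "\<dots> = (\<integral>x. indicator (cbox a b) x * dquot f e ((1 / real (Suc n)) *\<^sub>R d + x) n \<partial>lborel) + ?s n"
        using int[of e] int[of d 0] by (intro Bochner_Integration.integral_add) auto
      also have "(\<integral>x. indicator (cbox a b) x * dquot f e ((1 / real (Suc n)) *\<^sub>R d + x) n \<partial>lborel) = ?r n"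
        using lborel_integral_translation[of "\<lambda>x. indicator (cbox a b) (x - (1 / real (Suc n)) *\<^sub>R d) * dquot f e x n"
            "(1 / real (Suc n)) *\<^sub>R d"] by simp
      finally show ?thesis .
    qed
    moreover have "?l \<longlonglongrightarrow> I (d + e)" "?s \<longlonglongrightarrow> I d"
      using integral_shifted_dquot_tendsto[of a b 0] unfolding I_def by simp_all
    moreover have "?r \<longlonglongrightarrow> I e"
      using integral_shifted_dquot_tendsto[of a b d e] unfolding I_def .
    ultimately have "?l \<longlonglongrightarrow> I e + I d" by (simp add: tendsto_add)
    with \<open>?l \<longlonglongrightarrow> I (d + e)\<close> show ?thesis using LIMSEQ_unique by fastforce
  qed
  have pos: "I (s *\<^sub>R d) = s * I d" if "0 < s" for s d
  proof -
    have "I (s *\<^sub>R d) = (\<integral>x. s * (indicator (cbox a b) x * dird f d x) \<partial>lborel)"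
      unfolding I_def
    proof (rule integral_cong_AE)
      show "AE x in lborel. indicator (cbox a b) x * dird f (s *\<^sub>R d) x = s * (indicator (cbox a b) x * dird f d x)"
        using AE_convergent_dquot[of d] by eventually_elim (use that in \<open>simp add: dird_scale\<close>)
    qed measurable
    then show ?thesis by (simp add: I_def)
  qed
  have zero: "I 0 = 0" using add[of 0 0] by simp
  have neg: "I (- d) = - I d" for d using add[of d "- d"] zero by simp
  have "I (s *\<^sub>R d) = s * I d" for s d
  proof (cases s "0 :: real" rule: linorder_cases)
    case less
    then show ?thesis using pos[of "- s" d] neg[of "s *\<^sub>R d"] by simp
  qed (use zero pos in auto)
  then show ?thesis unfolding I_def[symmetric] using add by (intro linearI) auto
qed

text \<open>Both sides have equal integrals over every box by linearity of the integrals, and a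
  function whose box integrals all vanish is zero almost everywhere by Lebesgue
  differentiation.\<close>

lemma AE_dird_linear: "AE x in lborel. dird f d x = (\<Sum>b\<in>Basis. (d \<bullet> b) * dird f b x)"
proof -
  define D where "D x = dird f d x - (\<Sum>b\<in>Basis. (d \<bullet> b) * dird f b x)" for x
  have eq: "indicator (cbox a b) x * D x = indicator (cbox a b) x * dird f d x
      - (\<Sum>b'\<in>Basis. (d \<bullet> b') * (indicator (cbox a b) x * dird f b' x))" for a b x
    unfolding D_def by (simp add: right_diff_distrib sum_distrib_left mult_ac)
  have int: "integrable lborel (\<lambda>x. indicator (cbox a b) x * D x)" for a b
    unfolding eq by (intro Bochner_Integration.integrable_diff Bochner_Integration.integrable_sum
        integrable_mult_right integrable_dird)
  have zero: "(\<integral>x. indicator (cbox a b) x * D x \<partial>lborel) = 0" for a b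
  proof -
    define I where "I d = (\<integral>x. indicator (cbox a b) x * dird f d x \<partial>lborel)" for d
    have "linear I" unfolding I_def by (rule linear_integral_dird)
    have "I d = I (\<Sum>b\<in>Basis. (d \<bullet> b) *\<^sub>R b)" by (simp add: euclidean_representation)
    also have "\<dots> = (\<Sum>b\<in>Basis. (d \<bullet> b) * I b)"
      using \<open>linear I\<close> by (simp add: linear_sum linear_cmul)
    finally have "I d = (\<Sum>b\<in>Basis. (d \<bullet> b) * I b)" .
    moreover have "(\<integral>x. indicator (cbox a b) x * D x \<partial>lborel) = I d - (\<Sum>b\<in>Basis. (d \<bullet> b) * I b)"
      unfolding eq I_def
      by (subst Bochner_Integration.integral_diff)
        (auto intro!: Bochner_Integration.integrable_sum integrable_mult_right integrable_dird
          simp: Bochner_Integration.integral_sum integrable_mult_right integrable_dird)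
    ultimately show ?thesis by simp
  qed
  have set_int: "set_integrable lborel (cbox a b) D" for a b
    using int unfolding set_integrable_def by simp
  have hk: "D integrable_on cbox a b" "integral (cbox a b) D = 0" for a b
    using set_borel_integral_eq_integral[OF set_int] zero
    by (auto simp: set_lebesgue_integral_def)
  obtain N where N: "negligible N" and lim: "\<And>x e. \<lbrakk>x \<notin> N; 0 < e\<rbrakk> \<Longrightarrow>
       \<exists>\<delta>>0. \<forall>h. 0 < h \<and> h < \<delta> \<longrightarrow> norm (integral (cbox x (x + h *\<^sub>R One)) D /\<^sub>R h ^ DIM('a) - D x) < e"
    using integrable_ccontinuous_explicit[OF hk(1)] by metis
  have "D x = 0" if xN: "x \<notin> N" for x
  proof (rule ccontr)
    assume "D x \<noteq> 0"
    then obtain \<delta> where "\<delta> > 0" "\<forall>h. 0 < h \<and> h < \<delta> \<longrightarrow>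
        norm (integral (cbox x (x + h *\<^sub>R One)) D /\<^sub>R h ^ DIM('a) - D x) < \<bar>D x\<bar>"
      using lim[OF xN, of "\<bar>D x\<bar>"] by auto
    then show False
      using dense[of 0 \<delta>] by (auto simp: hk(2))
  qed
  with N have "AE x in lborel. D x = 0" by (rule negligible_imp_AE_lborel)
  then show ?thesis by (simp add: D_def)
qed

text \<open>The exceptional null set depends on the direction, so countably many directions are
  treated together. A dense set suffices: the Lipschitz bound carries the limit to nearby
  directions, and compactness of the sphere makes it uniform.\<close>

theorem AE_differentiable: "AE x in lborel. f differentiable (at x)"
proof -
  obtain DD :: "'a set" where DD: "countable DD" "\<And>X. open X \<Longrightarrow> X \<noteq> {} \<Longrightarrow> \<exists>d\<in>DD. d \<in> X"
    using countable_dense_exists by blast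
  have "AE x in lborel. \<forall>d\<in>DD. convergent (dquot f d x) \<and> dird f d x = (\<Sum>b\<in>Basis. (d \<bullet> b) * dird f b x)"
    unfolding AE_ball_countable[OF DD(1)] using AE_convergent_dquot AE_dird_linear by auto
  then show ?thesis
  proof eventually_elim
    case (elim x)
    define G where "G = (\<Sum>b\<in>Basis. dird f b x *\<^sub>R b)"
    have right: "((\<lambda>h. (f (x + h *\<^sub>R d) - f x) / h) \<longlongrightarrow> G \<bullet> d) (at_right 0)" if "d \<in> DD" for d
    proof -
      have "G \<bullet> d = (\<Sum>b\<in>Basis. (d \<bullet> b) * dird f b x)"
        unfolding G_def inner_sum_left by (simp add: inner_commute mult.commute)
      then have "G \<bullet> d = dird f d x"
        using elim that by simp
      then show ?thesis using right_limit_of_dquot[OF dquot_tendsto_dird, of d x] elim that by metis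
    qed
    have "(f has_derivative (\<lambda>h. G \<bullet> h)) (at x)"
      unfolding has_derivative_at_alt
    proof (intro conjI allI impI)
      fix e :: real assume e: "0 < e"
      \<comment> \<open>Replacing a unit direction by one within \<rho> costs at most
        \<open>(L + norm G) * \<rho>\<close> per unit of step length, which this choice keeps below
        \<open>e / 2\<close>.\<close>
      define \<rho> where "\<rho> = e / (2 * (L + norm G + 1))"
      have \<rho>: "0 < \<rho>" "(L + norm G) * \<rho> \<le> e / 2"
      proof -
        have pos: "0 < L + norm G + 1" using L_nonneg by (simp add: add_nonneg_pos)
        then show "0 < \<rho>" using e by (simp add: \<rho>_def)
        then have "(L + norm G) * \<rho> \<le> (L + norm G + 1) * \<rho>" by (intro mult_right_mono) auto
        also have "\<dots> = e / 2"
        proof -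
          have "X * (e / (2 * X)) = e / 2" if "0 < X" for X :: real using that by (simp add: field_simps)
          then show ?thesis unfolding \<rho>_def using pos by blast
        qed
        finally show "(L + norm G) * \<rho> \<le> e / 2" .
      qed
      have "sphere 0 1 \<subseteq> (\<Union>d\<in>DD. ball d \<rho>)"
      proof
        fix v :: 'a
        obtain d where "d \<in> DD" "d \<in> ball v \<rho>" using DD(2)[of "ball v \<rho>"] \<rho>(1) by auto
        then show "v \<in> (\<Union>d\<in>DD. ball d \<rho>)" by (auto simp: dist_commute)
      qed
      then obtain F where F: "F \<subseteq> DD" "finite F" "sphere 0 1 \<subseteq> (\<Union>d\<in>F. ball d \<rho>)"
        by (rule compactE_image[OF compact_sphere, rotated]) auto
      have "\<forall>\<^sub>F h in at_right 0. \<forall>d\<in>F. dist ((f (x + h *\<^sub>R d) - f x) / h) (G \<bullet> d) < e / 2"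
      proof (intro eventually_ball_finite ballI)
        fix d assume "d \<in> F"
        then show "\<forall>\<^sub>F h in at_right 0. dist ((f (x + h *\<^sub>R d) - f x) / h) (G \<bullet> d) < e / 2"
          using tendstoD[OF right, of d "e / 2"] F(1) e by auto
      qed (rule F(2))
      then obtain \<delta> where \<delta>: "0 < \<delta>"
        "\<And>h d. 0 < h \<Longrightarrow> h < \<delta> \<Longrightarrow> d \<in> F \<Longrightarrow> dist ((f (x + h *\<^sub>R d) - f x) / h) (G \<bullet> d) < e / 2"
        unfolding eventually_at_right_field by auto
      show "\<exists>\<delta>>0. \<forall>y. norm (y - x) < \<delta> \<longrightarrow> norm (f y - f x - G \<bullet> (y - x)) \<le> e * norm (y - x)"
      proof (intro exI[of _ \<delta>] conjI allI impI)
        fix y assume y: "norm (y - x) < \<delta>"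
        show "norm (f y - f x - G \<bullet> (y - x)) \<le> e * norm (y - x)"
        proof (cases "y = x")
          case False
          define h where "h = norm (y - x)"
          define v where "v = (y - x) /\<^sub>R h"
          have h: "0 < h" "h < \<delta>" using False y by (auto simp: h_def)
          have yx: "y - x = h *\<^sub>R v" using h by (simp add: v_def)
          have "v \<in> sphere 0 1" using h by (simp add: v_def h_def)
          then obtain d where d: "d \<in> F" "norm (v - d) < \<rho>"
            using F(3) by (force simp: dist_norm norm_minus_commute)
          have "\<bar>f y - f (x + h *\<^sub>R d)\<bar> \<le> L * norm (y - (x + h *\<^sub>R d))" by (rule lip)
          also have "y - (x + h *\<^sub>R d) = h *\<^sub>R (v - d)" using yx by (simp add: algebra_simps)
          finally have 1: "\<bar>f y - f (x + h *\<^sub>R d)\<bar> \<le> h * (L * norm (v - d))" using h by (simp add: mult_ac)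
          have "\<bar>G \<bullet> (h *\<^sub>R (v - d))\<bar> \<le> norm G * norm (h *\<^sub>R (v - d))" by (rule Cauchy_Schwarz_ineq2)
          then have 2: "\<bar>h * (G \<bullet> v) - h * (G \<bullet> d)\<bar> \<le> h * (norm G * norm (v - d))"
            using h unfolding inner_scaleR_right norm_scaleR inner_diff_right
            by (simp add: right_diff_distrib mult_ac)
          have "(f (x + h *\<^sub>R d) - f x) / h - G \<bullet> d = (f (x + h *\<^sub>R d) - f x - h * (G \<bullet> d)) / h"
            using h by (simp add: field_simps)
          then have "\<bar>f (x + h *\<^sub>R d) - f x - h * (G \<bullet> d)\<bar> / h \<le> e / 2"
            using \<delta>(2)[OF h d(1)] h by (simp add: dist_real_def)
          then have 3: "\<bar>f (x + h *\<^sub>R d) - f x - h * (G \<bullet> d)\<bar> \<le> h * (e / 2)"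
            using h by (simp add: field_simps)
          have "(L + norm G) * norm (v - d) \<le> (L + norm G) * \<rho>"
            using d(2) L_nonneg by (intro mult_left_mono) auto
          also note \<rho>(2)
          finally have "h * ((L + norm G) * norm (v - d)) \<le> h * (e / 2)" using h by (intro mult_left_mono) auto
          then have "\<bar>f y - f x - h * (G \<bullet> v)\<bar> \<le> h * (e / 2) + h * (e / 2)"
            using 1 2 3 unfolding distrib_left[of h] distrib_right by linarith
          then show ?thesis using h \<open>v \<in> sphere 0 1\<close> by (simp add: yx mult.commute)
        qed simp
      qed (rule \<delta>(1))
    qed (rule bounded_linear_inner_right)
    then show ?case by (auto simp: differentiable_def)
  qed
qed

end

theorem rademacher:
  fixes g :: "'a::euclidean_space \<Rightarrow> 'b::euclidean_space"
  assumes lip: "\<And>x y. norm (g x - g y) \<le> L * norm (x - y)"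
  shows "AE x in lborel. g differentiable (at x)"
proof -
  have "AE x in lborel. \<forall>b\<in>Basis. (\<lambda>x. g x \<bullet> b) differentiable (at x)"
  proof (subst AE_ball_countable)
    show "\<forall>b\<in>Basis. AE x in lborel. (\<lambda>x. g x \<bullet> b) differentiable (at x)"
    proof
      fix b :: 'b assume b: "b \<in> Basis"
      interpret lipschitz_fun "\<lambda>x. g x \<bullet> b" L
      proof
        fix x y
        have "\<bar>g x \<bullet> b - g y \<bullet> b\<bar> \<le> norm (g x - g y)"
          using Basis_le_norm[OF b, of "g x - g y"] by (simp add: inner_diff_left)
        with lip show "\<bar>g x \<bullet> b - g y \<bullet> b\<bar> \<le> L * norm (x - y)" by (rule order_trans[rotated])
      qed
      show "AE x in lborel. (\<lambda>x. g x \<bullet> b) differentiable (at x)" by (rule AE_differentiable)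
    qed
  qed (simp add: countable_finite)
  then show ?thesis
    by eventually_elim (subst differentiable_componentwise_within)
qed

section \<open>Mean value inequality and symmetry of Hessians\<close>

lemma AE_lborel_translation:
  fixes c :: "'a::euclidean_space"
  assumes "AE x in lborel. P x"
  shows "AE x in lborel. P (c + x)"
proof -
  obtain N where N: "{x \<in> space lborel. \<not> P x} \<subseteq> N" "N \<in> null_sets lborel"
    using assms by (rule AE_E3) auto
  have "{x. x - (- c) \<in> N} \<in> null_sets lborel" by (rule null_sets_translation[OF N(2)])
  then show ?thesis
    by (rule AE_I') (use N(1) in \<open>auto simp: add.commute\<close>)
qed

text \<open>For each \<open>t\<close>, almost every translate \<open>w + t d\<close> is a point of
  differentiability. Averaging over a ball of base points thus gives a differentiable function of
  \<open>t\<close> whose derivative is an average of directional derivatives. Testing with a vector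
  \<open>e\<close> different from \<open>d\<close> makes off-diagonal blocks of Hessians
  accessible.\<close>

lemma mean_value_inequality_of_derivatives:
  fixes g :: "'a::euclidean_space \<Rightarrow> 'b::euclidean_space"
  assumes lip_g: "\<And>x y. norm (g x - g y) \<le> L * norm (x - y)"
    and deriv: "\<And>z W. (g has_derivative W) (at z) \<Longrightarrow> e \<bullet> W d \<le> C"
  shows "e \<bullet> (g (z + d) - g z) \<le> C"
proof (rule ccontr)
  define G where "G w = e \<bullet> g w" for w
  interpret lipschitz_fun G "norm e * L"
  proof
    fix x y
    have "\<bar>G x - G y\<bar> \<le> norm e * norm (g x - g y)"
      unfolding G_def inner_diff_right[symmetric] by (rule Cauchy_Schwarz_ineq2)
    also have "\<dots> \<le> norm e * (L * norm (x - y))" by (intro mult_left_mono lip_g) simp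
    finally show "\<bar>G x - G y\<bar> \<le> norm e * L * norm (x - y)" by (simp add: mult.assoc)
  qed
  have Gcont: "continuous_on S (\<lambda>w. G (h w))" if "continuous_on S h" for S and h :: "'a \<Rightarrow> 'a"
    using continuous_on_compose2[OF continuous[of UNIV] that] by simp
  assume "\<not> e \<bullet> (g (z + d) - g z) \<le> C"
  then have "C < G (z + d) - G z" by (simp add: G_def inner_diff_right)
  \<comment> \<open>The gap between \<open>C\<close> and \<open>C'\<close> lets the violated
    inequality persist on a whole ball of base points.\<close>
  then obtain C' where C': "C < C'" "C' < G (z + d) - G z" using dense by blast
  have "open {w. C' < G (w + d) - G w}"
    by (intro open_Collect_less continuous_intros Gcont)
  then obtain r where r: "0 < r" "cball z r \<subseteq> {w. C' < G (w + d) - G w}"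
    using C'(2) open_contains_cball by (metis mem_Collect_eq)
  define K where "K = cball z r"
  have Kfin: "emeasure lborel K < \<infinity>" using emeasure_lborel_cball_finite[of z r] by (simp add: K_def less_top)
  have [measurable]: "K \<in> sets borel" by (simp add: K_def)
  have Kpos: "0 < measure lborel K" unfolding K_def using r(1) content_cball_pos by simp
  have intK: "integrable lborel (indicator K :: 'a \<Rightarrow> real)"
    using Kfin by (simp add: integrable_indicator_iff)
  define \<Phi> where "\<Phi> t = (\<integral>w. indicator K w * G (w + t *\<^sub>R d) \<partial>lborel)" for t
  define D where "D t = (\<integral>w. indicator K w * dird G d (w + t *\<^sub>R d) \<partial>lborel)" for t
  have int\<Phi>: "integrable lborel (\<lambda>w. indicator K w * G (w + t *\<^sub>R d))" for t
  proof -
    have "continuous_on K (\<lambda>w. G (w + t *\<^sub>R d))" by (intro Gcont continuous_intros)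
    then show ?thesis
      using borel_integrable_compact[of K "\<lambda>w. G (w + t *\<^sub>R d)"] by (simp add: K_def)
  qed
  \<comment> \<open>At a point of differentiability all null sequences give the same limit.
    Arbitrary \<open>s\<close> are needed for \<open>DERIV\<close>; the steps
    \<open>1 / Suc n\<close> identify the limit with the measurable \<open>dird G d\<close>.\<close>
  have quot: "(\<lambda>n. (G (w + s n *\<^sub>R d) - G w) / s n) \<longlonglongrightarrow> dird G d w \<and> dird G d w \<le> C"
    if diff: "g differentiable (at w)" and s: "s \<longlonglongrightarrow> 0" "\<And>n. s n \<noteq> 0" for w s
  proof -
    obtain W where W: "(g has_derivative W) (at w)" using diff by (auto simp: differentiable_def)
    have gen: "(\<lambda>n. (G (w + s n *\<^sub>R d) - G w) / s n) \<longlonglongrightarrow> e \<bullet> W d"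
      if s: "s \<longlonglongrightarrow> 0" "\<And>n. s n \<noteq> 0" for s :: "nat \<Rightarrow> real"
    proof -
      have lin: "((\<lambda>t. w + t *\<^sub>R d) has_derivative (\<lambda>t. t *\<^sub>R d)) (at 0)"
        by (auto intro!: derivative_eq_intros)
      have W0: "(g has_derivative W) (at (w + 0 *\<^sub>R d))" using W by simp
      have "((\<lambda>t. G (w + t *\<^sub>R d)) has_derivative (\<lambda>t. e \<bullet> W (t *\<^sub>R d))) (at 0)"
        unfolding G_def using has_derivative_compose[OF lin W0] by (rule has_derivative_inner_right)
      moreover have "(\<lambda>t. e \<bullet> W (t *\<^sub>R d)) = (\<lambda>t. (e \<bullet> W d) * t)"
        using linear_cmul[OF has_derivative_linear[OF W]] by (simp add: mult.commute)
      ultimately have "((\<lambda>t. G (w + t *\<^sub>R d)) has_field_derivative (e \<bullet> W d)) (at 0)"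
        by (simp add: has_field_derivative_def)
      then have "(\<lambda>h. (G (w + h *\<^sub>R d) - G w) / h) \<midarrow>0\<rightarrow> e \<bullet> W d" by (simp add: DERIV_def)
      then show ?thesis using s unfolding LIMSEQ_SEQ_conv[symmetric] by blast
    qed
    have "(\<lambda>n. (G (w + inverse (real (Suc n)) *\<^sub>R d) - G w) / inverse (real (Suc n))) \<longlonglongrightarrow> e \<bullet> W d"
      by (rule gen[OF LIMSEQ_inverse_real_of_nat]) simp
    moreover have "(G (w + inverse (real (Suc n)) *\<^sub>R d) - G w) / inverse (real (Suc n)) = dquot G d w n" for n
      by (simp add: dquot_def divide_inverse del: of_nat_Suc)
    ultimately have "dquot G d w \<longlonglongrightarrow> e \<bullet> W d" by simp
    then have "dird G d w = e \<bullet> W d" by (simp add: dird_def limI)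
    with gen[OF s] deriv[OF W] show ?thesis by simp
  qed
  have AEdiff: "AE w in lborel. g differentiable (at (w + t *\<^sub>R d))" for t
    using AE_lborel_translation[OF rademacher[of g L, OF lip_g], of "t *\<^sub>R d"] by (simp add: add.commute)
  have bound: "\<bar>(G (w + s *\<^sub>R d) - G w) / s\<bar> \<le> norm e * L * norm d" if "s \<noteq> 0" for w s
    using that lip[of "w + s *\<^sub>R d" w]
    by (simp add: abs_divide divide_le_eq mult_ac)
  \<comment> \<open>The Lipschitz constant dominates all quotients, so differentiating under the
    integral is dominated convergence along an arbitrary null sequence.\<close>
  have D_deriv: "(\<Phi> has_field_derivative D t) (at t)" for t
    unfolding DERIV_def LIMSEQ_SEQ_conv[symmetric]
  proof (intro allI impI)
    fix s :: "nat \<Rightarrow> real" assume s: "(\<forall>n. s n \<noteq> 0) \<and> s \<longlonglongrightarrow> 0"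
    have "(\<lambda>n. \<integral>w. indicator K w * ((G (w + t *\<^sub>R d + s n *\<^sub>R d) - G (w + t *\<^sub>R d)) / s n) \<partial>lborel) \<longlonglongrightarrow> D t"
      unfolding D_def
    proof (rule integral_dominated_convergence[where w = "\<lambda>w. norm e * L * norm d * indicator K w"])
      show "AE w in lborel. (\<lambda>n. indicator K w * ((G (w + t *\<^sub>R d + s n *\<^sub>R d) - G (w + t *\<^sub>R d)) / s n))
          \<longlonglongrightarrow> indicator K w * dird G d (w + t *\<^sub>R d)"
        using AEdiff[of t]
      proof eventually_elim
        case (elim w)
        show ?case by (intro tendsto_mult_left conjunct1[OF quot[OF elim]]) (use s in auto)
      qed
      show "AE w in lborel. norm (indicator K w * ((G (w + t *\<^sub>R d + s n *\<^sub>R d) - G (w + t *\<^sub>R d)) / s n))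
          \<le> norm e * L * norm d * indicator K w" for n
        using bound[of "s n"] s by (intro AE_I2) (auto simp del: abs_divide split: split_indicator)
    qed (use intK in \<open>auto intro!: integrable_mult_right simp del: integrable_mult_right_iff\<close>)
    moreover have "(\<integral>w. indicator K w * ((G (w + t *\<^sub>R d + s n *\<^sub>R d) - G (w + t *\<^sub>R d)) / s n) \<partial>lborel)
        = (\<Phi> (t + s n) - \<Phi> t) / s n" for n
    proof -
      have "indicator K w * ((G (w + t *\<^sub>R d + s n *\<^sub>R d) - G (w + t *\<^sub>R d)) / s n)
          = (indicator K w * G (w + (t + s n) *\<^sub>R d) - indicator K w * G (w + t *\<^sub>R d)) / s n" for w
        by (simp add: algebra_simps)
      then show ?thesis
        unfolding \<Phi>_def Bochner_Integration.integral_diff[OF int\<Phi>[of "t + s n"] int\<Phi>[of t], symmetric]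
          integral_divide_zero[symmetric] by (simp only:)
    qed
    ultimately show "(\<lambda>n. (\<Phi> (t + s n) - \<Phi> t) / s n) \<longlonglongrightarrow> D t" by (simp only:)
  qed
  have "D t \<le> C * measure lborel K" for t
  proof -
    have "D t \<le> (\<integral>w. C * indicator K w \<partial>lborel)"
      unfolding D_def
    proof (rule integral_mono_AE)
      have D_AE: "AE w in lborel. dird G d (w + t *\<^sub>R d) \<le> C \<and> \<bar>dird G d (w + t *\<^sub>R d)\<bar> \<le> norm e * L * norm d"
        using AEdiff[of t] AE_lborel_translation[OF AE_convergent_dquot[of d], of "t *\<^sub>R d"]
      proof eventually_elim
        case (elim w)
        then show ?case
          using quot[OF elim(1) LIMSEQ_inverse_real_of_nat] dird_bound by (simp add: add.commute)
      qed
      show "integrable lborel (\<lambda>w. indicator K w * dird G d (w + t *\<^sub>R d))"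
      proof (rule Bochner_Integration.integrable_bound[where f = "\<lambda>w. norm e * L * norm d * indicator K w"])
        show "AE w in lborel. norm (indicator K w * dird G d (w + t *\<^sub>R d)) \<le> norm (norm e * L * norm d * indicator K w)"
          using D_AE by eventually_elim (auto split: split_indicator)
      qed (use intK in \<open>auto intro!: integrable_mult_right simp del: integrable_mult_right_iff\<close>)
      show "AE w in lborel. indicator K w * dird G d (w + t *\<^sub>R d) \<le> C * indicator K w"
        using D_AE by eventually_elim (auto split: split_indicator)
    qed (use intK in simp)
    then show ?thesis using Kfin by simp
  qed
  moreover obtain t where "\<Phi> 1 - \<Phi> 0 = (1 - 0) * D t"
    using MVT2[of 0 1 \<Phi> D] D_deriv by auto
  ultimately have upper: "\<Phi> 1 - \<Phi> 0 \<le> C * measure lborel K" by simp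
  have "C' * measure lborel K = (\<integral>w. C' * indicator K w \<partial>lborel)" using Kfin by simp
  also have "\<dots> \<le> (\<integral>w. indicator K w * G (w + 1 *\<^sub>R d) - indicator K w * G (w + 0 *\<^sub>R d) \<partial>lborel)"
  proof (intro integral_mono Bochner_Integration.integrable_diff int\<Phi>)
    fix w :: 'a
    show "C' * indicator K w \<le> indicator K w * G (w + 1 *\<^sub>R d) - indicator K w * G (w + 0 *\<^sub>R d)"
      using r(2) by (auto simp: K_def split: split_indicator)
  qed (use intK in simp)
  also have "\<dots> = \<Phi> 1 - \<Phi> 0"
    unfolding \<Phi>_def by (rule Bochner_Integration.integral_diff[OF int\<Phi> int\<Phi>])
  finally have "C' * measure lborel K \<le> C * measure lborel K" using upper by simp
  then show False using Kpos C'(1) by simp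
qed

text \<open>Since \<open>g\<close> is known to be differentiable only at \<open>z\<close>, the mean
  value theorem is applied once, to \<phi>. It turns the second difference into a difference of
  gradients, and both gradients are expanded at \<open>z\<close>.\<close>

lemma second_difference_estimate:
  fixes \<phi> :: "'a::euclidean_space \<Rightarrow> real"
  assumes grad: "\<And>w. (\<phi> has_derivative (\<lambda>h. g w \<bullet> h)) (at w)"
    and W: "(g has_derivative W) (at z)" and e: "0 < e"
  obtains \<delta> where "0 < \<delta>" "\<And>t. 0 < t \<Longrightarrow> t < \<delta> \<Longrightarrow>
     \<bar>\<phi> (z + t *\<^sub>R a + t *\<^sub>R b) - \<phi> (z + t *\<^sub>R a) - \<phi> (z + t *\<^sub>R b) + \<phi> z - t\<^sup>2 * (a \<bullet> W b)\<bar> \<le> e * t\<^sup>2"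
proof -
  define m where "m = norm a + norm b + 1"
  have m: "0 < m" "norm a \<le> m" "norm a + norm b \<le> m" by (simp_all add: m_def add_nonneg_pos)
  \<comment> \<open>Both intermediate points lie within \<open>t * m\<close> of \<open>z\<close>, so
    each expansion errs by at most \<open>e' * (t * m)\<close>; multiplied by
    \<open>t * norm a \<le> t * m\<close>, the two errors add up to at most
    \<open>e * t^2\<close>.\<close>
  define e' where "e' = e / (2 * m * m)"
  have e': "0 < e'" using e m(1) by (simp add: e'_def)
  obtain \<delta>0 where \<delta>0: "0 < \<delta>0" "\<And>y. norm (y - z) < \<delta>0 \<Longrightarrow> norm (g y - g z - W (y - z)) \<le> e' * norm (y - z)"
    using W e' unfolding has_derivative_at_alt by blast
  have linW: "linear W" using W by (rule has_derivative_linear)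
  have "\<bar>\<phi> (z + t *\<^sub>R a + t *\<^sub>R b) - \<phi> (z + t *\<^sub>R a) - \<phi> (z + t *\<^sub>R b) + \<phi> z - t\<^sup>2 * (a \<bullet> W b)\<bar> \<le> e * t\<^sup>2"
    if t: "0 < t" "t < \<delta>0 / m" for t
  proof -
    define \<psi> where "\<psi> s = \<phi> (z + (s * t) *\<^sub>R a + t *\<^sub>R b) - \<phi> (z + (s * t) *\<^sub>R a)" for s
    define y1 y2 where "y1 s = z + (s * t) *\<^sub>R a + t *\<^sub>R b" and "y2 s = z + (s * t) *\<^sub>R a" for s
    have "(\<psi> has_real_derivative t * (a \<bullet> (g (y1 s) - g (y2 s)))) (at s)" for s
    proof -
      have 1: "((\<lambda>s. \<phi> (y1 s)) has_derivative (\<lambda>h. g (y1 s) \<bullet> ((h * t) *\<^sub>R a))) (at s)"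
        unfolding y1_def by (rule has_derivative_compose[OF _ grad]) (auto intro!: derivative_eq_intros)
      have 2: "((\<lambda>s. \<phi> (y2 s)) has_derivative (\<lambda>h. g (y2 s) \<bullet> ((h * t) *\<^sub>R a))) (at s)"
        unfolding y2_def by (rule has_derivative_compose[OF _ grad]) (auto intro!: derivative_eq_intros)
      have "(\<psi> has_derivative (\<lambda>h. g (y1 s) \<bullet> ((h * t) *\<^sub>R a) - g (y2 s) \<bullet> ((h * t) *\<^sub>R a))) (at s)"
        using has_derivative_diff[OF 1 2] by (simp add: \<psi>_def[abs_def] y1_def y2_def)
      then show ?thesis
        unfolding has_field_derivative_def
        by (rule has_derivative_eq_rhs) (auto simp: inner_diff_right inner_commute algebra_simps)
    qed
    then obtain s where s: "0 < s" "s < 1" "\<psi> 1 - \<psi> 0 = (1 - 0) * (t * (a \<bullet> (g (y1 s) - g (y2 s))))"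
      using MVT2[of 0 1 \<psi> "\<lambda>s. t * (a \<bullet> (g (y1 s) - g (y2 s)))"] by auto
    have tm: "t * m < \<delta>0" using t m by (simp add: pos_less_divide_eq)
    have na: "norm ((s * t) *\<^sub>R a) \<le> t * norm a"
      using s t by (simp add: mult_right_mono mult_le_cancel_right1)
    have n2: "norm (y2 s - z) \<le> t * m"
      using na m(2) t by (simp add: y2_def) (smt (verit) mult_left_mono)
    have n1: "norm (y1 s - z) \<le> t * m"
    proof -
      have "norm (y1 s - z) \<le> norm ((s * t) *\<^sub>R a) + norm (t *\<^sub>R b)"
        using norm_triangle_ineq[of "(s * t) *\<^sub>R a" "t *\<^sub>R b"] by (simp add: y1_def add.assoc)
      also have "\<dots> \<le> t * (norm a + norm b)" using na t by (simp add: distrib_left)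
      also have "\<dots> \<le> t * m" using m(3) t by (intro mult_left_mono) auto
      finally show ?thesis .
    qed
    have r1: "norm (g (y1 s) - g z - W (y1 s - z)) \<le> e' * (t * m)"
      using \<delta>0(2)[of "y1 s"] n1 tm e' by (smt (verit) mult_left_mono)
    have r2: "norm (g (y2 s) - g z - W (y2 s - z)) \<le> e' * (t * m)"
      using \<delta>0(2)[of "y2 s"] n2 tm e' by (smt (verit) mult_left_mono)
    have "W (y1 s - z) - W (y2 s - z) = t *\<^sub>R W b"
      unfolding linear_diff[OF linW, symmetric] by (simp add: y1_def y2_def linear_cmul[OF linW])
    then have eq: "g (y1 s) - g (y2 s) - t *\<^sub>R W b
        = (g (y1 s) - g z - W (y1 s - z)) - (g (y2 s) - g z - W (y2 s - z))" by (simp add: algebra_simps)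
    have r: "norm (g (y1 s) - g (y2 s) - t *\<^sub>R W b) \<le> 2 * e' * (t * m)"
      using norm_triangle_ineq4[of "g (y1 s) - g z - W (y1 s - z)" "g (y2 s) - g z - W (y2 s - z)"] r1 r2
      unfolding eq by linarith
    have "\<phi> (z + t *\<^sub>R a + t *\<^sub>R b) - \<phi> (z + t *\<^sub>R a) - \<phi> (z + t *\<^sub>R b) + \<phi> z - t\<^sup>2 * (a \<bullet> W b)
        = (\<psi> 1 - \<psi> 0) - t\<^sup>2 * (a \<bullet> W b)" by (simp add: \<psi>_def)
    also have "\<dots> = t * (a \<bullet> (g (y1 s) - g (y2 s) - t *\<^sub>R W b))"
      unfolding s(3) by (simp add: inner_diff_right algebra_simps power2_eq_square)
    finally have "\<bar>\<phi> (z + t *\<^sub>R a + t *\<^sub>R b) - \<phi> (z + t *\<^sub>R a) - \<phi> (z + t *\<^sub>R b) + \<phi> z - t\<^sup>2 * (a \<bullet> W b)\<bar>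
        = t * \<bar>a \<bullet> (g (y1 s) - g (y2 s) - t *\<^sub>R W b)\<bar>" using t by (simp add: abs_mult)
    also have "\<dots> \<le> t * (norm a * norm (g (y1 s) - g (y2 s) - t *\<^sub>R W b))"
      using t by (intro mult_left_mono Cauchy_Schwarz_ineq2) auto
    also have "\<dots> \<le> t * (m * (2 * e' * (t * m)))"
      using t m r by (intro mult_left_mono mult_mono) auto
    also have "\<dots> = e * t\<^sup>2" using m(1) by (simp add: e'_def power2_eq_square)
    finally show ?thesis .
  qed
  moreover have "0 < \<delta>0 / m" using \<delta>0(1) m(1) by simp
  ultimately show thesis using that by blast
qed

text \<open>The second difference is symmetric in \<open>a\<close> and \<open>b\<close>. In
  \<open>grad_cross\<close> this transfers the bound on the block from \<open>v\<close> to
  \<open>u\<close> to its transpose.\<close>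

lemma hessian_symmetric:
  fixes \<phi> :: "'a::euclidean_space \<Rightarrow> real"
  assumes grad: "\<And>w. (\<phi> has_derivative (\<lambda>h. g w \<bullet> h)) (at w)"
    and W: "(g has_derivative W) (at z)"
  shows "a \<bullet> W b = b \<bullet> W a"
proof -
  have "\<bar>a \<bullet> W b - b \<bullet> W a\<bar> \<le> e" if "0 < e" for e
  proof -
    have e2: "0 < e / 2" using that by simp
    obtain \<delta>1 where \<delta>1: "0 < \<delta>1" "\<And>t. 0 < t \<Longrightarrow> t < \<delta>1 \<Longrightarrow>
     \<bar>\<phi> (z + t *\<^sub>R a + t *\<^sub>R b) - \<phi> (z + t *\<^sub>R a) - \<phi> (z + t *\<^sub>R b) + \<phi> z - t\<^sup>2 * (a \<bullet> W b)\<bar> \<le> e / 2 * t\<^sup>2"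
      using second_difference_estimate[OF grad W e2] by blast
    obtain \<delta>2 where \<delta>2: "0 < \<delta>2" "\<And>t. 0 < t \<Longrightarrow> t < \<delta>2 \<Longrightarrow>
     \<bar>\<phi> (z + t *\<^sub>R b + t *\<^sub>R a) - \<phi> (z + t *\<^sub>R b) - \<phi> (z + t *\<^sub>R a) + \<phi> z - t\<^sup>2 * (b \<bullet> W a)\<bar> \<le> e / 2 * t\<^sup>2"
      using second_difference_estimate[OF grad W e2] by blast
    obtain t where t: "0 < t" "t < \<delta>1" "t < \<delta>2" using dense[of 0 "min \<delta>1 \<delta>2"] \<delta>1(1) \<delta>2(1) by auto
    have eq: "z + t *\<^sub>R b + t *\<^sub>R a = z + t *\<^sub>R a + t *\<^sub>R b" by (simp add: algebra_simps)
    have "\<bar>t\<^sup>2 * (a \<bullet> W b) - t\<^sup>2 * (b \<bullet> W a)\<bar> \<le> e * t\<^sup>2"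
      using \<delta>1(2)[OF t(1,2)] \<delta>2(2)[OF t(1,3), unfolded eq] by linarith
    moreover have "\<bar>t\<^sup>2 * (a \<bullet> W b) - t\<^sup>2 * (b \<bullet> W a)\<bar> = \<bar>a \<bullet> W b - b \<bullet> W a\<bar> * t\<^sup>2"
      unfolding right_diff_distrib[symmetric] by (simp add: abs_mult mult.commute)
    ultimately show ?thesis using t(1) by simp
  qed
  then have "\<bar>a \<bullet> W b - b \<bullet> W a\<bar> \<le> 0" by (metis field_le_epsilon add_0)
  then show ?thesis by simp
qed

section \<open>Subdifferentials and multipliers\<close>

lemma cpc_not_MInf: "closed_proper_convex f \<Longrightarrow> f x \<noteq> - \<infinity>"
  by (simp add: closed_proper_convex_def)

lemma cpc_edom_nonempty: "closed_proper_convex f \<Longrightarrow> edom f \<noteq> {}"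
  by (simp add: closed_proper_convex_def)

lemma cpc_real:
  assumes "closed_proper_convex f" "x \<in> edom f"
  obtains r where "f x = ereal r"
  using assms by (cases "f x") (auto simp: closed_proper_convex_def edom_def)

lemma cpc_convexD:
  assumes "closed_proper_convex f" "f x \<le> ereal s" "f y \<le> ereal t" "0 \<le> a" "0 \<le> b" "a + b = 1"
  shows "f (a *\<^sub>R x + b *\<^sub>R y) \<le> ereal (a * s + b * t)"
proof -
  have "convex {(x, t::real). f x \<le> ereal t}" using assms(1) by (simp add: closed_proper_convex_def)
  then have "a *\<^sub>R (x, s) + b *\<^sub>R (y, t) \<in> {(x, t::real). f x \<le> ereal t}"
    by (rule convexD) (use assms in auto)
  then show ?thesis by simp
qed

lemma cpc_convex_edom:
  assumes "closed_proper_convex f"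
  shows "convex (edom f)"
proof (rule convexI)
  fix x y and a b :: real
  assume xy: "x \<in> edom f" "y \<in> edom f" and ab: "0 \<le> a" "0 \<le> b" "a + b = 1"
  obtain s t where "f x = ereal s" "f y = ereal t" using cpc_real[OF assms] xy by metis
  then have "f (a *\<^sub>R x + b *\<^sub>R y) \<le> ereal (a * s + b * t)" using ab by (intro cpc_convexD[OF assms]) auto
  then show "a *\<^sub>R x + b *\<^sub>R y \<in> edom f" by (auto simp: edom_def intro: le_less_trans)
qed

text \<open>Testing against real upper bounds \<open>t\<close> of \<open>f y\<close> keeps
  extended-real arithmetic out of the later arguments.\<close>

lemma subdiffI:
  assumes "closed_proper_convex f" "f x = ereal s"
    and "\<And>y t. f y \<le> ereal t \<Longrightarrow> s + inner g (y - x) \<le> t"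
  shows "g \<in> subdiff f x"
  unfolding subdiff_def
proof (intro CollectI conjI allI)
  fix y
  show "f x + ereal (inner g (y - x)) \<le> f y"
  proof (cases "f y")
    case (real t)
    then show ?thesis using assms(3)[of y t] assms(2) by simp
  qed (use cpc_not_MInf[OF assms(1)] in auto)
qed (use assms(2) in simp)

lemma subdiff_edom: "g \<in> subdiff f x \<Longrightarrow> x \<in> edom f"
  by (simp add: subdiff_def edom_def)

lemma subdiffD:
  assumes "g \<in> subdiff f x" "f x = ereal s" "f y \<le> ereal t"
  shows "s + inner g (y - x) \<le> t"
proof -
  have "f x + ereal (inner g (y - x)) \<le> f y" using assms(1) by (simp add: subdiff_def)
  also note assms(3)
  finally show ?thesis using assms(2) by simp
qed

lemma subdiff_monotone:
  assumes cpc: "closed_proper_convex f" and g: "g \<in> subdiff f x" and h: "h \<in> subdiff f y"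
  shows "0 \<le> inner (g - h) (x - y)"
proof -
  obtain s t where st: "f x = ereal s" "f y = ereal t"
    using cpc_real[OF cpc] subdiff_edom g h by metis
  have "s + inner g (y - x) \<le> t" using st by (intro subdiffD[OF g]) auto
  moreover have "t + inner h (x - y) \<le> s" using st by (intro subdiffD[OF h]) auto
  ultimately show ?thesis by (simp add: inner_diff_left inner_diff_right)
qed

text \<open>The subgradient inequality says that \<open>(x n, t - inner (g n) (y - x n))\<close>
  lies in the epigraph, which is closed. The same passage to the limit shows that
  \<open>f x'\<close> is finite.\<close>

lemma subdiff_closed:
  assumes cpc: "closed_proper_convex f" and g: "\<And>n::nat. g n \<in> subdiff f (x n)"
    and lim: "x \<longlonglongrightarrow> x'" "g \<longlonglongrightarrow> g'"
  shows "g' \<in> subdiff f x'"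
proof -
  have step: "f x' \<le> ereal (t - inner g' (y - x'))" if "f y \<le> ereal t" for y t
  proof -
    have cl: "closed {(x, t::real). f x \<le> ereal t}" using cpc by (simp add: closed_proper_convex_def)
    have mem: "(x n, t - inner (g n) (y - x n)) \<in> {(x, t::real). f x \<le> ereal t}" for n
    proof -
      obtain s where s: "f (x n) = ereal s" using cpc_real[OF cpc subdiff_edom[OF g]] by metis
      show "(x n, t - inner (g n) (y - x n)) \<in> {(x, t::real). f x \<le> ereal t}"
        using subdiffD[OF g s that] s by simp
    qed
    have "(\<lambda>n. (x n, t - inner (g n) (y - x n))) \<longlonglongrightarrow> (x', t - inner g' (y - x'))"
      by (intro tendsto_intros lim)
    with cl mem have "(x', t - inner g' (y - x')) \<in> {(x, t::real). f x \<le> ereal t}"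
      by (rule closed_sequentially)
    then show ?thesis by simp
  qed
  obtain y0 where "y0 \<in> edom f" using cpc_edom_nonempty[OF cpc] by blast
  then obtain t0 where "f y0 = ereal t0" using cpc_real[OF cpc] by blast
  then have "f x' \<le> ereal (t0 - inner g' (y0 - x'))" by (intro step) simp
  then have "x' \<in> edom f" by (auto simp: edom_def intro: le_less_trans)
  then obtain s where s: "f x' = ereal s" using cpc_real[OF cpc] by blast
  show ?thesis
    by (rule subdiffI[OF cpc s]) (use step s in fastforce)
qed

text \<open>Formulated for a convex set \<open>C\<close> of pairs (point, value) so that it serves
  both the unconstrained subproblems and the original problem, whose constraint is intersected into
  \<open>C\<close>.\<close>

lemma first_order_condition_epigraph:
  fixes h :: "'a::real_inner \<Rightarrow> real" and s t :: real
  assumes "convex C" and xs: "(x, s) \<in> C" and yt: "(y, t) \<in> C"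
    and deriv: "(h has_derivative (\<lambda>d. inner G d)) (at x)"
    and min: "\<And>y t. (y, t) \<in> C \<Longrightarrow> s + h x \<le> t + h y"
  shows "s \<le> t + inner G (y - x)"
proof -
  define \<psi> where "\<psi> l = h (x + l *\<^sub>R (y - x))" for l
  have lin: "((\<lambda>l. x + l *\<^sub>R (y - x)) has_derivative (\<lambda>l. l *\<^sub>R (y - x))) (at 0)"
    by (auto intro!: derivative_eq_intros)
  have "(h has_derivative (\<lambda>d. inner G d)) (at (x + 0 *\<^sub>R (y - x)))" using deriv by simp
  from has_derivative_compose[OF lin this]
  have "(\<psi> has_field_derivative inner G (y - x)) (at 0)"
    unfolding \<psi>_def[abs_def] has_field_derivative_def
    by (rule has_derivative_eq_rhs) (simp add: fun_eq_iff mult.commute)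
  then have "((\<lambda>l. (\<psi> l - \<psi> 0) / l) \<longlongrightarrow> inner G (y - x)) (at_right 0)"
    unfolding DERIV_def by (simp add: filterlim_at_split)
  moreover have "\<forall>\<^sub>F l in at_right 0. s - t \<le> (\<psi> l - \<psi> 0) / l"
    unfolding eventually_at_right_field
  proof (intro exI[of _ 1] conjI allI impI)
    fix l :: real assume l: "0 < l" "l < 1"
    have "(1 - l) *\<^sub>R (x, s) + l *\<^sub>R (y, t) \<in> C"
      using \<open>convex C\<close> xs yt l by (intro convexD) auto
    then have "(x + l *\<^sub>R (y - x), s + l * (t - s)) \<in> C" by (simp add: algebra_simps)
    from min[OF this] have "l * (s - t) \<le> \<psi> l - \<psi> 0" by (simp add: \<psi>_def algebra_simps)
    then show "s - t \<le> (\<psi> l - \<psi> 0) / l" using l by (simp add: field_simps)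
  qed simp
  ultimately have "s - t \<le> inner G (y - x)"
    by (rule tendsto_lowerbound) simp
  then show ?thesis by simp
qed

lemma subdiff_of_minimizer:
  assumes cpc: "closed_proper_convex f"
    and deriv: "(h has_derivative (\<lambda>d. inner G d)) (at x)"
    and min: "\<And>y. f x + ereal (h x) \<le> f y + ereal (h y)"
  shows "- G \<in> subdiff f x"
proof -
  obtain y0 where "y0 \<in> edom f" using cpc_edom_nonempty[OF cpc] by blast
  then obtain t0 where "f y0 = ereal t0" using cpc_real[OF cpc] by blast
  then have "f x \<noteq> \<infinity>" using min[of y0] by auto
  then obtain s where s: "f x = ereal s" using cpc_not_MInf[OF cpc] by (cases "f x") auto
  show ?thesis
  proof (rule subdiffI[OF cpc s])
    fix y t assume yt: "f y \<le> ereal t"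
    have "s \<le> t + inner G (y - x)"
    proof (rule first_order_condition_epigraph[of "{(x, t::real). f x \<le> ereal t}" x s y t h])
      show "convex {(x, t::real). f x \<le> ereal t}" using cpc by (simp add: closed_proper_convex_def)
      fix y t assume "(y, t) \<in> {(x, t::real). f x \<le> ereal t}"
      then have "f y + ereal (h y) \<le> ereal t + ereal (h y)" by (intro add_right_mono) simp
      with min[of y] show "s + h x \<le> t + h y" unfolding s by (auto dest: order_trans)
    qed (use s yt deriv in auto)
    then show "s + inner (- G) (y - x) \<le> t" by simp
  qed
qed

text \<open>Perturbation argument: \<open>E\<close> collects pairs of constraint violation and
  excess of the linearized objective. Optimality puts the origin on its relative boundary; a
  supporting hyperplane there has a normal \<open>(a, \<alpha>)\<close>, and
  \<open>a /\<^sub>R \<alpha>\<close> is the multiplier once \<alpha> > 0.\<close>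

lemma multiplier_exists:
  fixes p :: "'u::euclidean_space \<Rightarrow> ereal" and q :: "'v::euclidean_space \<Rightarrow> ereal"
    and A :: "'x::euclidean_space \<Rightarrow> 'u" and B :: "'x \<Rightarrow> 'v"
  assumes p_cpc: "closed_proper_convex p" and q_cpc: "closed_proper_convex q"
    and grad: "\<And>w. (\<phi> has_derivative (\<lambda>h. inner (g w) h)) (at w)"
    and A: "linear A" and B: "linear B"
    and opt: "is_optimal p q \<phi> A B c us vs"
    and slater: "(uh, vh) \<in> rel_interior (edom p \<times> edom q)" "adjoint A uh + adjoint B vh = c"
  shows "\<exists>x. is_KKT p q g A B c us vs x"
proof -
  define Lm where "Lm = (\<lambda>w. adjoint A (fst w) + adjoint B (snd w))"
  have adjA: "linear (adjoint A)" and adjB: "linear (adjoint B)"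
    using A B by (simp_all add: adjoint_linear)
  have Lm: "linear Lm" unfolding Lm_def
    by (intro linear_compose_add linear_compose[OF linear_fst adjA, unfolded o_def]
        linear_compose[OF linear_snd adjB, unfolded o_def])
  have dom: "(uh, vh) \<in> edom p \<times> edom q" using slater(1) rel_interior_subset by blast
  obtain sh th where sth: "p uh = ereal sh" "q vh = ereal th"
    using dom cpc_real[OF p_cpc] cpc_real[OF q_cpc] by (metis mem_Sigma_iff)
  have feas: "Lm (us, vs) = c" using opt by (simp add: is_optimal_def Lm_def)
  have "p us + q vs + ereal (\<phi> (us, vs)) \<le> p uh + q vh + ereal (\<phi> (uh, vh))"
    using opt slater(2) by (simp add: is_optimal_def)
  then have "p us \<noteq> \<infinity>" "q vs \<noteq> \<infinity>" unfolding sth by auto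
  then obtain ps qs where ps: "p us = ereal ps" and qs: "q vs = ereal qs"
    using cpc_not_MInf[OF p_cpc] cpc_not_MInf[OF q_cpc] by (cases "p us"; cases "q vs") auto
  \<comment> \<open>The epigraph of the separable sum; bounding \<open>p\<close> and
    \<open>q\<close> by separate reals avoids sums of extended reals.\<close>
  define epi where "epi = {(w, r::real). \<exists>s t. p (fst w) \<le> ereal s \<and> q (snd w) \<le> ereal t \<and> s + t \<le> r}"
  have epi_convex: "convex epi"
  proof (rule convexI)
    fix y z and a b :: real assume yz: "y \<in> epi" "z \<in> epi" and ab: "0 \<le> a" "0 \<le> b" "a + b = 1"
    obtain u1 v1 r1 s1 t1 where y: "y = ((u1, v1), r1)" "p u1 \<le> ereal s1" "q v1 \<le> ereal t1" "s1 + t1 \<le> r1"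
      using yz(1) by (cases y) (auto simp: epi_def)
    obtain u2 v2 r2 s2 t2 where z: "z = ((u2, v2), r2)" "p u2 \<le> ereal s2" "q v2 \<le> ereal t2" "s2 + t2 \<le> r2"
      using yz(2) by (cases z) (auto simp: epi_def)
    have "(a * s1 + b * s2) + (a * t1 + b * t2) = a * (s1 + t1) + b * (s2 + t2)" by (simp add: algebra_simps)
    also have "\<dots> \<le> a * r1 + b * r2" using y(4) z(4) ab by (intro add_mono mult_left_mono) auto
    finally show "a *\<^sub>R y + b *\<^sub>R z \<in> epi"
      using cpc_convexD[OF p_cpc y(2) z(2) ab] cpc_convexD[OF q_cpc y(3) z(3) ab]
      unfolding epi_def y(1) z(1) by auto
  qed
  \<comment> \<open>The optimum of the original problem remains optimal when \<phi> is replaced by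
    its linearization there, which leaves a problem with affine smooth part.\<close>
  have lin_opt: "ps + qs \<le> r + inner (g (us, vs)) (w - (us, vs))" if w: "(w, r) \<in> epi" "Lm w = c" for w r
  proof (rule first_order_condition_epigraph[of "epi \<inter> {z. Lm (fst z) = c}" "(us, vs)" _ w r \<phi>])
    have "convex {z :: ('u \<times> 'v) \<times> real. Lm (fst z) = c}"
      by (rule convexI) (simp add: linear_add[OF Lm] linear_cmul[OF Lm] scaleR_left_distrib[symmetric])
    then show "convex (epi \<inter> {z. Lm (fst z) = c})" using epi_convex by (simp add: convex_Int)
    show "((us, vs), ps + qs) \<in> epi \<inter> {z. Lm (fst z) = c}" using feas ps qs by (auto simp: epi_def)
    show "(w, r) \<in> epi \<inter> {z. Lm (fst z) = c}" using w by simp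
    show "(\<phi> has_derivative inner (g (us, vs))) (at (us, vs))" using grad by simp
    fix y :: "'u \<times> 'v" and t assume "(y, t) \<in> epi \<inter> {z. Lm (fst z) = c}"
    then obtain s' t' where y: "p (fst y) \<le> ereal s'" "q (snd y) \<le> ereal t'" "s' + t' \<le> t" "Lm y = c"
      by (auto simp: epi_def)
    have "p us + q vs + ereal (\<phi> (us, vs)) \<le> p (fst y) + q (snd y) + ereal (\<phi> (fst y, snd y))"
      using opt y(4) unfolding is_optimal_def Lm_def by blast
    also have "\<dots> \<le> ereal s' + ereal t' + ereal (\<phi> (fst y, snd y))"
      by (intro add_mono y order_refl)
    finally show "ps + qs + \<phi> (us, vs) \<le> t + \<phi> y" using y(3) unfolding ps qs by simp
  qed
  define E where "E = (\<lambda>(w, r). (Lm w - c, r + inner (g (us, vs)) (w - (us, vs)) - (ps + qs))) ` epi"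
  have EI: "(Lm w - c, r + inner (g (us, vs)) (w - (us, vs)) - (ps + qs)) \<in> E" if "(w, r) \<in> epi" for w r
    using that unfolding E_def by force
  have E_convex: "convex E"
  proof -
    define k :: "('u \<times> 'v) \<times> real \<Rightarrow> 'x \<times> real" where "k = (\<lambda>z. (Lm (fst z), snd z + inner (g (us, vs)) (fst z)))"
    have "linear k" unfolding k_def
      by (rule linearI) (simp_all add: linear_add[OF Lm] linear_cmul[OF Lm] inner_add_right algebra_simps)
    then have "convex (k ` epi)" using epi_convex by (rule convex_linear_image)
    moreover have "E = (\<lambda>z. (- c, - inner (g (us, vs)) (us, vs) - (ps + qs)) + z) ` (k ` epi)"
      unfolding E_def k_def image_image by (intro image_cong) (auto simp: inner_diff_right)
    ultimately show ?thesis by (metis convex_translation)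
  qed
  have base: "((us, vs), ps + qs) \<in> epi" using ps qs by (auto simp: epi_def)
  have E0: "(0, 0) \<in> E" using EI[OF base] feas by simp
  have "((us, vs), ps + qs + 1) \<in> epi" 
    unfolding epi_def mem_Collect_eq case_prod_conv fst_conv snd_conv
    by (rule exI[of _ ps], rule exI[of _ qs]) (simp add: ps qs)
  from EI[OF this] have E1: "(0, 1) \<in> E" using feas by simp
  have E_nonneg: "0 \<le> r" if E_r: "(0, r) \<in> E" for r
  proof -
    obtain w r' where "(w, r') \<in> epi" "Lm w = c" "r = r' + inner (g (us, vs)) (w - (us, vs)) - (ps + qs)"
      using E_r unfolding E_def by auto
    then show ?thesis using lin_opt by fastforce
  qed
  \<comment> \<open>Otherwise the segment from \<open>(0, 1)\<close> could be prolonged beyond the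
    origin within \<open>E\<close>, to a point \<open>(0, r)\<close> with
    \<open>r < 0\<close>.\<close>
  have "(0, 0) \<notin> rel_interior E"
  proof
    assume "(0, 0) \<in> rel_interior E"
    then obtain e where "e > 1" "(1 - e) *\<^sub>R (0, 1) + e *\<^sub>R (0, 0) \<in> E"
      using convex_rel_interior_iff[OF E_convex] E1 by blast
    then show False using E_nonneg[of "1 - e"] by simp
  qed
  then obtain ax where ax: "\<And>y. y \<in> E \<Longrightarrow> inner ax (0, 0) \<le> inner ax y"
      "\<And>y. y \<in> rel_interior E \<Longrightarrow> inner ax (0, 0) < inner ax y"
    using supporting_hyperplane_rel_boundary[OF E_convex E0] by metis
  obtain a \<alpha> where ax_eq: "ax = (a, \<alpha>)" by (cases ax)
  have "0 \<le> \<alpha>" using ax(1)[OF E1] by (simp add: ax_eq)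
  \<comment> \<open>A vertical hyperplane would constrain the values of \<open>Lm\<close> alone. As
    \<open>c\<close> is in the relative interior of \<open>Y\<close>, the functional
    \<open>a\<close> is constant on \<open>Y\<close>; then \<open>ax\<close> vanishes on
    \<open>E\<close>, against strictness on the relative interior.\<close>
  have "\<alpha> \<noteq> 0"
  proof
    assume \<alpha>0: "\<alpha> = 0"
    define Y where "Y = Lm ` (edom p \<times> edom q)"
    have conv_dom: "convex (edom p \<times> edom q)"
      using p_cpc q_cpc by (intro convex_Times cpc_convex_edom)
    have "Lm (uh, vh) \<in> rel_interior Y"
      unfolding Y_def rel_interior_convex_linear_image[OF Lm conv_dom, symmetric] using slater(1) by simp
    then have cY: "c \<in> rel_interior Y" using slater(2) by (simp add: Lm_def)
    have Y_convex: "convex Y" unfolding Y_def by (rule convex_linear_image[OF Lm conv_dom])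
    have Y_ge: "0 \<le> inner a (y - c)" if yY: "y \<in> Y" for y
    proof -
      obtain w where w: "y = Lm w" "fst w \<in> edom p" "snd w \<in> edom q" using yY by (auto simp: Y_def)
      obtain s t where "p (fst w) = ereal s" "q (snd w) = ereal t"
        using w cpc_real[OF p_cpc] cpc_real[OF q_cpc] by metis
      then have "(w, s + t) \<in> epi" by (auto simp: epi_def)
      from ax(1)[OF EI[OF this]] show ?thesis by (simp add: ax_eq \<alpha>0 w(1))
    qed
    have Y_eq: "inner a (y - c) = 0" if yY: "y \<in> Y" for y
    proof -
      obtain e where e: "e > 1" "(1 - e) *\<^sub>R y + e *\<^sub>R c \<in> Y"
        using convex_rel_interior_iff[OF Y_convex] cY yY by blast
      have "(1 - e) *\<^sub>R y + e *\<^sub>R c - c = (1 - e) *\<^sub>R (y - c)" by (simp add: algebra_simps)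
      then have "0 \<le> (1 - e) * inner a (y - c)" using Y_ge[OF e(2)] by simp
      then show ?thesis using Y_ge[OF yY] e(1) by (smt (verit) mult_neg_pos)
    qed
    have "inner ax z = 0" if zE: "z \<in> E" for z
    proof -
      obtain w r where wr: "(w, r) \<in> epi" "fst z = Lm w - c" using zE by (auto simp: E_def)
      then have "Lm w \<in> Y" by (auto simp: epi_def Y_def edom_def mem_Times_iff intro!: imageI le_less_trans)
      then show ?thesis using Y_eq wr(2) by (cases z) (simp add: ax_eq \<alpha>0)
    qed
    moreover obtain z where "z \<in> rel_interior E"
      using E_convex E0 rel_interior_eq_empty by blast
    ultimately show False using ax(2)[of z] rel_interior_subset[of E] by (metis inner_zero_right less_irrefl subsetD zero_prod_def)
  qed
  with \<open>0 \<le> \<alpha>\<close> have \<alpha>: "0 < \<alpha>" by simp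
  define x where "x = a /\<^sub>R \<alpha>"
  have mult: "ps + qs \<le> s + t + inner (g (us, vs)) ((u, v) - (us, vs)) + inner x (Lm (u, v) - c)"
    if "p u \<le> ereal s" "q v \<le> ereal t" for u v s t
  proof -
    have "((u, v), s + t) \<in> epi" using that by (auto simp: epi_def)
    from ax(1)[OF EI[OF this]]
    have "0 \<le> inner a (Lm (u, v) - c) + \<alpha> * (s + t + inner (g (us, vs)) ((u, v) - (us, vs)) - (ps + qs))"
      by (simp add: ax_eq)
    moreover have "inner a (Lm (u, v) - c) = \<alpha> * inner x (Lm (u, v) - c)" using \<alpha> by (simp add: x_def)
    ultimately have "0 \<le> \<alpha> * (inner x (Lm (u, v) - c) + (s + t + inner (g (us, vs)) ((u, v) - (us, vs)) - (ps + qs)))"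
      by (simp only: distrib_left)
    then show ?thesis using \<alpha> by (simp add: zero_le_mult_iff)
  qed
  obtain g1 g2 where g12: "g (us, vs) = (g1, g2)" by (cases "g (us, vs)")
  \<comment> \<open>Fixing \<open>v = vs\<close> here and \<open>u = us\<close> below splits the
    joint inequality into the two subgradient conditions.\<close>
  have "- (g1 + A x) \<in> subdiff p us"
  proof (rule subdiffI[OF p_cpc ps])
    fix y t assume "p y \<le> ereal t"
    from mult[OF this, of vs qs] have "ps \<le> t + inner g1 (y - us) + inner x (Lm (y, vs) - c)"
      using qs by (simp add: g12)
    also have "Lm (y, vs) - c = adjoint A (y - us)"
      using feas by (auto simp: Lm_def linear_diff[OF adjA])
    also have "inner x (adjoint A (y - us)) = inner (A x) (y - us)" by (rule adjoint_works[OF A])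
    finally show "ps + inner (- (g1 + A x)) (y - us) \<le> t"
      unfolding inner_minus_left inner_add_left by linarith
  qed
  moreover have "- (g2 + B x) \<in> subdiff q vs"
  proof (rule subdiffI[OF q_cpc qs])
    fix y t assume "q y \<le> ereal t"
    from mult[OF _ this, of us ps] have "qs \<le> t + inner g2 (y - vs) + inner x (Lm (us, y) - c)"
      using ps by (simp add: g12)
    also have "Lm (us, y) - c = adjoint B (y - vs)"
      using feas by (auto simp: Lm_def linear_diff[OF adjB])
    also have "inner x (adjoint B (y - vs)) = inner (B x) (y - vs)" by (rule adjoint_works[OF B])
    finally show "qs + inner (- (g2 + B x)) (y - vs) \<le> t"
      unfolding inner_minus_left inner_add_left by linarith
  qed
  ultimately show ?thesis
    unfolding is_KKT_def using opt g12
    by (intro exI[of _ x] conjI bexI[of _ "- (g1 + A x)"] bexI[of _ "- (g2 + B x)"])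
      (auto simp: is_optimal_def zero_prod_def)
qed

section \<open>Quadratic forms\<close>

definition qf :: "('a::real_inner \<Rightarrow> 'a) \<Rightarrow> 'a \<Rightarrow> real" where
  "qf F x = inner x (F x)"

lemma self_adjointD:
  assumes "self_adjoint F"
  shows "linear F" "inner (F x) y = inner x (F y)" "inner x (F y) = inner y (F x)"
proof -
  show "linear F" using assms by (simp add: self_adjoint_def)
  show sym: "inner (F x) y = inner x (F y)" for x y using assms by (simp add: self_adjoint_def)
  show "inner x (F y) = inner y (F x)" using sym[of y x] by (simp add: inner_commute)
qed

lemma psd_opD:
  assumes "psd_op F"
  shows "self_adjoint F" "linear F" "0 \<le> qf F x" "inner x (F y) = inner y (F x)"
  using assms self_adjointD[of F] by (auto simp: psd_op_def qf_def)

lemma qf_add: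
  assumes "self_adjoint F"
  shows "qf F (a + b) = qf F a + 2 * inner a (F b) + qf F b"
  using self_adjointD(3)[OF assms, of b a]
  by (simp add: qf_def linear_add[OF self_adjointD(1)[OF assms]] inner_add_left inner_add_right)

lemma qf_diff:
  assumes "self_adjoint F"
  shows "qf F (a - b) = qf F a - 2 * inner a (F b) + qf F b"
  using self_adjointD(3)[OF assms, of b a]
  by (simp add: qf_def linear_diff[OF self_adjointD(1)[OF assms]] inner_diff_left inner_diff_right)

lemma qf_scale: "linear F \<Longrightarrow> qf F (t *\<^sub>R a) = t\<^sup>2 * qf F a"
  by (simp add: qf_def linear_cmul power2_eq_square)

lemma qf_zero [simp]: "qf F 0 = 0" by (simp add: qf_def)

lemma qf_polarize:
  assumes "self_adjoint F"
  shows "2 * inner (F (a - b)) a = qf F a - qf F b + qf F (a - b)"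
  using self_adjointD(2,3)[OF assms]
  by (simp add: qf_diff[OF assms] linear_diff[OF self_adjointD(1)[OF assms]] inner_diff_left)
    (simp add: qf_def inner_commute)

lemma qf_diff_le:
  assumes "psd_op F"
  shows "qf F (a - b) \<le> 2 * qf F a + 2 * qf F b"
  using psd_opD(3)[OF assms, of "a + b"] psd_opD(1)[OF assms] by (simp add: qf_add qf_diff)

lemma qf_cross_le:
  assumes "psd_op F"
  shows "2 * inner a (F b) \<le> qf F a + qf F b"
  using psd_opD(3)[OF assms, of "a - b"] psd_opD(1)[OF assms] by (simp add: qf_diff)

lemma norm_sq_diff_le: "(norm (a - b))\<^sup>2 \<le> 2 * (norm a)\<^sup>2 + 2 * (norm (b :: 'a::real_inner))\<^sup>2"
proof -
  have "0 \<le> (norm (a + b))\<^sup>2" by simp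
  then show ?thesis by (simp add: power2_norm_eq_inner inner_add_left inner_add_right inner_diff_left inner_diff_right inner_commute)
qed

lemma continuous_on_qf:
  fixes F :: "'a::euclidean_space \<Rightarrow> 'a"
  assumes "linear F" "continuous_on S h"
  shows "continuous_on S (\<lambda>x. qf F (h x))"
proof -
  have "continuous_on S (\<lambda>x. F (h x))"
    using assms by (intro continuous_on_compose2[OF linear_continuous_on assms(2), of F UNIV])
      (auto simp: linear_linear)
  then show ?thesis unfolding qf_def by (intro continuous_intros assms(2))
qed

text \<open>Stated for a homogeneous function instead of an operator, because the functions it is
  applied to also contain norms of \<open>adjoint A\<close> and \<open>adjoint B\<close>. The
  constant is the reciprocal of the minimum on the unit sphere.\<close>

lemma quadratic_coercive:
  fixes N :: "'a::euclidean_space \<Rightarrow> real"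
  assumes cont: "continuous_on UNIV N" and hom: "\<And>t x. N (t *\<^sub>R x) = t\<^sup>2 * N x"
    and pos: "\<And>x. x \<noteq> 0 \<Longrightarrow> 0 < N x"
  obtains C where "0 < C" "\<And>x. (norm x)\<^sup>2 \<le> C * N x"
proof -
  have ne: "sphere (0 :: 'a) 1 \<noteq> {}" by simp
  obtain x0 where x0: "x0 \<in> sphere 0 1" "\<And>x. x \<in> sphere 0 1 \<Longrightarrow> N x0 \<le> N x"
    using continuous_attains_inf[OF compact_sphere ne continuous_on_subset[OF cont subset_UNIV]] by blast
  have N0: "0 < N x0" using x0(1) by (intro pos) auto
  have "(norm x)\<^sup>2 \<le> inverse (N x0) * N x" for x
  proof (cases "x = 0")
    case True
    then show ?thesis using hom[of 0 0] by simp
  next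
    case False
    then have "N x0 \<le> N (inverse (norm x) *\<^sub>R x)" by (intro x0(2)) simp
    then have "N x0 * (norm x)\<^sup>2 \<le> N x"
      using False unfolding hom by (simp add: power_inverse field_simps)
    then show ?thesis using N0 by (simp add: field_simps)
  qed
  then show thesis using that N0 by (metis positive_imp_inverse_positive)
qed

lemma pd_op_coercive:
  fixes F :: "'a::euclidean_space \<Rightarrow> 'a"
  assumes "pd_op F"
  obtains C where "0 < C" "\<And>x. (norm x)\<^sup>2 \<le> C * qf F x"
proof (rule quadratic_coercive[of "qf F"])
  have "linear F" using assms by (simp add: pd_op_def self_adjoint_def)
  then show "continuous_on UNIV (qf F)" "\<And>t x. qf F (t *\<^sub>R x) = t\<^sup>2 * qf F x"
    using continuous_on_qf[of F UNIV "\<lambda>x. x"] by (simp_all add: qf_scale)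
  show "\<And>x. x \<noteq> 0 \<Longrightarrow> 0 < qf F x" using assms by (simp add: pd_op_def qf_def)
qed (use that in blast)

text \<open>Common shape of both subproblems: \<open>k\<close> collects what does not depend on the
  variable, \<open>F\<close> joins the diagonal block of \<open>Q + H\<close> with the proximal
  operator, and \<open>m\<close> is the part of the residual due to the other block and
  \<open>c\<close>.\<close>

lemma subproblem_optimality:
  fixes f :: "'a::euclidean_space \<Rightarrow> ereal" and A :: "'x::euclidean_space \<Rightarrow> 'a" and F :: "'a \<Rightarrow> 'a"
  assumes cpc: "closed_proper_convex f" and F: "self_adjoint F" and A: "linear A"
    and h: "\<And>y. h y = k + inner a (y - x0) + 1/2 * qf F (y - x0) + inner l (adjoint A y + m)
              + \<sigma> / 2 * (norm (adjoint A y + m))\<^sup>2"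
    and min: "\<And>y. f x + ereal (h x) \<le> f y + ereal (h y)"
  shows "- (a + F (x - x0) + A (l + \<sigma> *\<^sub>R (adjoint A x + m))) \<in> subdiff f x"
proof (rule subdiff_of_minimizer[OF cpc _ min])
  have adj: "linear (adjoint A)" using A by (rule adjoint_linear)
  have blF: "bounded_linear F" using self_adjointD(1)[OF F] by (simp add: linear_linear)
  have blA: "bounded_linear (adjoint A)" using adj by (simp add: linear_linear)
  have dF: "((\<lambda>y. F (y - x0)) has_derivative F) (at x)"
    by (rule has_derivative_eq_rhs[OF bounded_linear.has_derivative[OF blF]]) (auto intro!: derivative_eq_intros)
  have dA: "((\<lambda>y. adjoint A y) has_derivative adjoint A) (at x)"
    by (rule bounded_linear_imp_has_derivative[OF blA])
  have "(h has_derivative (\<lambda>d. inner a d + 1/2 * (inner (x - x0) (F d) + inner d (F (x - x0)))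
      + inner l (adjoint A d) + \<sigma> / 2 * (inner (adjoint A x + m) (adjoint A d) + inner (adjoint A d) (adjoint A x + m)))) (at x)"
    unfolding h[abs_def] qf_def power2_norm_eq_inner
    by (rule has_derivative_eq_rhs, (rule derivative_intros dF dA)+) auto
  then show "(h has_derivative (\<lambda>d. inner (a + F (x - x0) + A (l + \<sigma> *\<^sub>R (adjoint A x + m))) d)) (at x)"
  proof (rule has_derivative_eq_rhs, intro ext)
    fix d
    have 1: "inner (x - x0) (F d) = inner (F (x - x0)) d" "inner d (F (x - x0)) = inner (F (x - x0)) d"
      by (simp_all only: self_adjointD(2)[OF F] inner_commute[of d])
    have 2: "inner y (adjoint A d) = inner (A y) d" "inner (adjoint A d) y = inner (A y) d" for y
      using adjoint_works[OF A, of y d] by (simp_all add: inner_commute)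
    show "inner a d + 1/2 * (inner (x - x0) (F d) + inner d (F (x - x0)))
      + inner l (adjoint A d) + \<sigma> / 2 * (inner (adjoint A x + m) (adjoint A d) + inner (adjoint A d) (adjoint A x + m))
      = inner (a + F (x - x0) + A (l + \<sigma> *\<^sub>R (adjoint A x + m))) d"
      unfolding 1 2 by (simp add: linear_add[OF A] linear_cmul[OF A] inner_add_left)
  qed
qed

text \<open>The mean value inequality, tested with \<open>- d\<close>, bounds the growth of the
  gradient along \<open>d\<close> from below; monotonicity of an auxiliary function integrates this
  growth. The curvature \<gamma> belongs to the one direction \<open>d\<close>.\<close>

lemma quadratic_lower_bound:
  fixes \<phi> :: "'a::euclidean_space \<Rightarrow> real"
  assumes grad: "\<And>w. (\<phi> has_derivative (\<lambda>h. inner (g w) h)) (at w)"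
    and lip: "\<And>w w'. norm (g w - g w') \<le> L * norm (w - w')"
    and hess: "\<And>z W. (g has_derivative W) (at z) \<Longrightarrow> \<gamma> \<le> inner d (W d)"
  shows "\<phi> w + inner (g w) d + 1/2 * \<gamma> \<le> \<phi> (w + d)"
proof -
  have mono: "t * \<gamma> \<le> inner d (g (w + t *\<^sub>R d) - g w)" if "0 \<le> t" for t
  proof -
    have "inner (- d) (g (w + t *\<^sub>R d) - g w) \<le> - (t * \<gamma>)"
    proof (rule mean_value_inequality_of_derivatives[OF lip])
      fix z W assume W: "(g has_derivative W) (at z)"
      have "W (t *\<^sub>R d) = t *\<^sub>R W d" using has_derivative_linear[OF W] by (simp add: linear_cmul)
      then show "inner (- d) (W (t *\<^sub>R d)) \<le> - (t * \<gamma>)"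
        using hess[OF W] that by (simp add: mult_left_mono)
    qed
    then show ?thesis by simp
  qed
  define h where "h t = \<phi> (w + t *\<^sub>R d) - t * inner (g w) d - t\<^sup>2 / 2 * \<gamma>" for t
  have "(h has_real_derivative (inner d (g (w + t *\<^sub>R d) - g w) - t * \<gamma>)) (at t)" for t
  proof -
    have "((\<lambda>t. \<phi> (w + t *\<^sub>R d)) has_derivative (\<lambda>s. inner (g (w + t *\<^sub>R d)) (s *\<^sub>R d))) (at t)"
      by (rule has_derivative_compose[OF _ grad]) (auto intro!: derivative_eq_intros)
    then have 1: "((\<lambda>t. \<phi> (w + t *\<^sub>R d)) has_real_derivative inner (g (w + t *\<^sub>R d)) d) (at t)"
      unfolding has_field_derivative_def by (rule has_derivative_eq_rhs) (simp add: fun_eq_iff mult.commute)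
    show ?thesis unfolding h_def[abs_def]
      by (auto intro!: derivative_eq_intros 1 simp: inner_diff_right inner_commute)
  qed
  then have "h 0 \<le> h 1"
    using mono by (intro DERIV_nonneg_imp_nondecreasing[of 0 1 h]) fastforce+
  then show ?thesis by (simp add: h_def)
qed

lemma quadratic_upper_bound:
  fixes \<phi> :: "'a::euclidean_space \<Rightarrow> real"
  assumes grad: "\<And>w. (\<phi> has_derivative (\<lambda>h. inner (g w) h)) (at w)"
    and lip: "\<And>w w'. norm (g w - g w') \<le> L * norm (w - w')"
    and hess: "\<And>z W. (g has_derivative W) (at z) \<Longrightarrow> inner d (W d) \<le> \<gamma>"
  shows "\<phi> (w + d) \<le> \<phi> w + inner (g w) d + 1/2 * \<gamma>"
proof -
  have "- \<phi> w + inner (- g w) d + 1/2 * (- \<gamma>) \<le> - \<phi> (w + d)"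
  proof (rule quadratic_lower_bound[where \<phi> = "\<lambda>w. - \<phi> w" and g = "\<lambda>w. - g w" and L = L])
    show "((\<lambda>w. - \<phi> w) has_derivative inner (- g w)) (at w)" for w
      by (rule has_derivative_eq_rhs[OF has_derivative_minus[OF grad[of w]]]) (simp add: fun_eq_iff)
    show "norm (- g w - - g w') \<le> L * norm (w - w')" for w w'
      using lip[of w w'] by (simp add: norm_minus_commute)
    fix z W assume "((\<lambda>w. - g w) has_derivative W) (at z)"
    from has_derivative_minus[OF this] have "(g has_derivative (\<lambda>h. - W h)) (at z)" by simp
    from hess[OF this] show "- \<gamma> \<le> inner d (W d)" by simp
  qed
  then show ?thesis by simp
qed

section \<open>Vanishing decrements, identities of quadratic forms, a Young inequality\<close>

lemma nonneg_decrement_tendsto_0: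
  fixes \<Phi> a :: "nat \<Rightarrow> real"
  assumes "\<And>k. 0 \<le> \<Phi> k" "\<And>k. 0 \<le> a k" "\<And>k. \<Phi> (Suc k) + a k \<le> \<Phi> k"
  shows "a \<longlonglongrightarrow> 0"
proof -
  have "decseq \<Phi>" using assms(2,3) by (intro decseq_SucI) (smt (verit))
  then obtain l where l: "\<Phi> \<longlonglongrightarrow> l" using decseq_convergent[of \<Phi> 0] assms(1) by blast
  then have "(\<lambda>k. \<Phi> k - \<Phi> (Suc k)) \<longlonglongrightarrow> l - l" by (intro tendsto_diff LIMSEQ_Suc)
  then show ?thesis
    by (intro tendsto_sandwich[of "\<lambda>_. 0" a sequentially "\<lambda>k. \<Phi> k - \<Phi> (Suc k)"])
      (use assms(2,3) in \<open>auto simp: algebra_simps\<close>)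
qed

lemma tendsto_0_by_coercivity:
  fixes w :: "nat \<Rightarrow> 'a::real_normed_vector"
  assumes "\<And>k. (norm (w k))\<^sup>2 \<le> a k" "a \<longlonglongrightarrow> (0::real)"
  shows "w \<longlonglongrightarrow> 0"
proof -
  have "(\<lambda>k. (norm (w k))\<^sup>2) \<longlonglongrightarrow> 0"
    by (rule tendsto_sandwich[OF _ _ tendsto_const assms(2)]) (use assms(1) in auto)
  then have "(\<lambda>k. sqrt ((norm (w k))\<^sup>2)) \<longlonglongrightarrow> sqrt 0" by (rule tendsto_real_sqrt)
  then show ?thesis by (simp add: tendsto_norm_zero_iff)
qed

lemma self_adjoint_add: "self_adjoint F \<Longrightarrow> self_adjoint G \<Longrightarrow> self_adjoint (\<lambda>a. F a + G a)"
  by (simp add: self_adjoint_def linear_compose_add inner_add_left inner_add_right)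

lemma tendsto_linear:
  fixes F :: "'a::euclidean_space \<Rightarrow> 'b::real_normed_vector"
  assumes "linear F" "(h \<longlongrightarrow> l) net"
  shows "((\<lambda>k. F (h k)) \<longlongrightarrow> F l) net"
  using bounded_linear.tendsto[of F h l net] assms by (simp add: linear_linear)

lemma tendsto_qf:
  fixes F :: "'a::euclidean_space \<Rightarrow> 'a"
  assumes "linear F" "(h \<longlongrightarrow> l) net"
  shows "((\<lambda>k. qf F (h k)) \<longlongrightarrow> qf F l) net"
  unfolding qf_def by (intro tendsto_inner assms(2) tendsto_linear[OF assms])

lemma qf_polarize_step:
  assumes "self_adjoint F"
  shows "2 * inner (F e) a = qf F a - qf F (a - e) + qf F e"
  using qf_polarize[OF assms, of a "a - e"] by simp

text \<open>Isolates the telescoping part in \<open>descent\<close>, where \<open>z\<close> is the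
  full error, \<open>e\<close> and \<open>f\<close> are the \<open>u\<close>- and
  \<open>v\<close>-part of the step and \<open>b\<close> is the \<open>v\<close>-error. The
  \<open>u\<close>-step pairs with all of \<open>z\<close>, the \<open>v\<close>-step only with
  \<open>b\<close>, because the first update does not yet see the new \<open>v\<close>.\<close>

lemma qf_cross_identity:
  assumes F: "self_adjoint F"
  shows "qf F (z - (e + f)) + qf F z - qf F (e + f) + 2 * (inner z (F e) + inner b (F f))
    = qf F z + qf F (z - f) + (qf F b - qf F (b - f))"
  unfolding qf_diff[OF F] linear_add[OF self_adjointD(1)[OF F]] inner_add_right by (simp add: algebra_simps)

text \<open>Among the combinations \<open>(1 - \<theta>) * qf F (y + f) + \<theta> * qf F (y - e)\<close> of the first two terms, only
  \<open>\<theta> = 3/2\<close> makes the left-hand side positive semidefinite.\<close>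
lemma qf_sum_of_squares:
  assumes F: "self_adjoint F"
  shows "- (1/2) * qf F (y + f) + 3/2 * qf F (y - e) + qf F y + 2 * inner f (F (e + f)) - 1/4 * qf F (e + f)
    = 2 * qf F (y - (1/4) *\<^sub>R (f + 3 *\<^sub>R e)) + 1/8 * qf F (3 *\<^sub>R f + e)"
proof -
  note lin = self_adjointD(1)[OF F]
  have "inner e (F f) = inner f (F e)" by (rule self_adjointD(3)[OF F])
  then show ?thesis
    unfolding qf_diff[OF F] qf_add[OF F] qf_scale[OF lin] linear_add[OF lin] linear_cmul[OF lin]
      inner_add_right inner_scaleR_right inner_scaleR_left
    by (simp add: qf_def algebra_simps power2_eq_square)
qed

lemma tendsto_0_le:
  fixes b a :: "nat \<Rightarrow> real"
  assumes "a \<longlonglongrightarrow> 0" "\<And>k. 0 \<le> b k" "\<And>k. b k \<le> a k"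
  shows "b \<longlonglongrightarrow> 0"
  by (rule tendsto_sandwich[OF _ _ tendsto_const assms(1)]) (use assms(2,3) in auto)

text \<open>The terms with \<open>c0\<close> telescope, and \<open>c1\<close>, \<open>c2\<close> are
  the margin. In both cases the right side minus the left side is a nonnegative multiple of a single
  square.\<close>

lemma young_golden_ratio:
  fixes \<tau> :: real
  assumes "0 < \<tau>" "\<tau> < (1 + sqrt 5) / 2"
  shows "\<exists>c0 c1 c2. 0 \<le> c0 \<and> 0 < c1 \<and> 0 < c2 \<and> (\<forall>(R'::'a::real_inner) (R::'a) b.
     (c0 + c1) * (norm R')\<^sup>2 - c0 * (norm R)\<^sup>2 + c2 * (norm b)\<^sup>2
       \<le> (2 - \<tau>) * (norm R')\<^sup>2 + (norm b)\<^sup>2 - 2 * (1 - \<tau>) * inner R b)"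
proof (cases "\<tau> \<le> 1")
  case True
  \<comment> \<open>These weights leave \<open>1 - \<tau>\<close> times the squared norm of
    \<open>R - b\<close>.\<close>
  show ?thesis
  proof (rule exI[of _ "1 - \<tau>"], rule exI[of _ 1], rule exI[of _ \<tau>], intro conjI allI)
    fix R' R b :: 'a
    have "0 \<le> (1 - \<tau>) * (norm (R - b))\<^sup>2" using True by simp
    then show "(1 - \<tau> + 1) * (norm R')\<^sup>2 - (1 - \<tau>) * (norm R)\<^sup>2 + \<tau> * (norm b)\<^sup>2
       \<le> (2 - \<tau>) * (norm R')\<^sup>2 + (norm b)\<^sup>2 - 2 * (1 - \<tau>) * inner R b"
      by (simp add: power2_norm_eq_inner inner_diff_left inner_diff_right inner_commute algebra_simps)
  qed (use True assms in auto)
next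
  case False
  \<comment> \<open>The golden ratio is the positive root of \<open>1 + \<tau> - \<tau>^2\<close>,
    to which both margins are proportional.\<close>
  have gold: "0 < 1 + \<tau> - \<tau>\<^sup>2"
  proof -
    have "2 * \<tau> - 1 < sqrt 5" "0 \<le> 2 * \<tau> - 1" using assms(2) False by (auto simp: field_simps)
    then have "(2 * \<tau> - 1)\<^sup>2 < (sqrt 5)\<^sup>2" by (intro power_strict_mono) auto
    then show ?thesis by (simp add: power2_eq_square algebra_simps)
  qed
  \<comment> \<open>Now the square is that of \<open>R + \<tau> *\<^sub>R b\<close>, with weight
    \<open>(\<tau> - 1) / \<tau>\<close>; its coefficient at \<open>R\<close> dictates
    \<open>c0\<close>.\<close>
  show ?thesis
  proof (rule exI[of _ "1 - 1 / \<tau>"], rule exI[of _ "(1 + \<tau> - \<tau>\<^sup>2) / \<tau>"], rule exI[of _ "1 + \<tau> - \<tau>\<^sup>2"],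
      intro conjI allI)
    fix R' R b :: 'a
    have s: "1 - 1 / \<tau> + (1 + \<tau> - \<tau>\<^sup>2) / \<tau> = 2 - \<tau>" using assms(1) by (simp add: field_simps power2_eq_square)
    have "0 \<le> ((\<tau> - 1) / \<tau>) * (norm (R + \<tau> *\<^sub>R b))\<^sup>2" using False by simp
    also have "\<dots> = ((\<tau> - 1) / \<tau>) * (norm R)\<^sup>2 + 2 * (\<tau> - 1) * inner R b + \<tau> * (\<tau> - 1) * (norm b)\<^sup>2"
      using assms(1) by (simp add: power2_norm_eq_inner inner_add_left inner_add_right inner_commute field_simps)
    finally have *: "0 \<le> ((\<tau> - 1) / \<tau>) * (norm R)\<^sup>2 + 2 * (\<tau> - 1) * inner R b + \<tau> * (\<tau> - 1) * (norm b)\<^sup>2" .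
    have t: "(\<tau> - 1) / \<tau> = 1 - 1 / \<tau>" using assms(1) by (simp add: field_simps)
    show "(1 - 1 / \<tau> + (1 + \<tau> - \<tau>\<^sup>2) / \<tau>) * (norm R')\<^sup>2 - (1 - 1 / \<tau>) * (norm R)\<^sup>2 + (1 + \<tau> - \<tau>\<^sup>2) * (norm b)\<^sup>2
       \<le> (2 - \<tau>) * (norm R')\<^sup>2 + (norm b)\<^sup>2 - 2 * (1 - \<tau>) * inner R b"
      using * unfolding s t by (simp add: algebra_simps power2_eq_square[of \<tau>])
  qed (use gold False assms in \<open>auto simp: field_simps\<close>)
qed

section \<open>The majorized ADMM\<close>

locale majorized_admm =
  fixes p :: "'u::euclidean_space \<Rightarrow> ereal" and q :: "'v::euclidean_space \<Rightarrow> ereal"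
    and \<phi> :: "'u \<times> 'v \<Rightarrow> real" and g :: "'u \<times> 'v \<Rightarrow> 'u \<times> 'v"
    and A :: "'x::euclidean_space \<Rightarrow> 'u" and B :: "'x \<Rightarrow> 'v" and c :: 'x
    and Q H :: "'u \<times> 'v \<Rightarrow> 'u \<times> 'v"
    and D1 S :: "'u \<Rightarrow> 'u" and D2 T :: "'v \<Rightarrow> 'v"
    and \<eta> \<sigma> \<tau> :: real
    and u :: "nat \<Rightarrow> 'u" and v :: "nat \<Rightarrow> 'v" and x :: "nat \<Rightarrow> 'x"
  assumes p_cpc: "closed_proper_convex p" and q_cpc: "closed_proper_convex q"
    and phi_grad: "\<forall>w. (\<phi> has_derivative (\<lambda>h. inner (g w) h)) (at w)"
    and grad_lip: "\<exists>L. \<forall>w w'. norm (g w - g w') \<le> L * norm (w - w')"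
    and A_lin: "linear A" and B_lin: "linear B"
    and Q_psd: "psd_op Q" and D1_psd: "psd_op D1" and D2_psd: "psd_op D2"
    and H_def: "H = Diag D1 D2"
    and hess_bounds: "\<forall>w. \<forall>W \<in> gen_hessian g w.
        loewner_le Q (blinfun_apply W) \<and> loewner_le (blinfun_apply W) (\<lambda>z. Q z + H z)"
    and eta_nonneg: "0 \<le> \<eta>"
    and eta_bound: "\<forall>z. \<forall>W \<in> gen_hessian g z. \<forall>a b.
        \<bar>inner a (blk12 (blinfun_apply W) b - blk12 Q b)\<bar>
          \<le> \<eta> / 2 * (inner a (D1 a) + inner b (D2 b))"
    and sigma_pos: "\<sigma> > 0" and tau_pos: "\<tau> > 0"
    and S_psd: "psd_op S" and T_psd: "psd_op T"
    and sol_nonempty: "\<exists>u' v'. is_optimal p q \<phi> A B c u' v'"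
    and slater: "\<exists>uh vh. (uh, vh) \<in> rel_interior (edom p \<times> edom q) \<and>
                         adjoint A uh + adjoint B vh = c"
    and pd1: "pd_op (\<lambda>a. blk11 Q a + \<sigma> *\<^sub>R A (adjoint A a) + S a)"
    and pd2: "pd_op (\<lambda>b. blk22 Q b + \<sigma> *\<^sub>R B (adjoint B b) + T b)"
    and init: "v 0 \<in> edom q"
    and u_step: "\<forall>k. \<forall>u'.
        Lhat p q \<phi> g Q H A B c \<sigma> (u (Suc k)) (v k) (x k) (u k, v k)
          + ereal (1/2 * inner (u (Suc k) - u k) (S (u (Suc k) - u k)))
        \<le> Lhat p q \<phi> g Q H A B c \<sigma> u' (v k) (x k) (u k, v k)
          + ereal (1/2 * inner (u' - u k) (S (u' - u k)))"
    and v_step: "\<forall>k. \<forall>v'.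
        Lhat p q \<phi> g Q H A B c \<sigma> (u (Suc k)) (v (Suc k)) (x k) (u k, v k)
          + ereal (1/2 * inner (v (Suc k) - v k) (T (v (Suc k) - v k)))
        \<le> Lhat p q \<phi> g Q H A B c \<sigma> (u (Suc k)) v' (x k) (u k, v k)
          + ereal (1/2 * inner (v' - v k) (T (v' - v k)))"
    and x_step: "\<forall>k. x (Suc k) = x k + (\<tau> * \<sigma>) *\<^sub>R
                       (adjoint A (u (Suc k)) + adjoint B (v (Suc k)) - c)"
begin

section \<open>Consequences of the bounds on the generalized Hessian\<close>

lemma grad: "(\<phi> has_derivative (\<lambda>h. inner (g w) h)) (at w)"
  using phi_grad by blast

lemma linear_adjoints: "linear (adjoint A)" "linear (adjoint B)"
  using A_lin B_lin by (simp_all add: adjoint_linear)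

lemmas adj_simps = linear_add[OF linear_adjoints(1)] linear_diff[OF linear_adjoints(1)]
  linear_add[OF linear_adjoints(2)] linear_diff[OF linear_adjoints(2)]

lemmas Q_sa = psd_opD(1)[OF Q_psd] and Q_lin = psd_opD(2)[OF Q_psd]

lemma Q_split: "Q (a, b) = Q (a, 0) + Q (0, b)"
  using linear_add[OF Q_lin, of "(a, 0)" "(0, b)"] by simp

lemma qf_H: "qf H (a, b) = qf D1 a + qf D2 b"
  by (simp add: H_def Diag_def qf_def)

lemma blk_self_adjoint: "self_adjoint (blk11 Q)" "self_adjoint (blk22 Q)"
proof -
  have "fst (Q (a + b, 0)) = fst (Q (a, 0)) + fst (Q (b, 0))" "fst (Q (t *\<^sub>R a, 0)) = t *\<^sub>R fst (Q (a, 0))"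
    for a b t
    using linear_add[OF Q_lin, of "(a, 0)" "(b, 0)"] linear_cmul[OF Q_lin, of t "(a, 0)"] by simp_all
  moreover have "inner (fst (Q (a, 0))) b = inner a (fst (Q (b, 0)))" for a b
    using self_adjointD(2)[OF Q_sa, of "(a, 0)" "(b, 0)"] by (simp add: inner_prod_def)
  ultimately show "self_adjoint (blk11 Q)"
    unfolding self_adjoint_def blk11_def by (auto intro: linearI)
  have "snd (Q (0, a + b)) = snd (Q (0, a)) + snd (Q (0, b))" "snd (Q (0, t *\<^sub>R a)) = t *\<^sub>R snd (Q (0, a))"
    for a b t
    using linear_add[OF Q_lin, of "(0, a)" "(0, b)"] linear_cmul[OF Q_lin, of t "(0, a)"] by simp_all
  moreover have "inner (snd (Q (0, a))) b = inner a (snd (Q (0, b)))" for a b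
    using self_adjointD(2)[OF Q_sa, of "(0, a)" "(0, b)"] by (simp add: inner_prod_def)
  ultimately show "self_adjoint (blk22 Q)"
    unfolding self_adjoint_def blk22_def by (auto intro: linearI)
qed

lemma inner_blk: "inner a (blk11 Q b) = inner (a, 0) (Q (b, 0))" "inner a' (blk22 Q b') = inner (0, a') (Q (0, b'))"
  by (simp_all add: blk11_def blk22_def inner_prod_def)

text \<open>An existing Hessian is the limit of a constant sequence, so the hypotheses on Clarke's
  set apply at every point where \<open>g\<close> is differentiable.\<close>

lemma hessian_in_gen_hessian:
  assumes "(g has_derivative W) (at z)"
  shows "Blinfun W \<in> gen_hessian g z" "blinfun_apply (Blinfun W) = W"
proof -
  show eq: "blinfun_apply (Blinfun W) = W"
    using has_derivative_bounded_linear[OF assms] by (rule bounded_linear_Blinfun_apply)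
  show "Blinfun W \<in> gen_hessian g z"
    unfolding gen_hessian_def
    by (rule hull_inc, rule CollectI, rule exI[of _ "\<lambda>_. z"], rule exI[of _ "\<lambda>_. Blinfun W"])
      (use assms eq in auto)
qed

lemma hessian_bounds:
  assumes "(g has_derivative W) (at z)"
  shows "qf Q d \<le> inner d (W d)" "inner d (W d) \<le> qf Q d + qf H d"
    "\<bar>inner a (fst (W (0, b)) - fst (Q (0, b)))\<bar> \<le> \<eta> / 2 * (qf D1 a + qf D2 b)"
  using hess_bounds[rule_format, OF hessian_in_gen_hessian(1)[OF assms]]
    eta_bound[rule_format, OF hessian_in_gen_hessian(1)[OF assms]]
  unfolding hessian_in_gen_hessian(2)[OF assms]
  by (simp_all add: loewner_le_def qf_def blk12_def inner_add_right del: split_paired_All)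

lemma phi_lower: "\<phi> w + inner (g w) d + 1/2 * qf Q d \<le> \<phi> (w + d)"
proof -
  obtain L where "\<And>w w'. norm (g w - g w') \<le> L * norm (w - w')" using grad_lip by blast
  with grad show ?thesis by (rule quadratic_lower_bound) (rule hessian_bounds)
qed

lemma phi_upper: "\<phi> (w + d) \<le> \<phi> w + inner (g w) d + 1/2 * (qf Q d + qf H d)"
proof -
  obtain L where "\<And>w w'. norm (g w - g w') \<le> L * norm (w - w')" using grad_lip by blast
  with grad show ?thesis by (rule quadratic_upper_bound) (rule hessian_bounds)
qed

text \<open>The gradient change over a step \<open>(a, b)\<close>, tested in a
  \<open>v\<close>-direction. The off-diagonal deviation of the Hessian from \<open>Q\<close> is
  bounded through \<eta> after transposition; the diagonal deviation lies between 0 and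
  \<open>D2\<close>, so its mixed term splits as for a semidefinite form.\<close>

lemma grad_cross:
  "inner (0, d) (Q (a, b)) + inner d (D2 b) - 1/2 * qf D2 b - 1/2 * qf D2 d - \<eta> / 2 * (qf D1 a + qf D2 d)
    \<le> inner (0, d) (g (w + (a, b)) - g w)" (is "?l \<le> _")
proof -
  obtain L where lip: "\<And>w w'. norm (g w - g w') \<le> L * norm (w - w')" using grad_lip by blast
  have "inner (- (0, d)) (g (w + (a, b)) - g w) \<le> - ?l"
  proof (rule mean_value_inequality_of_derivatives[OF lip])
    fix z W assume W: "(g has_derivative W) (at z)"
    note sym = hessian_symmetric[OF grad W] and lin = has_derivative_linear[OF W]
    have split: "W (a, b) = W (a, 0) + W (0, b)" using linear_add[OF lin, of "(a, 0)" "(0, b)"] by simp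
    have "inner (0, d) (W (a, 0)) - inner (0, d) (Q (a, 0)) = inner a (fst (W (0, d)) - fst (Q (0, d)))"
      using sym[of "(0, d)" "(a, 0)"] psd_opD(4)[OF Q_psd, of "(0, d)" "(a, 0)"]
      by (simp add: inner_prod_def inner_diff_right)
    then have 1: "- (\<eta> / 2 * (qf D1 a + qf D2 d)) \<le> inner (0, d) (W (a, 0)) - inner (0, d) (Q (a, 0))"
      using hessian_bounds(3)[OF W, of a d] by (simp add: abs_le_iff)
    \<comment> \<open>The lower right block of \<open>Q + H - W\<close>; its nonnegativity at
      \<open>d - b\<close> together with \<open>E \<le> D2\<close> bounds the mixed term.\<close>
    define E where "E y y' = inner (0, y) (Q (0, y')) + inner y (D2 y') - inner (0, y) (W (0, y'))" for y y'
    have E_sym: "E y y' = E y' y" for y y'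
      using sym[of "(0, y)" "(0, y')"] psd_opD(4)[OF Q_psd, of "(0, y)" "(0, y')"] psd_opD(4)[OF D2_psd, of y y']
      by (simp add: E_def)
    have E_nonneg: "0 \<le> E y y" for y
      using hessian_bounds(2)[OF W, of "(0, y)"] unfolding qf_H by (simp add: E_def qf_def)
    have E_le: "E y y \<le> qf D2 y" for y
      using hessian_bounds(1)[OF W, of "(0, y)"] by (simp add: E_def qf_def)
    have E_diff: "E (d - b) (d - b) = E d d - E d b - E b d + E b b"
    proof -
      have 0: "(0, d - b) = (0, d) - ((0, b) :: 'u \<times> 'v)" by simp
      show ?thesis unfolding E_def 0 linear_diff[OF lin] linear_diff[OF Q_lin] linear_diff[OF psd_opD(2)[OF D2_psd]]
          inner_diff_left inner_diff_right by simp
    qed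
    have 2: "2 * E d b \<le> qf D2 d + qf D2 b"
      using E_nonneg[of "d - b"] E_sym[of b d] E_le[of d] E_le[of b] unfolding E_diff by simp
    have "inner (0, d) (W (a, b)) \<ge> ?l"
      using 1 2 unfolding split Q_split[of a b] inner_add_right E_def by simp
    then show "inner (- (0, d)) (W (a, b)) \<le> - ?l" unfolding inner_minus_left by simp
  qed
  then show ?thesis unfolding inner_minus_left by simp
qed

section \<open>Increments, residuals and optimality conditions of the two subproblems\<close>

definition du where "du k = u (Suc k) - u k"
definition dv where "dv k = v (Suc k) - v k"
definition r where "r k = adjoint A (u k) + adjoint B (v k) - c"

lemma x_Suc: "x (Suc k) = x k + (\<tau> * \<sigma>) *\<^sub>R r (Suc k)"
  using x_step by (simp add: r_def)

text \<open>Finiteness of \<open>q (v k)\<close> lets it be absorbed into the constant of the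
  \<open>u\<close>-subproblem; the minimizations pass it on.\<close>

lemma v_edom: "v k \<in> edom q"
proof (induction k)
  case (Suc k)
  obtain t where t: "q (v k) = ereal t" using cpc_real[OF q_cpc Suc] by blast
  obtain a0 b0 where u0: "p a0 = ereal b0"
    using cpc_edom_nonempty[OF p_cpc] cpc_real[OF p_cpc] by blast
  have "p (u (Suc k)) \<noteq> \<infinity>"
    using u_step[rule_format, of k a0] unfolding Lhat_def t u0 by auto
  moreover have "q (v (Suc k)) \<noteq> \<infinity>"
  proof
    assume inf: "q (v (Suc k)) = \<infinity>"
    obtain s where "p (u (Suc k)) = ereal s"
      using \<open>p (u (Suc k)) \<noteq> \<infinity>\<close> cpc_not_MInf[OF p_cpc] by (cases "p (u (Suc k))") auto
    then show False using v_step[rule_format, of k "v k"] unfolding Lhat_def t inf by auto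
  qed
  ultimately show ?case by (auto simp: edom_def less_top)
qed (rule init)

text \<open>The \<open>u\<close>-step still works with the old \<open>v\<close>: of \<open>Q\<close>
  only the block \<open>blk11 Q\<close> enters, and the residual is \<open>r (Suc k)\<close> without
  the contribution of \<open>dv k\<close>.\<close>

lemma u_subgradient:
  "- (fst (g (u k, v k)) + (blk11 Q (du k) + D1 (du k) + S (du k)) + A (x k + \<sigma> *\<^sub>R (r (Suc k) - adjoint B (dv k))))
     \<in> subdiff p (u (Suc k))"
proof -
  define F where "F a = blk11 Q a + D1 a + S a" for a
  have F: "self_adjoint F" unfolding F_def
    by (intro self_adjoint_add blk_self_adjoint psd_opD(1) D1_psd S_psd)
  obtain t where t: "q (v k) = ereal t" using cpc_real[OF q_cpc v_edom] by blast
  define h where "h y = (t + \<phi> (u k, v k)) + inner (fst (g (u k, v k))) (y - u k) + 1/2 * qf F (y - u k)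
     + inner (x k) (adjoint A y + (adjoint B (v k) - c)) + \<sigma> / 2 * (norm (adjoint A y + (adjoint B (v k) - c)))\<^sup>2" for y
  have eq: "Lhat p q \<phi> g Q H A B c \<sigma> y (v k) (x k) (u k, v k) + ereal (1/2 * inner (y - u k) (S (y - u k)))
      = p y + ereal (h y)" for y
  proof -
    have "1/2 * qf F (y - u k) = 1/2 * inner ((y, v k) - (u k, v k)) (Q ((y, v k) - (u k, v k)) + H ((y, v k) - (u k, v k)))
        + 1/2 * inner (y - u k) (S (y - u k))"
      by (simp add: F_def qf_def inner_add_right inner_blk H_def Diag_def algebra_simps)
    moreover have "inner (fst (g (u k, v k))) (y - u k) = inner (g (u k, v k)) ((y, v k) - (u k, v k))"
      by (simp add: inner_prod_def)
    ultimately show ?thesis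
      unfolding Lhat_def t h_def by (cases "p y") (simp_all add: algebra_simps)
  qed
  have "- (fst (g (u k, v k)) + F (u (Suc k) - u k)
      + A (x k + \<sigma> *\<^sub>R (adjoint A (u (Suc k)) + (adjoint B (v k) - c)))) \<in> subdiff p (u (Suc k))"
    by (rule subproblem_optimality[OF p_cpc F A_lin h_def]) (use u_step eq in metis)
  moreover have "adjoint A (u (Suc k)) + (adjoint B (v k) - c) = r (Suc k) - adjoint B (dv k)"
    by (simp add: r_def dv_def adj_simps)
  ultimately show ?thesis by (simp add: F_def du_def)
qed

text \<open>The majorant is still centred at the old pair, but \<open>u\<close> has already moved;
  hence \<open>Q\<close> acts on the full increment, unlike in the \<open>u\<close>-step.\<close>

lemma v_subgradient:
  "- (snd (g (u k, v k)) + snd (Q (du k, dv k)) + (D2 (dv k) + T (dv k)) + B (x k + \<sigma> *\<^sub>R r (Suc k)))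
     \<in> subdiff q (v (Suc k))"
proof -
  define F where "F a = blk22 Q a + D2 a + T a" for a
  have F: "self_adjoint F" unfolding F_def
    by (intro self_adjoint_add blk_self_adjoint psd_opD(1) D2_psd T_psd)
  obtain t where t: "p (u (Suc k)) = ereal t"
    using cpc_real[OF p_cpc subdiff_edom[OF u_subgradient]] by blast
  define e where "e = u (Suc k) - u k"
  define gk where "gk = g (u k, v k)"
  \<comment> \<open>Terms in \<open>e\<close> alone are constants of the
    \<open>v\<close>-subproblem, while the coupling \<open>Q (e, 0)\<close> becomes part of its
    linear term.\<close>
  define h where "h y = (t + \<phi> (u k, v k) + inner (fst gk) e + 1/2 * qf Q (e, 0) + 1/2 * qf D1 e)
     + inner (snd gk + snd (Q (e, 0))) (y - v k) + 1/2 * qf F (y - v k)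
     + inner (x k) (adjoint B y + (adjoint A (u (Suc k)) - c)) + \<sigma> / 2 * (norm (adjoint B y + (adjoint A (u (Suc k)) - c)))\<^sup>2" for y
  have eq: "Lhat p q \<phi> g Q H A B c \<sigma> (u (Suc k)) y (x k) (u k, v k) + ereal (1/2 * inner (y - v k) (T (y - v k)))
      = q y + ereal (h y)" for y
  proof -
    have pair: "(u (Suc k), y) - (u k, v k) = (e, y - v k)" by (simp add: e_def)
    have "qf Q (e, y - v k) = qf Q (e, 0) + 2 * inner (0, y - v k) (Q (e, 0)) + qf Q (0, y - v k)"
      using qf_add[OF Q_sa, of "(0, y - v k)" "(e, 0)"] by simp
    then have "1/2 * qf F (y - v k) + 1/2 * qf Q (e, 0) + 1/2 * qf D1 e + inner (snd (Q (e, 0))) (y - v k)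
       = 1/2 * inner (e, y - v k) (Q (e, y - v k) + H (e, y - v k)) + 1/2 * inner (y - v k) (T (y - v k))"
      by (simp add: F_def qf_def inner_add_right inner_blk H_def Diag_def inner_prod_def[of "(0, y - v k)" "Q (e, 0)"]
          inner_commute[of "snd (Q (e, 0))"] algebra_simps)
    moreover have "inner (fst gk) e + inner (snd gk) (y - v k) = inner gk (e, y - v k)"
      by (simp add: inner_prod_def)
    moreover have "adjoint B y + (adjoint A (u (Suc k)) - c) = adjoint A (u (Suc k)) + adjoint B y - c" by simp
    ultimately show ?thesis
      unfolding Lhat_def t h_def pair gk_def[symmetric] inner_add_left by (cases "q y") (simp_all add: algebra_simps)
  qed
  have "- (snd gk + snd (Q (e, 0)) + F (v (Suc k) - v k)
      + B (x k + \<sigma> *\<^sub>R (adjoint B (v (Suc k)) + (adjoint A (u (Suc k)) - c)))) \<in> subdiff q (v (Suc k))"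
    by (rule subproblem_optimality[OF q_cpc F B_lin h_def]) (use v_step eq in metis)
  moreover have "adjoint B (v (Suc k)) + (adjoint A (u (Suc k)) - c) = r (Suc k)"
    by (simp add: r_def)
  moreover have "snd (Q (e, 0)) + F (v (Suc k) - v k) = snd (Q (du k, dv k)) + (D2 (dv k) + T (dv k))"
    unfolding Q_split[of "du k" "dv k"] by (simp add: F_def du_def dv_def e_def blk22_def)
  ultimately show ?thesis by (simp add: gk_def add.assoc)
qed

subsection \<open>Descent inequalities\<close>

definition Psi where
  "Psi ub vb xb k = (norm (x k - xb))\<^sup>2 / (\<tau> * \<sigma>) + qf D1 (u k - ub) + qf S (u k - ub)
     + qf Q (0, v k - vb) + qf D2 (v k - vb) + qf T (v k - vb) + \<sigma> * (norm (adjoint B (v k - vb)))\<^sup>2"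

lemma Psi_nonneg: "0 \<le> Psi ub vb xb k"
  unfolding Psi_def using sigma_pos tau_pos psd_opD(3)[OF D1_psd] psd_opD(3)[OF S_psd] psd_opD(3)[OF Q_psd]
    psd_opD(3)[OF D2_psd] psd_opD(3)[OF T_psd] by (intro add_nonneg_nonneg) auto

text \<open>Three expansions whose \<phi>-values cancel in the sum: the majorant from the old
  iterate to the new one, the minorant from the old iterate to \<open>wb\<close>, and the minorant
  from \<open>wb\<close> to the new iterate. In the application \<open>z\<close> is the new error
  and \<open>d\<close> the last step.\<close>

lemma gradient_three_point:
  "qf Q (z - d) + qf Q z - (qf Q d + qf H d) \<le> 2 * inner (g (wb + (z - d)) - g wb) z"
proof -
  define w where "w = wb + (z - d)"
  have "\<phi> (w + d) \<le> \<phi> w + inner (g w) d + 1/2 * (qf Q d + qf H d)" by (rule phi_upper)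
  moreover have "\<phi> w + inner (g w) (d - z) + 1/2 * qf Q (d - z) \<le> \<phi> (w + (d - z))" by (rule phi_lower)
  moreover have "\<phi> wb + inner (g wb) z + 1/2 * qf Q z \<le> \<phi> (wb + z)" by (rule phi_lower)
  moreover have "w + (d - z) = wb" "w + d = wb + z" by (simp_all add: w_def)
  moreover have "qf Q (d - z) = qf Q (z - d)"
    using psd_opD(4)[OF Q_psd, of d z] by (simp add: qf_diff[OF Q_sa])
  ultimately show ?thesis
    unfolding w_def[symmetric] inner_diff_left inner_diff_right by (simp add: add_divide_distrib)
qed

lemma KKT_subgradients:
  assumes "is_KKT p q g A B c ub vb xb"
  shows "- (fst (g (ub, vb)) + A xb) \<in> subdiff p ub" "- (snd (g (ub, vb)) + B xb) \<in> subdiff q vb"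
    "adjoint A ub + adjoint B vb = c"
proof -
  obtain gp gq where g: "gp \<in> subdiff p ub" "gq \<in> subdiff q vb" "0 = g (ub, vb) + (gp + A xb, gq + B xb)"
    using assms by (auto simp: is_KKT_def)
  have "fst (g (ub, vb)) + (gp + A xb) = 0" "snd (g (ub, vb)) + (gq + B xb) = 0"
    using arg_cong[OF g(3), of fst] arg_cong[OF g(3), of snd] by simp_all
  then have "gp = - (fst (g (ub, vb)) + A xb)" "gq = - (snd (g (ub, vb)) + B xb)"
    by (simp_all add: algebra_simps eq_neg_iff_add_eq_0)
  with g show "- (fst (g (ub, vb)) + A xb) \<in> subdiff p ub" "- (snd (g (ub, vb)) + B xb) \<in> subdiff q vb" by simp_all
  show "adjoint A ub + adjoint B vb = c" using assms by (simp add: is_KKT_def)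
qed

text \<open>The optimality conditions of both steps are compared with the KKT conditions and tested
  with the new errors. The cross term of \<open>adjoint B (dv k)\<close> with the residual arises
  because the \<open>u\<close>-step uses the old \<open>v\<close> in its residual.\<close>

lemma descent:
  assumes KKT: "is_KKT p q g A B c ub vb xb"
  shows "Psi ub vb xb (Suc k) + qf Q (u (Suc k) - ub, v (Suc k) - vb) + qf Q (u (Suc k) - ub, v k - vb)
     + qf S (du k) + qf T (dv k)
     + (2 - \<tau>) * (\<sigma> * (norm (r (Suc k)))\<^sup>2) + \<sigma> * (norm (adjoint B (dv k)))\<^sup>2
     - 2 * (\<sigma> * inner (adjoint B (dv k)) (r (Suc k))) \<le> Psi ub vb xb k"
proof -
  define a b e f R y where "a = u (Suc k) - ub" and "b = v (Suc k) - vb" and "e = du k" and "f = dv k"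
    and "R = r (Suc k)" and "y = x k - xb"
  define gk gb where "gk = g (u k, v k)" and "gb = g (ub, vb)"
  note defs = a_def b_def e_def f_def R_def y_def gk_def gb_def
  have uk: "u k - ub = a - e" and vk: "v k - vb = b - f" by (simp_all add: defs du_def dv_def)
  have R: "R = adjoint A a + adjoint B b"
    using KKT_subgradients(3)[OF KKT] by (auto simp: defs r_def adj_simps)
  have adjA: "inner (A z) a = inner z (adjoint A a)" for z using adjoint_works[OF A_lin] by simp
  have adjB: "inner (B z) b = inner z (adjoint B b)" for z using adjoint_works[OF B_lin] by simp
  have "0 \<le> inner (- (fst gk + (blk11 Q e + D1 e + S e) + A (x k + \<sigma> *\<^sub>R (R - adjoint B f)))
      - (- (fst gb + A xb))) a"
    unfolding defs by (rule subdiff_monotone[OF p_cpc u_subgradient KKT_subgradients(1)[OF KKT]])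
  moreover have "- (fst gk + (blk11 Q e + D1 e + S e) + A (x k + \<sigma> *\<^sub>R (R - adjoint B f))) - (- (fst gb + A xb))
     = - (fst (gk - gb) + blk11 Q e + D1 e + S e + A (y + \<sigma> *\<^sub>R (R - adjoint B f)))"
    by (simp add: y_def linear_add[OF A_lin] linear_diff[OF A_lin] algebra_simps)
  ultimately have m1: "inner (fst (gk - gb)) a + inner (blk11 Q e) a + inner (D1 e) a + inner (S e) a
      + inner (y + \<sigma> *\<^sub>R (R - adjoint B f)) (adjoint A a) \<le> 0"
    unfolding adjA[symmetric] by (simp only: inner_minus_left inner_add_left)
  have "0 \<le> inner (- (snd gk + snd (Q (e, f)) + (D2 f + T f) + B (x k + \<sigma> *\<^sub>R R)) - (- (snd gb + B xb))) b"
    unfolding defs by (rule subdiff_monotone[OF q_cpc v_subgradient KKT_subgradients(2)[OF KKT]])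
  moreover have "- (snd gk + snd (Q (e, f)) + (D2 f + T f) + B (x k + \<sigma> *\<^sub>R R)) - (- (snd gb + B xb))
     = - (snd (gk - gb) + snd (Q (e, f)) + D2 f + T f + B (y + \<sigma> *\<^sub>R R))"
    by (simp add: y_def linear_add[OF B_lin] linear_diff[OF B_lin] algebra_simps)
  ultimately have m2: "inner (snd (gk - gb)) b + inner (snd (Q (e, f))) b + inner (D2 f) b + inner (T f) b
      + inner (y + \<sigma> *\<^sub>R R) (adjoint B b) \<le> 0"
    unfolding adjB[symmetric] by (simp only: inner_minus_left inner_add_left)
  have G: "inner (fst (gk - gb)) a + inner (snd (gk - gb)) b = inner (gk - gb) (a, b)"
    by (simp add: inner_prod_def)
  have "(u k, v k) = (ub, vb) + ((a, b) - (e, f))" by (simp add: defs du_def dv_def)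
  then have G_ge: "qf Q ((a, b) - ((e, 0) + (0, f))) + qf Q (a, b) - (qf Q ((e, 0) + (0, f)) + qf H (e, f))
      \<le> 2 * inner (gk - gb) (a, b)"
    using gradient_three_point[of "(a, b)" "(e, f)" "(ub, vb)"] unfolding gk_def gb_def by simp
  have Qt: "inner (blk11 Q e) a + inner (snd (Q (e, f))) b = inner (a, b) (Q (e, 0)) + inner (0, b) (Q (0, f))"
    unfolding Q_split[of e f] by (simp add: blk11_def inner_prod_def inner_commute inner_add_left inner_add_right)
  note Qid = qf_cross_identity[OF Q_sa, of "(a, b)" "(e, 0)" "(0, f)" "(0, b)"]
  have Qid2: "(a, b) - (0, f) = (a, b - f)" "(0, b) - (0, f) = (0 :: 'u, b - f)" by simp_all
  note p1 = qf_polarize_step[OF psd_opD(1)[OF D1_psd], of e a]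
    and p2 = qf_polarize_step[OF psd_opD(1)[OF S_psd], of e a]
    and p3 = qf_polarize_step[OF psd_opD(1)[OF D2_psd], of f b]
    and p4 = qf_polarize_step[OF psd_opD(1)[OF T_psd], of f b]
  have xs: "x (Suc k) - xb = y + (\<tau> * \<sigma>) *\<^sub>R R" by (simp add: x_Suc defs)
  \<comment> \<open>The multiplier update yields \<open>2 * inner y R\<close> up to \<tau> \<sigma>
    times the squared residual, which lowers the coefficient 2 of that square to
    \<open>2 - \<tau>\<close>.\<close>
  have X: "(norm (x (Suc k) - xb))\<^sup>2 / (\<tau> * \<sigma>) = (norm (x k - xb))\<^sup>2 / (\<tau> * \<sigma>) + 2 * inner y R + \<tau> * (\<sigma> * (norm R)\<^sup>2)"
    unfolding xs y_def[symmetric] using sigma_pos tau_pos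
    by (simp add: power2_norm_eq_inner inner_add_left inner_add_right inner_commute[of R y] field_simps)
  have Aa: "adjoint A a = R - adjoint B b" using R by simp
  have xr: "inner (y + \<sigma> *\<^sub>R (R - adjoint B f)) (adjoint A a) + inner (y + \<sigma> *\<^sub>R R) (adjoint B b)
      = inner y R + \<sigma> * (norm R)\<^sup>2 - \<sigma> * inner (adjoint B f) R + \<sigma> * inner (adjoint B f) (adjoint B b)"
    unfolding Aa by (simp add: power2_norm_eq_inner inner_add_left inner_diff_left inner_diff_right algebra_simps)
  have "2 * inner (adjoint B f) (adjoint B b)
      = (norm (adjoint B b))\<^sup>2 - (norm (adjoint B (b - f)))\<^sup>2 + (norm (adjoint B f))\<^sup>2"
    by (simp add: adj_simps power2_norm_eq_inner inner_diff_left inner_diff_right inner_commute)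
  then have BB: "2 * (\<sigma> * inner (adjoint B f) (adjoint B b))
      = \<sigma> * (norm (adjoint B b))\<^sup>2 - \<sigma> * (norm (adjoint B (b - f)))\<^sup>2 + \<sigma> * (norm (adjoint B f))\<^sup>2"
    by (metis (no_types, opaque_lifting) mult.left_commute distrib_left right_diff_distrib)
  have H: "qf H (e, f) = qf D1 e + qf D2 f" by (rule qf_H)
  have tau: "(2 - \<tau>) * (\<sigma> * (norm R)\<^sup>2) = 2 * (\<sigma> * (norm R)\<^sup>2) - \<tau> * (\<sigma> * (norm R)\<^sup>2)"
    by (simp add: left_diff_distrib)
  \<comment> \<open>\<open>Y\<close> gathers the terms handled by exact identities; the pairing with
    the gradients is estimated, and that with \<open>Q\<close> is absorbed by
    \<open>Qid\<close>.\<close>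
  define Y where "Y = inner (D1 e) a + inner (S e) a + inner (D2 f) b + inner (T f) b
     + (inner y R + \<sigma> * (norm R)\<^sup>2 - \<sigma> * inner (adjoint B f) R + \<sigma> * inner (adjoint B f) (adjoint B b))"
  have s1: "inner (gk - gb) (a, b) + (inner (a, b) (Q (e, 0)) + inner (0, b) (Q (0, f))) + Y \<le> 0"
    using m1 m2 unfolding Y_def G[symmetric] Qt[symmetric] xr[symmetric] by linarith
  have s2: "qf Q (a, b) + qf Q (a, b - f) + (qf Q (0, b) - qf Q (0, b - f)) - (qf D1 e + qf D2 f) + 2 * Y \<le> 0"
    using s1 G_ge Qid unfolding H Qid2 distrib_left by linarith
  show ?thesis
    unfolding Psi_def uk vk X a_def[symmetric] b_def[symmetric] e_def[symmetric] f_def[symmetric] R_def[symmetric] tau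
    using s2 p1 p2 p3 p4 BB unfolding Y_def distrib_left right_diff_distrib by linarith
qed

text \<open>Monotonicity of the subdifferential of \<open>q\<close> between consecutive
  \<open>v\<close>-steps bounds the cross term left by \<open>descent\<close>. Inserting the
  multiplier update gives the old residual the coefficient \<open>1 - \<tau>\<close>.\<close>

lemma cross_descent:
  "qf D2 (dv (Suc k)) + qf T (dv (Suc k)) - qf D2 (dv k) - qf T (dv k) - \<eta> * (qf D1 (du k) + qf D2 (dv (Suc k)))
     + 2 * inner (0, dv (Suc k)) (Q (du (Suc k), dv (Suc k)))
     - 2 * (1 - \<tau>) * (\<sigma> * inner (r (Suc k)) (adjoint B (dv (Suc k))))
   \<le> - 2 * (\<sigma> * inner (adjoint B (dv (Suc k))) (r (Suc (Suc k))))"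
proof -
  define d where "d = dv (Suc k)"
  define R R' where "R = r (Suc k)" and "R' = r (Suc (Suc k))"
  define g0 g1 where "g0 = g (u k, v k)" and "g1 = g (u (Suc k), v (Suc k))"
  note defs = d_def R_def R'_def g0_def g1_def
  have "0 \<le> inner (- (snd g1 + snd (Q (du (Suc k), d)) + (D2 d + T d) + B (x (Suc k) + \<sigma> *\<^sub>R R'))
     - (- (snd g0 + snd (Q (du k, dv k)) + (D2 (dv k) + T (dv k)) + B (x k + \<sigma> *\<^sub>R R)))) (v (Suc (Suc k)) - v (Suc k))"
    unfolding defs by (rule subdiff_monotone[OF q_cpc v_subgradient v_subgradient])
  moreover have "v (Suc (Suc k)) - v (Suc k) = d" by (simp add: d_def dv_def)
  moreover have "- (snd g1 + snd (Q (du (Suc k), d)) + (D2 d + T d) + B (x (Suc k) + \<sigma> *\<^sub>R R'))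
     - (- (snd g0 + snd (Q (du k, dv k)) + (D2 (dv k) + T (dv k)) + B (x k + \<sigma> *\<^sub>R R)))
     = - (snd (g1 - g0) + snd (Q (du (Suc k), d)) - snd (Q (du k, dv k)) + (D2 d - D2 (dv k)) + (T d - T (dv k))
        + B (\<sigma> *\<^sub>R R' - ((1 - \<tau>) * \<sigma>) *\<^sub>R R))"
    unfolding x_Suc R_def[symmetric]
    by (simp add: linear_add[OF B_lin] linear_diff[OF B_lin] linear_cmul[OF B_lin] algebra_simps)
  ultimately have "inner (snd (g1 - g0)) d + inner (snd (Q (du (Suc k), d))) d - inner (snd (Q (du k, dv k))) d
      + (inner (D2 d) d - inner (D2 (dv k)) d) + (inner (T d) d - inner (T (dv k)) d)
      + inner (B (\<sigma> *\<^sub>R R' - ((1 - \<tau>) * \<sigma>) *\<^sub>R R)) d \<le> 0"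
    by (simp only: inner_minus_left inner_add_left inner_diff_left)
  moreover have "inner (B (\<sigma> *\<^sub>R R' - ((1 - \<tau>) * \<sigma>) *\<^sub>R R)) d
      = \<sigma> * inner (adjoint B d) R' - (1 - \<tau>) * (\<sigma> * inner R (adjoint B d))"
    unfolding adjoint_works[OF B_lin, symmetric] by (simp add: inner_diff_left inner_diff_right inner_commute)
  moreover have "inner (snd z) d = inner (0, d) z" for z :: "'u \<times> 'v" by (simp add: inner_prod_def inner_commute)
  ultimately have m: "inner (0, d) (g1 - g0) + inner (0, d) (Q (du (Suc k), d)) - inner (0, d) (Q (du k, dv k))
      + (inner d (D2 d) - inner d (D2 (dv k))) + (inner d (T d) - inner d (T (dv k)))
      + (\<sigma> * inner (adjoint B d) R' - (1 - \<tau>) * (\<sigma> * inner R (adjoint B d))) \<le> 0"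
    by (simp only: inner_commute[of "D2 _"] inner_commute[of "T _"])
  \<comment> \<open>The two gradients belong to consecutive base points: \<open>grad_cross\<close>
    is used with the previous increment as step and the new one as test direction.\<close>
  have eq: "(u (Suc k), v (Suc k)) = (u k, v k) + (du k, dv k)" by (simp add: du_def dv_def)
  have "inner (0, d) (Q (du k, dv k)) + inner d (D2 (dv k)) - 1/2 * qf D2 (dv k) - 1/2 * qf D2 d
      - \<eta> / 2 * (qf D1 (du k) + qf D2 d) \<le> inner (0, d) (g1 - g0)"
    unfolding g0_def g1_def eq by (rule grad_cross)
  moreover have "2 * inner d (T (dv k)) \<le> qf T d + qf T (dv k)" by (rule qf_cross_le[OF T_psd])
  ultimately show ?thesis
    using m unfolding d_def[symmetric] R_def[symmetric] R'_def[symmetric] qf_def by (simp add: algebra_simps)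
qed

subsection \<open>Convergence\<close>

lemma g_continuous: "continuous_on UNIV g"
proof -
  obtain L where L: "\<And>w w'. norm (g w - g w') \<le> L * norm (w - w')" using grad_lip by blast
  have "\<bar>L\<bar>-lipschitz_on UNIV g"
  proof (rule lipschitz_onI)
    show "dist (g w) (g w') \<le> \<bar>L\<bar> * dist w w'" for w w'
      using L[of w w'] by (smt (verit) dist_norm mult_right_mono norm_ge_zero)
  qed simp
  then show ?thesis by (rule lipschitz_on_continuous_on)
qed

text \<open>Convexity of \<phi> enters as \<open>phi_lower\<close> with \<open>Q\<close> positive
  semidefinite; the multiplier terms cancel between two feasible points.\<close>

lemma KKT_optimal:
  assumes KKT: "is_KKT p q g A B c ub vb xb"
  shows "is_optimal p q \<phi> A B c ub vb"
  unfolding is_optimal_def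
proof (intro conjI allI impI)
  note sub = KKT_subgradients[OF KKT]
  show "adjoint A ub + adjoint B vb = c" by (rule sub(3))
  fix u' v' assume feas: "adjoint A u' + adjoint B v' = c"
  obtain s t where st: "p ub = ereal s" "q vb = ereal t"
    using cpc_real[OF p_cpc subdiff_edom[OF sub(1)]] cpc_real[OF q_cpc subdiff_edom[OF sub(2)]] by metis
  show "p ub + q vb + ereal (\<phi> (ub, vb)) \<le> p u' + q v' + ereal (\<phi> (u', v'))"
  proof (cases "p u' = \<infinity> \<or> q v' = \<infinity>")
    case False
    then obtain s' t' where st': "p u' = ereal s'" "q v' = ereal t'"
      using cpc_not_MInf[OF p_cpc] cpc_not_MInf[OF q_cpc] by (cases "p u'"; cases "q v'") auto
    have 1: "s + inner (- (fst (g (ub, vb)) + A xb)) (u' - ub) \<le> s'"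
      using st' by (intro subdiffD[OF sub(1) st(1)]) simp
    have 2: "t + inner (- (snd (g (ub, vb)) + B xb)) (v' - vb) \<le> t'"
      using st' by (intro subdiffD[OF sub(2) st(2)]) simp
    have "\<phi> (ub, vb) + inner (g (ub, vb)) (u' - ub, v' - vb) + 1/2 * qf Q (u' - ub, v' - vb) \<le> \<phi> ((ub, vb) + (u' - ub, v' - vb))"
      by (rule phi_lower)
    moreover have "0 \<le> qf Q (u' - ub, v' - vb)" by (rule psd_opD(3)[OF Q_psd])
    ultimately have 3: "\<phi> (ub, vb) + inner (fst (g (ub, vb))) (u' - ub) + inner (snd (g (ub, vb))) (v' - vb) \<le> \<phi> (u', v')"
      by (simp add: inner_prod_def)
    have "inner (A xb) (u' - ub) + inner (B xb) (v' - vb)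
        = inner xb (adjoint A (u' - ub) + adjoint B (v' - vb))"
      using adjoint_works[OF A_lin] adjoint_works[OF B_lin] by (simp add: inner_add_right)
    also have "adjoint A (u' - ub) + adjoint B (v' - vb) = 0"
      using feas sub(3) by (simp add: adj_simps algebra_simps)
    finally have "inner (A xb) (u' - ub) + inner (B xb) (v' - vb) = 0" by simp
    then show ?thesis
      using 1 2 3 unfolding st st' inner_minus_left inner_add_left by simp
  next
    case True
    then have "p u' + q v' + ereal (\<phi> (u', v')) = \<infinity>"
      using cpc_not_MInf[OF p_cpc, of u'] cpc_not_MInf[OF q_cpc, of v'] by (cases "p u'"; cases "q v'") auto
    then show ?thesis by (metis ereal_less_eq(1))
  qed
qed

text \<open>The optimality conditions link indices \<open>s k\<close> and \<open>Suc (s k)\<close>.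
  Vanishing increments give both the same limit, and the subdifferentials have closed
  graphs.\<close>

lemma limit_is_KKT:
  assumes du0: "du \<longlonglongrightarrow> 0" and dv0: "dv \<longlonglongrightarrow> 0" and r0: "r \<longlonglongrightarrow> 0"
    and s: "strict_mono s" and ul: "(\<lambda>k. u (s k)) \<longlonglongrightarrow> ub" and vl: "(\<lambda>k. v (s k)) \<longlonglongrightarrow> vb"
    and xl: "(\<lambda>k. x (s k)) \<longlonglongrightarrow> xb"
  shows "is_KKT p q g A B c ub vb xb"
proof -
  have du_s: "(\<lambda>k. du (s k)) \<longlonglongrightarrow> 0" and dv_s: "(\<lambda>k. dv (s k)) \<longlonglongrightarrow> 0" and r_s: "(\<lambda>k. r (s k)) \<longlonglongrightarrow> 0"
    and r_s1: "(\<lambda>k. r (Suc (s k))) \<longlonglongrightarrow> 0"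
    using LIMSEQ_subseq_LIMSEQ[OF du0 s] LIMSEQ_subseq_LIMSEQ[OF dv0 s] LIMSEQ_subseq_LIMSEQ[OF r0 s]
      LIMSEQ_subseq_LIMSEQ[OF LIMSEQ_Suc[OF r0] s] by (simp_all add: o_def)
  have "(\<lambda>k. u (s k) + du (s k)) \<longlonglongrightarrow> ub + 0" by (intro tendsto_add ul du_s)
  then have u1: "(\<lambda>k. u (Suc (s k))) \<longlonglongrightarrow> ub" by (simp add: du_def)
  have "(\<lambda>k. v (s k) + dv (s k)) \<longlonglongrightarrow> vb + 0" by (intro tendsto_add vl dv_s)
  then have v1: "(\<lambda>k. v (Suc (s k))) \<longlonglongrightarrow> vb" by (simp add: dv_def)
  have gl: "(\<lambda>k. g (u (s k), v (s k))) \<longlonglongrightarrow> g (ub, vb)"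
    by (rule continuous_on_tendsto_compose[OF g_continuous]) (auto intro: tendsto_Pair ul vl)
  have z: "blk11 Q 0 = 0" "D1 0 = 0" "S 0 = 0" "D2 0 = 0" "T 0 = 0" "Q 0 = 0" "adjoint B 0 = 0"
    using linear_0[OF self_adjointD(1)[OF blk_self_adjoint(1)]] linear_0[OF psd_opD(2)[OF D1_psd]]
      linear_0[OF psd_opD(2)[OF S_psd]] linear_0[OF psd_opD(2)[OF D2_psd]] linear_0[OF psd_opD(2)[OF T_psd]]
      linear_0[OF Q_lin] linear_0[OF linear_adjoints(2)] by simp_all
  have "(\<lambda>k. - (fst (g (u (s k), v (s k))) + (blk11 Q (du (s k)) + D1 (du (s k)) + S (du (s k)))
        + A (x (s k) + \<sigma> *\<^sub>R (r (Suc (s k)) - adjoint B (dv (s k))))))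
      \<longlonglongrightarrow> - (fst (g (ub, vb)) + (blk11 Q 0 + D1 0 + S 0) + A (xb + \<sigma> *\<^sub>R (0 - adjoint B 0)))"
    by (intro tendsto_minus tendsto_add tendsto_fst[OF gl] du_s r_s1 xl tendsto_scaleR tendsto_diff tendsto_const
        tendsto_linear[OF A_lin] tendsto_linear[OF linear_adjoints(2) dv_s]
        tendsto_linear[OF self_adjointD(1)[OF blk_self_adjoint(1)] du_s]
        tendsto_linear[OF psd_opD(2)[OF D1_psd] du_s] tendsto_linear[OF psd_opD(2)[OF S_psd] du_s])
  then have "(\<lambda>k. - (fst (g (u (s k), v (s k))) + (blk11 Q (du (s k)) + D1 (du (s k)) + S (du (s k)))
        + A (x (s k) + \<sigma> *\<^sub>R (r (Suc (s k)) - adjoint B (dv (s k)))))) \<longlonglongrightarrow> - (fst (g (ub, vb)) + A xb)"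
    by (simp add: z)
  from subdiff_closed[OF p_cpc u_subgradient u1 this]
  have 1: "- (fst (g (ub, vb)) + A xb) \<in> subdiff p ub" .
  have "(\<lambda>k. - (snd (g (u (s k), v (s k))) + snd (Q (du (s k), dv (s k))) + (D2 (dv (s k)) + T (dv (s k)))
        + B (x (s k) + \<sigma> *\<^sub>R r (Suc (s k)))))
      \<longlonglongrightarrow> - (snd (g (ub, vb)) + snd (Q (0, 0)) + (D2 0 + T 0) + B (xb + \<sigma> *\<^sub>R 0))"
    by (intro tendsto_minus tendsto_add tendsto_snd[OF gl] r_s1 xl tendsto_scaleR tendsto_const
        tendsto_linear[OF B_lin] tendsto_snd[OF tendsto_linear[OF Q_lin tendsto_Pair[OF du_s dv_s]]]
        tendsto_linear[OF psd_opD(2)[OF D2_psd] dv_s] tendsto_linear[OF psd_opD(2)[OF T_psd] dv_s])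
  then have "(\<lambda>k. - (snd (g (u (s k), v (s k))) + snd (Q (du (s k), dv (s k))) + (D2 (dv (s k)) + T (dv (s k)))
        + B (x (s k) + \<sigma> *\<^sub>R r (Suc (s k))))) \<longlonglongrightarrow> - (snd (g (ub, vb)) + B xb)"
    using z by (simp add: zero_prod_def)
  from subdiff_closed[OF q_cpc v_subgradient v1 this]
  have 2: "- (snd (g (ub, vb)) + B xb) \<in> subdiff q vb" .
  have "(\<lambda>k. r (s k)) \<longlonglongrightarrow> adjoint A ub + adjoint B vb - c"
    unfolding r_def by (intro tendsto_add tendsto_diff tendsto_const
        tendsto_linear[OF linear_adjoints(1) ul] tendsto_linear[OF linear_adjoints(2) vl])
  then have "adjoint A ub + adjoint B vb - c = 0" using r_s LIMSEQ_unique by blast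
  with 1 2 show ?thesis
    unfolding is_KKT_def
    by (intro conjI bexI[OF _ 1] bexI[OF _ 2]) (auto simp: prod_eq_iff)
qed

lemma KKT_exists: "\<exists>ub vb xb. is_KKT p q g A B c ub vb xb"
proof -
  obtain us vs where "is_optimal p q \<phi> A B c us vs" using sol_nonempty by blast
  moreover obtain uh vh where "(uh, vh) \<in> rel_interior (edom p \<times> edom q)" "adjoint A uh + adjoint B vh = c"
    using slater by blast
  ultimately show ?thesis using multiplier_exists[OF p_cpc q_cpc grad A_lin B_lin] by blast
qed

text \<open>The hypothesis \<open>lyap\<close> is applied to two KKT points, first merely for
  boundedness and then at a cluster point. The offset \<open>m\<close> allows for Lyapunov values
  that bound the iterates only after further updates.\<close>

lemma convergence_from_lyapunov:
  assumes du0: "du \<longlonglongrightarrow> 0" and dv0: "dv \<longlonglongrightarrow> 0" and r0: "r \<longlonglongrightarrow> 0"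
    and lyap: "\<And>ub vb xb. is_KKT p q g A B c ub vb xb \<Longrightarrow>
      \<exists>\<Phi> C m. (\<forall>k. 0 \<le> \<Phi> k \<and> \<Phi> (Suc k) \<le> \<Phi> k) \<and>
        (\<forall>k. (norm (u (k + m) - ub))\<^sup>2 \<le> C * \<Phi> k \<and> (norm (v (k + m) - vb))\<^sup>2 \<le> C * \<Phi> k
           \<and> (norm (x (k + m) - xb))\<^sup>2 \<le> C * \<Phi> k) \<and>
        (\<forall>s. strict_mono s \<and> (\<lambda>k. u (s k)) \<longlonglongrightarrow> ub \<and> (\<lambda>k. v (s k)) \<longlonglongrightarrow> vb \<and> (\<lambda>k. x (s k)) \<longlonglongrightarrow> xb
           \<longrightarrow> (\<lambda>k. \<Phi> (s k)) \<longlonglongrightarrow> (0::real))"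
  shows "converges_to_KKT p q \<phi> g A B c u v x"
proof -
  obtain ub vb xb where KKT: "is_KKT p q g A B c ub vb xb" using KKT_exists by blast
  obtain \<Phi> :: "nat \<Rightarrow> real" and C m where \<Phi>: "\<And>k. 0 \<le> \<Phi> k" "\<And>k. \<Phi> (Suc k) \<le> \<Phi> k"
    and bd: "\<And>k. (norm (u (k + m) - ub))\<^sup>2 \<le> C * \<Phi> k" "\<And>k. (norm (v (k + m) - vb))\<^sup>2 \<le> C * \<Phi> k"
      "\<And>k. (norm (x (k + m) - xb))\<^sup>2 \<le> C * \<Phi> k"
    using lyap[OF KKT] by blast
  have "decseq \<Phi>" by (rule decseq_SucI) (rule \<Phi>(2))
  then have \<Phi>_le: "\<Phi> k \<le> \<Phi> 0" for k using decseqD[of \<Phi> 0 k] by simp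
  have bounded: "bounded (range y)" if "\<And>k. (norm (y (k + m) - yb))\<^sup>2 \<le> C * \<Phi> k"
    for y :: "nat \<Rightarrow> 'a::real_normed_vector" and yb
  proof -
    have le: "norm (y (k + m)) \<le> norm yb + sqrt (\<bar>C\<bar> * \<Phi> 0)" for k
    proof -
      have "C * \<Phi> k \<le> \<bar>C\<bar> * \<Phi> 0" using \<Phi>(1)[of k] \<Phi>_le[of k] by (smt (verit) mult_mono)
      then have "norm (y (k + m) - yb) \<le> sqrt (\<bar>C\<bar> * \<Phi> 0)"
        using that[of k] by (intro real_le_rsqrt) simp
      then show ?thesis using norm_triangle_sub[of "y (k + m)" yb] by simp
    qed
    \<comment> \<open>The first \<open>m\<close> iterates are not covered by the bound, but they
      form a finite set.\<close>
    have "range y \<subseteq> y ` {..<m} \<union> cball 0 (norm yb + sqrt (\<bar>C\<bar> * \<Phi> 0))"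
    proof
      fix z assume "z \<in> range y"
      then obtain k where "z = y k" by blast
      then show "z \<in> y ` {..<m} \<union> cball 0 (norm yb + sqrt (\<bar>C\<bar> * \<Phi> 0))"
        using le[of "k - m"] by (cases "k < m") auto
    qed
    then show ?thesis by (rule bounded_subset[rotated]) (simp add: finite_imp_bounded)
  qed
  define z where "z k = ((u k, v k), x k)" for k
  have "bounded (range z)"
    by (rule bounded_subset[OF bounded_Times[OF bounded_Times[OF bounded[OF bd(1)] bounded[OF bd(2)]] bounded[OF bd(3)]]])
      (auto simp: z_def)
  then obtain l s where s: "strict_mono s" and zl: "(z \<circ> s) \<longlonglongrightarrow> l"
    using bounded_imp_convergent_subsequence by blast
  obtain ui vi xi where l: "l = ((ui, vi), xi)" by (metis surj_pair)
  have lims: "(\<lambda>k. u (s k)) \<longlonglongrightarrow> ui" "(\<lambda>k. v (s k)) \<longlonglongrightarrow> vi" "(\<lambda>k. x (s k)) \<longlonglongrightarrow> xi"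
    using tendsto_fst[OF tendsto_fst[OF zl]] tendsto_snd[OF tendsto_fst[OF zl]] tendsto_snd[OF zl]
    by (simp_all add: z_def l o_def)
  have KKTi: "is_KKT p q g A B c ui vi xi" by (rule limit_is_KKT[OF du0 dv0 r0 s lims])
  obtain \<Phi> :: "nat \<Rightarrow> real" and C m where \<Phi>: "\<And>k. 0 \<le> \<Phi> k" "\<And>k. \<Phi> (Suc k) \<le> \<Phi> k"
    and bd: "\<And>k. (norm (u (k + m) - ui))\<^sup>2 \<le> C * \<Phi> k" "\<And>k. (norm (v (k + m) - vi))\<^sup>2 \<le> C * \<Phi> k"
      "\<And>k. (norm (x (k + m) - xi))\<^sup>2 \<le> C * \<Phi> k"
    and sub: "(\<lambda>k. \<Phi> (s k)) \<longlonglongrightarrow> 0"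
    using lyap[OF KKTi] s lims by blast
  have dec: "decseq \<Phi>" by (rule decseq_SucI) (rule \<Phi>(2))
  obtain L where L: "\<Phi> \<longlonglongrightarrow> L" using decseq_convergent[OF dec, of 0] \<Phi>(1) by blast
  have "(\<lambda>k. \<Phi> (s k)) \<longlonglongrightarrow> L" using LIMSEQ_subseq_LIMSEQ[OF L s] by (simp add: o_def)
  then have "L = 0" using sub LIMSEQ_unique by blast
  with L have "(\<lambda>k. C * \<Phi> k) \<longlonglongrightarrow> C * 0" by (intro tendsto_mult_left) simp
  then have lim0: "(\<lambda>k. C * \<Phi> k) \<longlonglongrightarrow> 0" by simp
  have conv: "y \<longlonglongrightarrow> yb" if "\<And>k. (norm (y (k + m) - yb))\<^sup>2 \<le> C * \<Phi> k"
    for y :: "nat \<Rightarrow> 'a::real_normed_vector" and yb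
  proof -
    have "(\<lambda>k. y (k + m) - yb) \<longlonglongrightarrow> 0" by (rule tendsto_0_by_coercivity[OF that lim0])
    then show ?thesis using LIMSEQ_offset[of y m yb] by (simp add: LIM_zero_iff)
  qed
  show ?thesis
    unfolding converges_to_KKT_def
    using conv[OF bd(1)] conv[OF bd(2)] conv[OF bd(3)] KKT_optimal[OF KKTi] KKTi by blast
qed

section \<open>Coercivity and vanishing increments\<close>

lemma norm_adjoint_sq: "inner a (A (adjoint A a)) = (norm (adjoint A a))\<^sup>2" "inner b (B (adjoint B b)) = (norm (adjoint B b))\<^sup>2"
  using adjoint_works[OF A_lin, of "adjoint A a" a] adjoint_works[OF B_lin, of "adjoint B b" b]
  by (simp_all add: power2_norm_eq_inner inner_commute)

lemma u_coercive: obtains C where "0 < C" "\<And>a. (norm a)\<^sup>2 \<le> C * (qf Q (a, 0) + \<sigma> * (norm (adjoint A a))\<^sup>2 + qf S a)"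
proof -
  obtain C where "0 < C" "\<And>a. (norm a)\<^sup>2 \<le> C * qf (\<lambda>a. blk11 Q a + \<sigma> *\<^sub>R A (adjoint A a) + S a) a"
    using pd_op_coercive[OF pd1] by blast
  then show thesis using that by (simp add: qf_def inner_add_right inner_blk norm_adjoint_sq)
qed

lemma v_coercive: obtains C where "0 < C" "\<And>b. (norm b)\<^sup>2 \<le> C * (qf Q (0, b) + \<sigma> * (norm (adjoint B b))\<^sup>2 + qf T b)"
proof -
  obtain C where "0 < C" "\<And>b. (norm b)\<^sup>2 \<le> C * qf (\<lambda>b. blk22 Q b + \<sigma> *\<^sub>R B (adjoint B b) + T b) b"
    using pd_op_coercive[OF pd2] by blast
  then show thesis using that by (simp add: qf_def inner_add_right inner_blk norm_adjoint_sq)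
qed

lemmas nonnegs = psd_opD(3)[OF Q_psd] psd_opD(3)[OF S_psd] psd_opD(3)[OF T_psd] psd_opD(3)[OF D1_psd] psd_opD(3)[OF D2_psd]

text \<open>For the \<open>v\<close>-error these are all the terms of \<open>v_coercive\<close>. For
  the \<open>u\<close>-error only the part in \<open>S\<close> is obtained; its parts in
  \<open>Q\<close> and \<open>adjoint A\<close> must come from the dissipation.\<close>

lemma Psi_controls:
  "(norm (x k - xb))\<^sup>2 \<le> (\<tau> * \<sigma>) * Psi ub vb xb k"
  "qf S (u k - ub) \<le> Psi ub vb xb k"
  "qf Q (0, v k - vb) + \<sigma> * (norm (adjoint B (v k - vb)))\<^sup>2 + qf T (v k - vb) \<le> Psi ub vb xb k"
proof -
  have n: "0 \<le> (norm (x k - xb))\<^sup>2 / (\<tau> * \<sigma>)" "0 \<le> \<sigma> * (norm (adjoint B (v k - vb)))\<^sup>2"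
    using sigma_pos tau_pos by auto
  note nn = n nonnegs(1)[of "(0, v k - vb)"] nonnegs(2)[of "u k - ub"] nonnegs(3)[of "v k - vb"]
    nonnegs(4)[of "u k - ub"] nonnegs(5)[of "v k - vb"]
  have "(norm (x k - xb))\<^sup>2 / (\<tau> * \<sigma>) \<le> Psi ub vb xb k" unfolding Psi_def using nn by linarith
  then show "(norm (x k - xb))\<^sup>2 \<le> (\<tau> * \<sigma>) * Psi ub vb xb k"
    using sigma_pos tau_pos by (simp add: divide_le_eq mult.commute)
  show "qf S (u k - ub) \<le> Psi ub vb xb k"
    "qf Q (0, v k - vb) + \<sigma> * (norm (adjoint B (v k - vb)))\<^sup>2 + qf T (v k - vb) \<le> Psi ub vb xb k"
    unfolding Psi_def using nn by linarith+
qed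

lemma Psi_tendsto_0:
  assumes ul: "(\<lambda>k. u (s k)) \<longlonglongrightarrow> ub" and vl: "(\<lambda>k. v (s k)) \<longlonglongrightarrow> vb" and xl: "(\<lambda>k. x (s k)) \<longlonglongrightarrow> xb"
  shows "(\<lambda>k. Psi ub vb xb (s k)) \<longlonglongrightarrow> 0"
proof -
  have "(\<lambda>k. Psi ub vb xb (s k)) \<longlonglongrightarrow> (norm (xb - xb))\<^sup>2 / (\<tau> * \<sigma>) + qf D1 (ub - ub) + qf S (ub - ub)
     + qf Q (0, vb - vb) + qf D2 (vb - vb) + qf T (vb - vb) + \<sigma> * (norm (adjoint B (vb - vb)))\<^sup>2"
    unfolding Psi_def using tau_pos sigma_pos
    by (intro tendsto_intros tendsto_qf tendsto_linear[OF linear_adjoints(2)] ul vl xl Q_lin psd_opD(2) D1_psd S_psd D2_psd T_psd) auto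
  moreover have "(0 :: 'u, 0 :: 'v) = 0" by (simp add: zero_prod_def)
  ultimately show ?thesis by (simp add: linear_0[OF linear_adjoints(2)])
qed

text \<open>The offset covers both applications: the staggered pair with \<open>m = 0\<close> for
  \<tau> \<le> 1, and \<open>m = 1\<close> otherwise.\<close>

lemma differences_tendsto_0:
  assumes cont: "continuous_on UNIV N" and hom: "\<And>t w. N (t *\<^sub>R w) = t\<^sup>2 * N w"
    and pos: "\<And>w. w \<noteq> 0 \<Longrightarrow> (0::real) < N w"
    and lim: "(\<lambda>k. N (du (Suc k), dv (k + m))) \<longlonglongrightarrow> 0"
  shows "du \<longlonglongrightarrow> 0" "dv \<longlonglongrightarrow> 0"
proof -
  obtain C where C: "\<And>w. (norm w)\<^sup>2 \<le> C * N w"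
    using quadratic_coercive[OF cont hom pos] by blast
  have "(\<lambda>k. C * N (du (Suc k), dv (k + m))) \<longlonglongrightarrow> C * 0" by (intro tendsto_mult_left lim)
  then have w: "(\<lambda>k. (du (Suc k), dv (k + m))) \<longlonglongrightarrow> 0"
    by (intro tendsto_0_by_coercivity[OF C]) simp
  show "du \<longlonglongrightarrow> 0" using tendsto_fst[OF w] by (simp add: LIMSEQ_imp_Suc)
  show "dv \<longlonglongrightarrow> 0" using tendsto_snd[OF w] by (simp add: LIMSEQ_offset)
qed

lemma continuous_on_adjoint:
  "continuous_on UNIV (\<lambda>w. adjoint A (fst w))" "continuous_on UNIV (\<lambda>w. adjoint B (snd w))"
proof -
  have "continuous_on UNIV (adjoint A)" "continuous_on UNIV (adjoint B)"
    using linear_adjoints by (simp_all add: linear_continuous_on linear_linear)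
  then show "continuous_on UNIV (\<lambda>w. adjoint A (fst w))" "continuous_on UNIV (\<lambda>w. adjoint B (snd w))"
    by (auto intro!: continuous_on_compose2[of UNIV "adjoint A"] continuous_on_compose2[of UNIV "adjoint B"]
        continuous_on_fst continuous_on_snd)
qed

lemmas adj_scale = linear_cmul[OF linear_adjoints(1)] linear_cmul[OF linear_adjoints(2)]

section \<open>Convergence for step sizes \<tau> \<le> 1\<close>

lemma convergence_small_step:
  assumes tau: "\<tau> \<le> 1"
    and inj: "\<And>a b. qf Q (a, b) + qf S a + qf T b + (1 - \<tau>) * \<sigma> * ((norm (adjoint A a))\<^sup>2 + (norm (adjoint B b))\<^sup>2) = 0
       \<Longrightarrow> a = 0 \<or> b = 0"
  shows "converges_to_KKT p q \<phi> g A B c u v x"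
proof -
  \<comment> \<open>The residual between the two updates. Its square consists of the cross term of
    \<open>descent\<close>, the square of \<open>adjoint B (dv k)\<close> and one squared residual,
    which leaves \<open>1 - \<tau>\<close> of the coefficient \<open>2 - \<tau>\<close>.\<close>
  define \<rho> where "\<rho> k = r (Suc k) - adjoint B (dv k)" for k
  have \<rho>_eq: "\<rho> k = adjoint A (u (Suc k)) + adjoint B (v k) - c" for k
    by (simp add: \<rho>_def r_def dv_def adj_simps)
  define a where "a ub vb k = qf Q (u (Suc k) - ub, v (Suc k) - vb) + qf Q (u (Suc k) - ub, v k - vb)
     + qf S (du k) + qf T (dv k) + (1 - \<tau>) * (\<sigma> * (norm (r (Suc k)))\<^sup>2) + \<sigma> * (norm (\<rho> k))\<^sup>2" for ub vb k
  have nn: "0 \<le> (1 - \<tau>) * (\<sigma> * (norm (r (Suc k)))\<^sup>2)" "0 \<le> \<sigma> * (norm (\<rho> k))\<^sup>2" for k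
    using tau sigma_pos by auto
  have a_ge: "qf Q (u (Suc k) - ub, v k - vb) \<le> a ub vb k" "qf S (du k) \<le> a ub vb k" "qf T (dv k) \<le> a ub vb k"
    "(1 - \<tau>) * (\<sigma> * (norm (r (Suc k)))\<^sup>2) \<le> a ub vb k" "\<sigma> * (norm (\<rho> k))\<^sup>2 \<le> a ub vb k" "0 \<le> a ub vb k" for ub vb k
    using nonnegs(1)[of "(u (Suc k) - ub, v (Suc k) - vb)"] nonnegs(1)[of "(u (Suc k) - ub, v k - vb)"]
      nonnegs(2)[of "du k"] nonnegs(3)[of "dv k"] nn[of k] unfolding a_def by linarith+
  have dec: "Psi ub vb xb (Suc k) + a ub vb k \<le> Psi ub vb xb k" if "is_KKT p q g A B c ub vb xb" for ub vb xb k
  proof -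
    have *: "(norm (\<rho> k))\<^sup>2 = (norm (r (Suc k)))\<^sup>2 + (norm (adjoint B (dv k)))\<^sup>2 - 2 * inner (adjoint B (dv k)) (r (Suc k))"
      by (simp add: \<rho>_def power2_norm_eq_inner inner_diff_left inner_diff_right inner_commute)
    have "(1 - \<tau>) * (\<sigma> * (norm (r (Suc k)))\<^sup>2) + \<sigma> * (norm (\<rho> k))\<^sup>2 = (2 - \<tau>) * (\<sigma> * (norm (r (Suc k)))\<^sup>2)
        + \<sigma> * (norm (adjoint B (dv k)))\<^sup>2 - 2 * (\<sigma> * inner (adjoint B (dv k)) (r (Suc k)))"
      unfolding * by (simp add: algebra_simps)
    then show ?thesis using descent[OF that, of k] unfolding a_def by linarith
  qed
  obtain ub vb xb where KKT: "is_KKT p q g A B c ub vb xb" using KKT_exists by blast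
  have a0: "a ub vb \<longlonglongrightarrow> 0"
    by (rule nonneg_decrement_tendsto_0[of "Psi ub vb xb"]) (rule Psi_nonneg a_ge(6) dec[OF KKT])+
  \<comment> \<open>Where the hypothesis' form vanishes, only one block is known to be zero. The
    last summand then annihilates the image of the other block under its adjoint, so that
    \<open>u_coercive\<close> or \<open>v_coercive\<close> applies.\<close>
  define N where "N = (\<lambda>w. qf Q w + qf S (fst w) + qf T (snd w)
     + (1 - \<tau>) * \<sigma> * ((norm (adjoint A (fst w)))\<^sup>2 + (norm (adjoint B (snd w)))\<^sup>2)
     + \<sigma> * (norm (adjoint A (fst w) + adjoint B (snd w)))\<^sup>2)"
  have N_cont: "continuous_on UNIV N" unfolding N_def
    by (intro continuous_intros continuous_on_qf continuous_on_adjoint Q_lin psd_opD(2) S_psd T_psd)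
  have N_hom: "N (t *\<^sub>R w) = t\<^sup>2 * N w" for t w
    unfolding N_def by (simp add: qf_scale Q_lin psd_opD(2)[OF S_psd] psd_opD(2)[OF T_psd] adj_scale
        scaleR_add_right[symmetric] power_mult_distrib algebra_simps del: scaleR_add_right)
  have N_pos: "0 < N w" if w: "w \<noteq> 0" for w
  proof -
    obtain a b where ab: "w = (a, b)" by (cases w)
    define P where "P = qf Q (a, b) + qf S a + qf T b + (1 - \<tau>) * \<sigma> * ((norm (adjoint A a))\<^sup>2 + (norm (adjoint B b))\<^sup>2)"
    have N_eq: "N w = P + \<sigma> * (norm (adjoint A a + adjoint B b))\<^sup>2" by (simp add: N_def P_def ab)
    have t: "0 \<le> (1 - \<tau>) * \<sigma> * ((norm (adjoint A a))\<^sup>2 + (norm (adjoint B b))\<^sup>2)" using tau sigma_pos by simp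
    have P: "0 \<le> P" unfolding P_def using nonnegs(1)[of "(a, b)"] nonnegs(2)[of a] nonnegs(3)[of b] t by linarith
    have s: "0 \<le> \<sigma> * (norm (adjoint A a + adjoint B b))\<^sup>2" using sigma_pos by simp
    have "N w \<noteq> 0"
    proof
      assume "N w = 0"
      then have P0: "P = 0" and AB: "adjoint A a + adjoint B b = 0"
        using P s sigma_pos by (auto simp: N_eq add_nonneg_eq_0_iff)
      have Q0: "qf Q (a, b) = 0" "qf S a = 0" "qf T b = 0"
        using P0 t nonnegs(1)[of "(a, b)"] nonnegs(2)[of a] nonnegs(3)[of b] unfolding P_def by linarith+
      from P0 have "a = 0 \<or> b = 0" unfolding P_def by (rule inj)
      then show False
      proof
        assume a: "a = 0"
        then have "adjoint B b = 0" using AB by (simp add: linear_0[OF linear_adjoints(1)])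
        moreover obtain C where "(norm b)\<^sup>2 \<le> C * (qf Q (0, b) + \<sigma> * (norm (adjoint B b))\<^sup>2 + qf T b)"
          using v_coercive by blast
        ultimately show False using Q0 a w ab by (simp add: zero_prod_def)
      next
        assume b: "b = 0"
        then have "adjoint A a = 0" using AB by (simp add: linear_0[OF linear_adjoints(2)])
        moreover obtain C where "(norm a)\<^sup>2 \<le> C * (qf Q (a, 0) + \<sigma> * (norm (adjoint A a))\<^sup>2 + qf S a)"
          using u_coercive by blast
        ultimately show False using Q0 b w ab by (simp add: zero_prod_def)
      qed
    qed
    then show ?thesis using P s N_eq by simp
  qed
  \<comment> \<open>The staggered pair is the difference of the points
    \<open>(u (Suc k), v k)\<close> at consecutive indices, whose \<open>Q\<close>-errors are
    dissipated; its images under the adjoints are differences of residuals. The factor 20 is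
    generous.\<close>
  have N_le: "N (du (Suc k), dv k) \<le> 20 * a ub vb k + 20 * a ub vb (Suc k)" for k
  proof -
    have "(du (Suc k), dv k) = (u (Suc (Suc k)) - ub, v (Suc k) - vb) - (u (Suc k) - ub, v k - vb)"
      by (simp add: du_def dv_def)
    then have 1: "qf Q (du (Suc k), dv k) \<le> 2 * qf Q (u (Suc (Suc k)) - ub, v (Suc k) - vb) + 2 * qf Q (u (Suc k) - ub, v k - vb)"
      using qf_diff_le[OF Q_psd] by metis
    have e1: "adjoint A (du (Suc k)) + adjoint B (dv k) = \<rho> (Suc k) - \<rho> k"
      and e2: "adjoint A (du (Suc k)) = \<rho> (Suc k) - r (Suc k)" and e3: "adjoint B (dv k) = r (Suc k) - \<rho> k"
      unfolding \<rho>_eq r_def du_def dv_def by (simp_all add: adj_simps)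
    have "\<sigma> * (norm (adjoint A (du (Suc k)) + adjoint B (dv k)))\<^sup>2 \<le> \<sigma> * (2 * (norm (\<rho> (Suc k)))\<^sup>2 + 2 * (norm (\<rho> k))\<^sup>2)"
      unfolding e1 using sigma_pos by (intro mult_left_mono norm_sq_diff_le) simp
    then have 2: "\<sigma> * (norm (adjoint A (du (Suc k)) + adjoint B (dv k)))\<^sup>2
        \<le> 2 * (\<sigma> * (norm (\<rho> (Suc k)))\<^sup>2) + 2 * (\<sigma> * (norm (\<rho> k))\<^sup>2)" by (simp add: algebra_simps)
    have \<rho>le: "(1 - \<tau>) * \<sigma> * (norm (\<rho> j))\<^sup>2 \<le> \<sigma> * (norm (\<rho> j))\<^sup>2" for j
      using tau_pos sigma_pos by (simp add: mult_right_mono)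
    have "(1 - \<tau>) * \<sigma> * (norm (adjoint A (du (Suc k))))\<^sup>2 \<le> (1 - \<tau>) * \<sigma> * (2 * (norm (\<rho> (Suc k)))\<^sup>2 + 2 * (norm (r (Suc k)))\<^sup>2)"
      unfolding e2 using tau sigma_pos by (intro mult_left_mono norm_sq_diff_le) simp
    then have 3: "(1 - \<tau>) * \<sigma> * (norm (adjoint A (du (Suc k))))\<^sup>2
        \<le> 2 * (\<sigma> * (norm (\<rho> (Suc k)))\<^sup>2) + 2 * ((1 - \<tau>) * (\<sigma> * (norm (r (Suc k)))\<^sup>2))"
      using \<rho>le[of "Suc k"] by (simp add: algebra_simps)
    have "(1 - \<tau>) * \<sigma> * (norm (adjoint B (dv k)))\<^sup>2 \<le> (1 - \<tau>) * \<sigma> * (2 * (norm (r (Suc k)))\<^sup>2 + 2 * (norm (\<rho> k))\<^sup>2)"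
      unfolding e3 using tau sigma_pos by (intro mult_left_mono norm_sq_diff_le) simp
    then have 4: "(1 - \<tau>) * \<sigma> * (norm (adjoint B (dv k)))\<^sup>2
        \<le> 2 * ((1 - \<tau>) * (\<sigma> * (norm (r (Suc k)))\<^sup>2)) + 2 * (\<sigma> * (norm (\<rho> k))\<^sup>2)"
      using \<rho>le[of k] by (simp add: algebra_simps)
    show ?thesis
      using 1 2 3 4 a_ge[where k = k and ub = ub and vb = vb] a_ge[where k = "Suc k" and ub = ub and vb = vb]
      unfolding N_def fst_conv snd_conv distrib_left by linarith
  qed
  have N_nonneg: "0 \<le> N w" for w using N_pos[of w] N_hom[of 0 0] by (cases "w = 0") auto
  have "(\<lambda>k. 20 * a ub vb k + 20 * a ub vb (Suc k)) \<longlonglongrightarrow> 20 * 0 + 20 * 0"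
    by (intro tendsto_add tendsto_mult_left a0 LIMSEQ_Suc)
  then have lim: "(\<lambda>k. 20 * a ub vb k + 20 * a ub vb (Suc k)) \<longlonglongrightarrow> 0" by simp
  have "(\<lambda>k. N (du (Suc k), dv (k + 0))) \<longlonglongrightarrow> 0"
    by (rule tendsto_0_le[OF lim]) (simp_all only: N_nonneg add_0_right N_le)
  note du0 = differences_tendsto_0(1)[OF N_cont N_hom N_pos this]
    and dv0 = differences_tendsto_0(2)[OF N_cont N_hom N_pos this]
  have "(norm (\<rho> k))\<^sup>2 \<le> a ub vb k / \<sigma>" for k
    using a_ge(5)[of k ub vb] sigma_pos by (simp add: pos_le_divide_eq mult.commute)
  then have \<rho>0: "\<rho> \<longlonglongrightarrow> 0"
    by (rule tendsto_0_by_coercivity) (rule tendsto_divide_zero[OF a0])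
  have "(\<lambda>k. \<rho> k + adjoint B (dv k)) \<longlonglongrightarrow> 0 + adjoint B 0"
    by (intro tendsto_add \<rho>0 tendsto_linear[OF linear_adjoints(2) dv0])
  then have "(\<lambda>k. r (Suc k)) \<longlonglongrightarrow> 0" by (simp add: \<rho>_def linear_0[OF linear_adjoints(2)])
  then have r0: "r \<longlonglongrightarrow> 0" by (rule LIMSEQ_imp_Suc)
  obtain C1 where C1: "0 < C1" "\<And>a. (norm a)\<^sup>2 \<le> C1 * (qf Q (a, 0) + \<sigma> * (norm (adjoint A a))\<^sup>2 + qf S a)"
    using u_coercive by blast
  obtain C2 where C2: "0 < C2" "\<And>b. (norm b)\<^sup>2 \<le> C2 * (qf Q (0, b) + \<sigma> * (norm (adjoint B b))\<^sup>2 + qf T b)"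
    using v_coercive by blast
  show ?thesis
  proof (rule convergence_from_lyapunov[OF du0 dv0 r0])
    fix ub vb xb assume KKT: "is_KKT p q g A B c ub vb xb"
    define P where "P = Psi ub vb xb"
    \<comment> \<open>The 9 consists of 4 for the \<open>Q\<close>-part, 4 for the part in
      \<open>adjoint A\<close> and 1 for \<open>S\<close>; both fours come from the factor-two
      inequality for squares of differences.\<close>
    define C where "C = 9 * C1 + C2 + \<tau> * \<sigma>"
    have P0: "0 \<le> P k" for k unfolding P_def by (rule Psi_nonneg)
    have step: "P (Suc k) + a ub vb k \<le> P k" for k unfolding P_def by (rule dec[OF KKT])
    have mono: "P (Suc k) \<le> P k" "a ub vb k \<le> P k" for k using step[of k] P0[of "Suc k"] a_ge(6)[where k = k and ub = ub and vb = vb] by linarith+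
    have Cle: "9 * C1 * P k \<le> C * P k" "C2 * P k \<le> C * P k" "(\<tau> * \<sigma>) * P k \<le> C * P k" for k
      using C1(1) C2(1) sigma_pos tau_pos P0[of k] by (auto simp: C_def intro!: mult_right_mono)
    have bu: "(norm (u (k + 1) - ub))\<^sup>2 \<le> C * P k" for k
    proof -
      have "(u (Suc k) - ub, 0) = (u (Suc k) - ub, v k - vb) - (0, v k - vb)" by simp
      then have 1: "qf Q (u (Suc k) - ub, 0) \<le> 2 * qf Q (u (Suc k) - ub, v k - vb) + 2 * qf Q (0, v k - vb)"
        using qf_diff_le[OF Q_psd] by metis
      have "adjoint A (u (Suc k) - ub) = \<rho> k - adjoint B (v k - vb)"
        unfolding \<rho>_eq KKT_subgradients(3)[OF KKT, symmetric] by (simp add: adj_simps)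
      then have "\<sigma> * (norm (adjoint A (u (Suc k) - ub)))\<^sup>2 \<le> \<sigma> * (2 * (norm (\<rho> k))\<^sup>2 + 2 * (norm (adjoint B (v k - vb)))\<^sup>2)"
        using sigma_pos norm_sq_diff_le by simp
      then have 2: "\<sigma> * (norm (adjoint A (u (Suc k) - ub)))\<^sup>2 \<le> 2 * (\<sigma> * (norm (\<rho> k))\<^sup>2) + 2 * (\<sigma> * (norm (adjoint B (v k - vb)))\<^sup>2)"
        by (simp add: algebra_simps)
      have 3: "qf Q (0, v k - vb) \<le> P k" "\<sigma> * (norm (adjoint B (v k - vb)))\<^sup>2 \<le> P k"
        using Psi_controls(3)[where k = k and ub = ub and vb = vb and xb = xb] nonnegs(1)[of "(0, v k - vb)"] nonnegs(3)[of "v k - vb"]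
          mult_nonneg_nonneg[OF less_imp_le[OF sigma_pos] zero_le_power2[of "norm (adjoint B (v k - vb))"]]
        unfolding P_def by linarith+
      have 4: "qf S (u (Suc k) - ub) \<le> P k"
        using Psi_controls(2)[where k = "Suc k" and ub = ub and vb = vb and xb = xb] mono(1)[of k] unfolding P_def by linarith
      have "qf Q (u (Suc k) - ub, 0) + \<sigma> * (norm (adjoint A (u (Suc k) - ub)))\<^sup>2 + qf S (u (Suc k) - ub) \<le> 9 * P k"
        using 1 2 3 4 a_ge[where k = k and ub = ub and vb = vb] mono(2)[of k] by linarith
      then have "C1 * (qf Q (u (Suc k) - ub, 0) + \<sigma> * (norm (adjoint A (u (Suc k) - ub)))\<^sup>2 + qf S (u (Suc k) - ub)) \<le> C1 * (9 * P k)"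
        using C1(1) by simp
      then have "(norm (u (Suc k) - ub))\<^sup>2 \<le> 9 * C1 * P k" using C1(2)[of "u (Suc k) - ub"] by simp
      then show ?thesis using Cle(1)[of k] by simp
    qed
    have bv: "(norm (v (k + 1) - vb))\<^sup>2 \<le> C * P k" for k
    proof -
      have "qf Q (0, v (Suc k) - vb) + \<sigma> * (norm (adjoint B (v (Suc k) - vb)))\<^sup>2 + qf T (v (Suc k) - vb) \<le> P k"
        using Psi_controls(3)[where k = "Suc k" and ub = ub and vb = vb and xb = xb] mono(1)[of k] unfolding P_def by linarith
      then have "C2 * (qf Q (0, v (Suc k) - vb) + \<sigma> * (norm (adjoint B (v (Suc k) - vb)))\<^sup>2 + qf T (v (Suc k) - vb)) \<le> C2 * P k"
        using C2(1) by simp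
      then show ?thesis using C2(2)[of "v (Suc k) - vb"] Cle(2)[of k] by simp
    qed
    have bx: "(norm (x (k + 1) - xb))\<^sup>2 \<le> C * P k" for k
    proof -
      have "(norm (x (Suc k) - xb))\<^sup>2 \<le> (\<tau> * \<sigma>) * P (Suc k)" unfolding P_def by (rule Psi_controls(1))
      also have "\<dots> \<le> (\<tau> * \<sigma>) * P k" using mono(1) tau_pos sigma_pos by (intro mult_left_mono) auto
      also note Cle(3)
      finally show ?thesis by simp
    qed
    show "\<exists>\<Phi> C m. (\<forall>k. 0 \<le> \<Phi> k \<and> \<Phi> (Suc k) \<le> \<Phi> k) \<and>
        (\<forall>k. (norm (u (k + m) - ub))\<^sup>2 \<le> C * \<Phi> k \<and> (norm (v (k + m) - vb))\<^sup>2 \<le> C * \<Phi> k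
           \<and> (norm (x (k + m) - xb))\<^sup>2 \<le> C * \<Phi> k) \<and>
        (\<forall>s. strict_mono s \<and> (\<lambda>k. u (s k)) \<longlonglongrightarrow> ub \<and> (\<lambda>k. v (s k)) \<longlonglongrightarrow> vb \<and> (\<lambda>k. x (s k)) \<longlonglongrightarrow> xb
           \<longrightarrow> (\<lambda>k. \<Phi> (s k)) \<longlonglongrightarrow> (0::real))"
      by (rule exI[of _ P], rule exI[of _ C], rule exI[of _ 1])
        (use P0 mono(1) bu bv bx Psi_tendsto_0 in \<open>auto simp: P_def\<close>)
  qed
qed

section \<open>Convergence for step sizes below the golden ratio\<close>

definition Mform where
  "Mform w = 1/4 * qf Q w + (qf S (fst w) - \<eta> * qf D1 (fst w)) + (qf T (snd w) - \<eta> * qf D2 (snd w))"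

text \<open>Shifted by one index against \<open>Psi\<close>, because the estimate combines the
  descent of one step with a comparison to the step before. The increment terms are those that
  \<open>cross_descent\<close> charges to the earlier step; \<open>c0\<close> comes from the Young
  inequality.\<close>

definition Lyap where
  "Lyap c0 ub vb xb k = Psi ub vb xb (Suc k) + 3/2 * qf Q (u (Suc k) - ub, v (Suc k) - vb)
     + (qf D2 (dv k) + qf T (dv k)) + \<eta> * qf D1 (du k) + c0 * (\<sigma> * (norm (r (Suc k)))\<^sup>2)"

lemma Lyap_descent:
  assumes KKT: "is_KKT p q g A B c ub vb xb"
    and young: "\<And>(R' :: 'x) (R :: 'x) b. (c0 + c1) * (norm R')\<^sup>2 - c0 * (norm R)\<^sup>2 + c2 * (norm b)\<^sup>2
       \<le> (2 - \<tau>) * (norm R')\<^sup>2 + (norm b)\<^sup>2 - 2 * (1 - \<tau>) * inner R b"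
  shows "Lyap c0 ub vb xb (Suc k) + (Mform (du (Suc k), dv (Suc k)) + c1 * (\<sigma> * (norm (r (Suc (Suc k))))\<^sup>2)
      + c2 * (\<sigma> * (norm (adjoint B (dv (Suc k))))\<^sup>2)) \<le> Lyap c0 ub vb xb k"
proof -
  define e f where "e = du (Suc k)" and "f = dv (Suc k)"
  \<comment> \<open>The mixed error between two iterates: the old error is
    \<open>y - (e, 0)\<close>, the new one \<open>y + (0, f)\<close>.\<close>
  define y where "y = (u (Suc (Suc k)) - ub, v (Suc k) - vb)"
  define R R' b where "R = r (Suc k)" and "R' = r (Suc (Suc k))" and "b = adjoint B f"
  have z': "(u (Suc (Suc k)) - ub, v (Suc (Suc k)) - vb) = y + (0, f)"
    by (simp add: y_def f_def dv_def)
  have z: "(u (Suc k) - ub, v (Suc k) - vb) = y - (e, 0)" by (simp add: y_def e_def du_def)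
  have ef: "(e, f) = (e, 0) + (0, f)" by simp
  have d: "Psi ub vb xb (Suc (Suc k)) + qf Q (y + (0, f)) + qf Q y + qf S e + qf T f
     + (2 - \<tau>) * (\<sigma> * (norm R')\<^sup>2) + \<sigma> * (norm b)\<^sup>2 - 2 * (\<sigma> * inner b R') \<le> Psi ub vb xb (Suc k)"
    using descent[OF KKT, of "Suc k"] unfolding z' y_def[symmetric] e_def[symmetric] f_def[symmetric]
      b_def[symmetric] R'_def[symmetric] .
  have c: "qf D2 f + qf T f - qf D2 (dv k) - qf T (dv k) - \<eta> * qf D1 (du k) - \<eta> * qf D2 f
     + 2 * inner (0, f) (Q (e, f)) - 2 * (1 - \<tau>) * (\<sigma> * inner R b) \<le> - 2 * (\<sigma> * inner b R')"
    using cross_descent[of k] unfolding e_def[symmetric] f_def[symmetric]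
      b_def[symmetric] R'_def[symmetric] R_def[symmetric] by (simp add: distrib_left)
  have "\<sigma> * ((c0 + c1) * (norm R')\<^sup>2 - c0 * (norm R)\<^sup>2 + c2 * (norm b)\<^sup>2)
       \<le> \<sigma> * ((2 - \<tau>) * (norm R')\<^sup>2 + (norm b)\<^sup>2 - 2 * (1 - \<tau>) * inner R b)"
    by (rule mult_left_mono[OF young less_imp_le[OF sigma_pos]])
  then have yg: "c0 * (\<sigma> * (norm R')\<^sup>2) + c1 * (\<sigma> * (norm R')\<^sup>2) - c0 * (\<sigma> * (norm R)\<^sup>2) + c2 * (\<sigma> * (norm b)\<^sup>2)
       \<le> (2 - \<tau>) * (\<sigma> * (norm R')\<^sup>2) + \<sigma> * (norm b)\<^sup>2 - 2 * (1 - \<tau>) * (\<sigma> * inner R b)"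
    by (simp add: algebra_simps)
  \<comment> \<open>After exchanging \<open>3/2\<close> of the new for the old
    \<open>Q\<close>-error, two squares and a quarter of \<open>Q\<close> at the increment are left
    over. This quarter is the one in \<open>Mform\<close>.\<close>
  have sq: "1/4 * qf Q (e, f) \<le> - (1/2) * qf Q (y + (0, f)) + 3/2 * qf Q (y - (e, 0)) + qf Q y
      + 2 * inner (0, f) (Q (e, f))"
    unfolding ef using qf_sum_of_squares[OF Q_sa, of y "(0, f)" "(e, 0)"]
      nonnegs(1)[of "y - (1/4) *\<^sub>R ((0, f) + 3 *\<^sub>R (e, 0))"] nonnegs(1)[of "3 *\<^sub>R (0, f) + (e, 0)"] by linarith
  show ?thesis
    unfolding Lyap_def Mform_def e_def[symmetric] f_def[symmetric] b_def[symmetric] R'_def[symmetric] R_def[symmetric]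
      z' z fst_conv snd_conv
    using d c yg sq by linarith
qed

lemma convergence_large_step:
  assumes tau: "\<tau> < (1 + sqrt 5) / 2"
    and M_nonneg: "\<And>w. 0 \<le> Mform w"
    and M_u: "\<And>a. a \<noteq> 0 \<Longrightarrow> 0 < Mform (a, 0) + \<sigma> * (norm (adjoint A a))\<^sup>2"
    and M_v: "\<And>b. b \<noteq> 0 \<Longrightarrow> 0 < Mform (0, b) + \<sigma> * (norm (adjoint B b))\<^sup>2"
    and inj: "\<And>a b. Mform (a, b) + \<sigma> * ((norm (adjoint A a))\<^sup>2 + (norm (adjoint B b))\<^sup>2) = 0 \<Longrightarrow> a = 0 \<or> b = 0"
  shows "converges_to_KKT p q \<phi> g A B c u v x"
proof -
  obtain c0 c1 c2 where c: "0 \<le> c0" "0 < c1" "0 < c2" and young: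
    "\<And>(R' :: 'x) (R :: 'x) b. (c0 + c1) * (norm R')\<^sup>2 - c0 * (norm R)\<^sup>2 + c2 * (norm b)\<^sup>2
       \<le> (2 - \<tau>) * (norm R')\<^sup>2 + (norm b)\<^sup>2 - 2 * (1 - \<tau>) * inner R b"
    using young_golden_ratio[OF tau_pos tau, where 'a = 'x] by blast
  define m where "m k = Mform (du (Suc k), dv (Suc k)) + c1 * (\<sigma> * (norm (r (Suc (Suc k))))\<^sup>2)
      + c2 * (\<sigma> * (norm (adjoint B (dv (Suc k))))\<^sup>2)" for k
  have m_ge: "Mform (du (Suc k), dv (Suc k)) \<le> m k" "c1 * (\<sigma> * (norm (r (Suc (Suc k))))\<^sup>2) \<le> m k"
    "c2 * (\<sigma> * (norm (adjoint B (dv (Suc k))))\<^sup>2) \<le> m k" "0 \<le> m k" for k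
  proof -
    have "0 \<le> c1 * (\<sigma> * (norm (r (Suc (Suc k))))\<^sup>2)" "0 \<le> c2 * (\<sigma> * (norm (adjoint B (dv (Suc k))))\<^sup>2)"
      using c sigma_pos by simp_all
    then show "Mform (du (Suc k), dv (Suc k)) \<le> m k" "c1 * (\<sigma> * (norm (r (Suc (Suc k))))\<^sup>2) \<le> m k"
      "c2 * (\<sigma> * (norm (adjoint B (dv (Suc k))))\<^sup>2) \<le> m k" "0 \<le> m k"
      unfolding m_def using M_nonneg[of "(du (Suc k), dv (Suc k))"] by linarith+
  qed
  have dec: "Lyap c0 ub vb xb (Suc k) + m k \<le> Lyap c0 ub vb xb k" if "is_KKT p q g A B c ub vb xb" for ub vb xb k
    unfolding m_def by (rule Lyap_descent[OF that young])
  have Lyap_parts: "Psi ub vb xb (Suc k) \<le> Lyap c0 ub vb xb k"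
    "qf Q (u (Suc k) - ub, v (Suc k) - vb) \<le> Lyap c0 ub vb xb k" "0 \<le> Lyap c0 ub vb xb k" for ub vb xb k
  proof -
    have "0 \<le> c0 * (\<sigma> * (norm (r (Suc k)))\<^sup>2)" "0 \<le> \<eta> * qf D1 (du k)"
      using c sigma_pos eta_nonneg nonnegs(4)[of "du k"] by simp_all
    then show "Psi ub vb xb (Suc k) \<le> Lyap c0 ub vb xb k"
      "qf Q (u (Suc k) - ub, v (Suc k) - vb) \<le> Lyap c0 ub vb xb k" "0 \<le> Lyap c0 ub vb xb k"
      unfolding Lyap_def using Psi_nonneg[of ub vb xb "Suc k"] nonnegs(1)[of "(u (Suc k) - ub, v (Suc k) - vb)"]
        nonnegs(3)[of "dv k"] nonnegs(5)[of "dv k"] by linarith+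
  qed
  obtain ub vb xb where KKT: "is_KKT p q g A B c ub vb xb" using KKT_exists by blast
  have m0: "m \<longlonglongrightarrow> 0"
    by (rule nonneg_decrement_tendsto_0[of "Lyap c0 ub vb xb"]) (rule Lyap_parts(3) m_ge(4) dec[OF KKT])+
  have "(norm (r (Suc (Suc k))))\<^sup>2 \<le> m k / (c1 * \<sigma>)" for k
    using m_ge(2)[of k] c sigma_pos by (simp add: pos_le_divide_eq mult_ac)
  then have "(\<lambda>k. r (Suc (Suc k))) \<longlonglongrightarrow> 0"
    by (rule tendsto_0_by_coercivity) (rule tendsto_divide_zero[OF m0])
  then have r0: "r \<longlonglongrightarrow> 0" by (intro LIMSEQ_imp_Suc[of r] LIMSEQ_imp_Suc[of "\<lambda>k. r (Suc k)"])
  have "(norm (adjoint B (dv (Suc k))))\<^sup>2 \<le> m k / (c2 * \<sigma>)" for k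
    using m_ge(3)[of k] c sigma_pos by (simp add: pos_le_divide_eq mult_ac)
  then have Bdv0: "(\<lambda>k. adjoint B (dv (Suc k))) \<longlonglongrightarrow> 0"
    by (rule tendsto_0_by_coercivity) (rule tendsto_divide_zero[OF m0])
  \<comment> \<open>Consecutive residuals differ by the images of both increments, so the image of
    \<open>du\<close> vanishes along with that of \<open>dv\<close>.\<close>
  have "(\<lambda>k. r (Suc (Suc k)) - r (Suc k) - adjoint B (dv (Suc k))) \<longlonglongrightarrow> 0 - 0 - 0"
    by (intro tendsto_diff Bdv0 LIMSEQ_Suc r0)
  moreover have "r (Suc (Suc k)) - r (Suc k) - adjoint B (dv (Suc k)) = adjoint A (du (Suc k))" for k
    by (simp add: r_def du_def dv_def adj_simps)
  ultimately have Adu0: "(\<lambda>k. adjoint A (du (Suc k))) \<longlonglongrightarrow> 0" by simp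
  \<comment> \<open>All summands of \<open>N\<close> tend to zero separately at equal indices, so no
    staggering occurs.\<close>
  define N where "N = (\<lambda>w. Mform w + \<sigma> * ((norm (adjoint A (fst w)))\<^sup>2 + (norm (adjoint B (snd w)))\<^sup>2))"
  have N_cont: "continuous_on UNIV N" unfolding N_def Mform_def
    by (intro continuous_intros continuous_on_qf continuous_on_adjoint Q_lin psd_opD(2) S_psd T_psd D1_psd D2_psd)
  have N_hom: "N (t *\<^sub>R w) = t\<^sup>2 * N w" for t w
    unfolding N_def Mform_def by (simp add: qf_scale Q_lin psd_opD(2)[OF S_psd] psd_opD(2)[OF T_psd]
        psd_opD(2)[OF D1_psd] psd_opD(2)[OF D2_psd] adj_scale power_mult_distrib algebra_simps)
  have N_pos: "0 < N w" if w: "w \<noteq> 0" for w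
  proof -
    obtain a b where ab: "w = (a, b)" by (cases w)
    have "0 \<le> \<sigma> * ((norm (adjoint A a))\<^sup>2 + (norm (adjoint B b))\<^sup>2)" using sigma_pos by simp
    then have "0 \<le> N w" using M_nonneg[of w] by (simp add: N_def ab)
    moreover have "N w \<noteq> 0"
    proof
      assume N0: "N w = 0"
      then have "a = 0 \<or> b = 0" by (intro inj) (simp add: N_def ab)
      then show False
      proof
        assume "a = 0"
        then show False using N0 w M_v[of b] by (auto simp: N_def ab linear_0[OF linear_adjoints(1)] zero_prod_def)
      next
        assume "b = 0"
        then show False using N0 w M_u[of a] by (auto simp: N_def ab linear_0[OF linear_adjoints(2)] zero_prod_def)
      qed
    qed
    ultimately show ?thesis by simp
  qed
  have M0: "(\<lambda>k. Mform (du (Suc k), dv (Suc k))) \<longlonglongrightarrow> 0"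
    by (rule tendsto_0_le[OF m0 M_nonneg m_ge(1)])
  have "(\<lambda>k. N (du (Suc k), dv (k + 1))) \<longlonglongrightarrow> 0 + \<sigma> * ((norm (0 :: 'x))\<^sup>2 + (norm (0 :: 'x))\<^sup>2)"
    unfolding N_def fst_conv snd_conv Suc_eq_plus1[symmetric]
    by (intro tendsto_add tendsto_mult_left tendsto_power tendsto_norm M0 Adu0 Bdv0)
  then have "(\<lambda>k. N (du (Suc k), dv (k + 1))) \<longlonglongrightarrow> 0" by simp
  note du0 = differences_tendsto_0(1)[OF N_cont N_hom N_pos this]
    and dv0 = differences_tendsto_0(2)[OF N_cont N_hom N_pos this]
  obtain C1 where C1: "0 < C1" "\<And>a. (norm a)\<^sup>2 \<le> C1 * (qf Q (a, 0) + \<sigma> * (norm (adjoint A a))\<^sup>2 + qf S a)"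
    using u_coercive by blast
  obtain C2 where C2: "0 < C2" "\<And>b. (norm b)\<^sup>2 \<le> C2 * (qf Q (0, b) + \<sigma> * (norm (adjoint B b))\<^sup>2 + qf T b)"
    using v_coercive by blast
  show ?thesis
  proof (rule convergence_from_lyapunov[OF du0 dv0 r0])
    fix ub vb xb assume KKT: "is_KKT p q g A B c ub vb xb"
    define P where "P = Lyap c0 ub vb xb"
    \<comment> \<open>For the form in \<open>u_coercive\<close>: 4 from \<open>Q\<close>,
      \<open>2 + 2 / c1\<close> from the part in \<open>adjoint A\<close> via the residual, and 1
      from \<open>S\<close>.\<close>
    define C3 where "C3 = (7 + 2 / c1) * C1"
    define C where "C = C3 + C2 + \<tau> * \<sigma>"
    have P0: "0 \<le> P k" for k unfolding P_def by (rule Lyap_parts(3))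
    have step: "P (Suc k) + m k \<le> P k" for k unfolding P_def by (rule dec[OF KKT])
    have mono: "P (Suc k) \<le> P k" "m k \<le> P k" for k using step[of k] P0[of "Suc k"] m_ge(4)[of k] by linarith+
    have C3: "0 < C3" using C1(1) c by (simp add: C3_def add_pos_pos)
    have Cle: "C3 * P k \<le> C * P k" "C2 * P k \<le> C * P k" "(\<tau> * \<sigma>) * P k \<le> C * P k" for k
      using C3 C2(1) sigma_pos tau_pos P0[of k] by (auto simp: C_def intro!: mult_right_mono)
    \<comment> \<open>\<open>P k\<close> contains \<open>Psi\<close> at \<open>Suc k\<close>; one
      further decrease reaches index \<open>k + 2\<close>, where \<open>m k\<close> bounds the
      residual. Hence the offset 2.\<close>
    have Psi_le: "Psi ub vb xb (Suc (Suc k)) \<le> P k" for k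
      using Lyap_parts(1)[of ub vb xb "Suc k"] mono(1)[of k] unfolding P_def by linarith
    have bu: "(norm (u (k + 2) - ub))\<^sup>2 \<le> C * P k" for k
    proof -
      define a b where "a = u (Suc (Suc k)) - ub" and "b = v (Suc (Suc k)) - vb"
      have "(a, 0) = (a, b) - (0, b)" by simp
      then have 1: "qf Q (a, 0) \<le> 2 * qf Q (a, b) + 2 * qf Q (0, b)"
        using qf_diff_le[OF Q_psd] by metis
      have "adjoint A a = r (Suc (Suc k)) - adjoint B b"
        using KKT_subgradients(3)[OF KKT] by (auto simp: r_def a_def b_def adj_simps algebra_simps)
      then have "\<sigma> * (norm (adjoint A a))\<^sup>2 \<le> \<sigma> * (2 * (norm (r (Suc (Suc k))))\<^sup>2 + 2 * (norm (adjoint B b))\<^sup>2)"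
        using sigma_pos norm_sq_diff_le by simp
      then have 2: "\<sigma> * (norm (adjoint A a))\<^sup>2 \<le> 2 * (\<sigma> * (norm (r (Suc (Suc k))))\<^sup>2) + 2 * (\<sigma> * (norm (adjoint B b))\<^sup>2)"
        by (simp add: algebra_simps)
      have 3: "qf Q (0, b) \<le> P k" "\<sigma> * (norm (adjoint B b))\<^sup>2 \<le> P k"
        using Psi_controls(3)[where k = "Suc (Suc k)" and ub = ub and vb = vb and xb = xb] Psi_le[of k]
          nonnegs(1)[of "(0, b)"] nonnegs(3)[of b]
          mult_nonneg_nonneg[OF less_imp_le[OF sigma_pos] zero_le_power2[of "norm (adjoint B b)"]]
        unfolding b_def[symmetric] by linarith+
      have 4: "qf S a \<le> P k"
        using Psi_controls(2)[where k = "Suc (Suc k)" and ub = ub and vb = vb and xb = xb] Psi_le[of k]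
        unfolding a_def by linarith
      have 5: "qf Q (a, b) \<le> P k"
        using Lyap_parts(2)[of "Suc k" ub vb xb] mono(1)[of k] unfolding P_def a_def b_def by linarith
      have "c1 * (\<sigma> * (norm (r (Suc (Suc k))))\<^sup>2) \<le> P k" using m_ge(2)[of k] mono(2)[of k] by linarith
      then have 6: "\<sigma> * (norm (r (Suc (Suc k))))\<^sup>2 \<le> P k / c1" using c by (simp add: pos_le_divide_eq mult.commute)
      have "qf Q (a, 0) + \<sigma> * (norm (adjoint A a))\<^sup>2 + qf S a \<le> 7 * P k + 2 * (P k / c1)"
        using 1 2 3 4 5 6 by linarith
      also have "\<dots> = (7 + 2 / c1) * P k" by (simp add: algebra_simps)
      finally have "C1 * (qf Q (a, 0) + \<sigma> * (norm (adjoint A a))\<^sup>2 + qf S a) \<le> C1 * ((7 + 2 / c1) * P k)"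
        using C1(1) by simp
      then have "(norm a)\<^sup>2 \<le> C3 * P k" using C1(2)[of a] by (simp add: C3_def mult_ac)
      then show ?thesis using Cle(1)[of k] by (simp add: a_def)
    qed
    have bv: "(norm (v (k + 2) - vb))\<^sup>2 \<le> C * P k" for k
    proof -
      have "qf Q (0, v (Suc (Suc k)) - vb) + \<sigma> * (norm (adjoint B (v (Suc (Suc k)) - vb)))\<^sup>2 + qf T (v (Suc (Suc k)) - vb) \<le> P k"
        using Psi_controls(3)[where k = "Suc (Suc k)" and ub = ub and vb = vb and xb = xb] Psi_le[of k] by linarith
      then have "C2 * (qf Q (0, v (Suc (Suc k)) - vb) + \<sigma> * (norm (adjoint B (v (Suc (Suc k)) - vb)))\<^sup>2 + qf T (v (Suc (Suc k)) - vb)) \<le> C2 * P k"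
        using C2(1) by simp
      then show ?thesis using C2(2)[of "v (Suc (Suc k)) - vb"] Cle(2)[of k] by simp
    qed
    have bx: "(norm (x (k + 2) - xb))\<^sup>2 \<le> C * P k" for k
    proof -
      have "(norm (x (Suc (Suc k)) - xb))\<^sup>2 \<le> (\<tau> * \<sigma>) * Psi ub vb xb (Suc (Suc k))" by (rule Psi_controls(1))
      also have "\<dots> \<le> (\<tau> * \<sigma>) * P k" using Psi_le tau_pos sigma_pos by (intro mult_left_mono) auto
      also note Cle(3)
      finally show ?thesis by simp
    qed
    \<comment> \<open>\<open>Lyap\<close> at \<open>s k\<close> involves the iterates at
      \<open>Suc (s k)\<close>, to which the vanishing increments and residuals carry over the
      limits.\<close>
    have lim: "(\<lambda>k. P (s k)) \<longlonglongrightarrow> 0"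
      if s: "strict_mono s" and ul: "(\<lambda>k. u (s k)) \<longlonglongrightarrow> ub" and vl: "(\<lambda>k. v (s k)) \<longlonglongrightarrow> vb"
        and xl: "(\<lambda>k. x (s k)) \<longlonglongrightarrow> xb" for s
    proof -
      have du_s: "(\<lambda>k. du (s k)) \<longlonglongrightarrow> 0" and dv_s: "(\<lambda>k. dv (s k)) \<longlonglongrightarrow> 0" and r_s: "(\<lambda>k. r (Suc (s k))) \<longlonglongrightarrow> 0"
        using LIMSEQ_subseq_LIMSEQ[OF du0 s] LIMSEQ_subseq_LIMSEQ[OF dv0 s]
          LIMSEQ_subseq_LIMSEQ[OF LIMSEQ_Suc[OF r0] s] by (simp_all add: o_def)
      have "(\<lambda>k. u (s k) + du (s k)) \<longlonglongrightarrow> ub + 0" by (intro tendsto_add ul du_s)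
      then have u1: "(\<lambda>k. u (Suc (s k))) \<longlonglongrightarrow> ub" by (simp add: du_def)
      have "(\<lambda>k. v (s k) + dv (s k)) \<longlonglongrightarrow> vb + 0" by (intro tendsto_add vl dv_s)
      then have v1: "(\<lambda>k. v (Suc (s k))) \<longlonglongrightarrow> vb" by (simp add: dv_def)
      have "(\<lambda>k. x (s k) + (\<tau> * \<sigma>) *\<^sub>R r (Suc (s k))) \<longlonglongrightarrow> xb + (\<tau> * \<sigma>) *\<^sub>R 0"
        by (intro tendsto_add tendsto_scaleR tendsto_const xl r_s)
      then have x1: "(\<lambda>k. x (Suc (s k))) \<longlonglongrightarrow> xb" by (simp add: x_Suc)
      have "(\<lambda>k. P (s k)) \<longlonglongrightarrow> 0 + 3/2 * qf Q (ub - ub, vb - vb) + (qf D2 0 + qf T 0) + \<eta> * qf D1 0 + c0 * (\<sigma> * (norm (0 :: 'x))\<^sup>2)"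
        unfolding P_def Lyap_def
        by (intro tendsto_add tendsto_mult_left tendsto_power tendsto_norm r_s Psi_tendsto_0[OF u1 v1 x1]
            tendsto_qf[OF Q_lin] tendsto_Pair tendsto_diff tendsto_const u1 v1
            tendsto_qf[OF psd_opD(2)[OF D2_psd] dv_s] tendsto_qf[OF psd_opD(2)[OF T_psd] dv_s]
            tendsto_qf[OF psd_opD(2)[OF D1_psd] du_s])
      moreover have "(0 :: 'u, 0 :: 'v) = 0" by (simp add: zero_prod_def)
      ultimately show ?thesis by simp
    qed
    show "\<exists>\<Phi> C m. (\<forall>k. 0 \<le> \<Phi> k \<and> \<Phi> (Suc k) \<le> \<Phi> k) \<and>
        (\<forall>k. (norm (u (k + m) - ub))\<^sup>2 \<le> C * \<Phi> k \<and> (norm (v (k + m) - vb))\<^sup>2 \<le> C * \<Phi> k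
           \<and> (norm (x (k + m) - xb))\<^sup>2 \<le> C * \<Phi> k) \<and>
        (\<forall>s. strict_mono s \<and> (\<lambda>k. u (s k)) \<longlonglongrightarrow> ub \<and> (\<lambda>k. v (s k)) \<longlonglongrightarrow> vb \<and> (\<lambda>k. x (s k)) \<longlonglongrightarrow> xb
           \<longrightarrow> (\<lambda>k. \<Phi> (s k)) \<longlonglongrightarrow> (0::real))"
      by (rule exI[of _ P], rule exI[of _ C], rule exI[of _ 2]) (use P0 mono(1) bu bv bx lim in blast)
  qed
qed

end

section \<open>From the operator form of the hypotheses to quadratic forms\<close>

theorem theorem4p1:
  fixes p :: "'u::euclidean_space \<Rightarrow> ereal" and q :: "'v::euclidean_space \<Rightarrow> ereal"
    and \<phi> :: "'u \<times> 'v \<Rightarrow> real" and g :: "'u \<times> 'v \<Rightarrow> 'u \<times> 'v"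
    and A :: "'x::euclidean_space \<Rightarrow> 'u" and B :: "'x \<Rightarrow> 'v" and c :: 'x
    and Q H :: "'u \<times> 'v \<Rightarrow> 'u \<times> 'v"
    and D1 S :: "'u \<Rightarrow> 'u" and D2 T :: "'v \<Rightarrow> 'v"
    and \<eta> \<sigma> \<tau> :: real
    and u :: "nat \<Rightarrow> 'u" and v :: "nat \<Rightarrow> 'v" and x :: "nat \<Rightarrow> 'x"
  assumes p_cpc: "closed_proper_convex p" and q_cpc: "closed_proper_convex q"
    and phi_convex: "convex_on UNIV \<phi>"
    and phi_grad: "\<forall>w. (\<phi> has_derivative (\<lambda>h. inner (g w) h)) (at w)"
    and grad_lip: "\<exists>L. \<forall>w w'. norm (g w - g w') \<le> L * norm (w - w')"
    and A_lin: "linear A" and B_lin: "linear B"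
    and Q_psd: "psd_op Q" and D1_psd: "psd_op D1" and D2_psd: "psd_op D2"
    and H_def: "H = Diag D1 D2"
    and hess_bounds: "\<forall>w. \<forall>W \<in> gen_hessian g w.
        loewner_le Q (blinfun_apply W) \<and> loewner_le (blinfun_apply W) (\<lambda>z. Q z + H z)"
    and eta_range: "0 \<le> \<eta>" "\<eta> \<le> 1"
    and eta_bound: "\<forall>z. \<forall>W \<in> gen_hessian g z. \<forall>a b.
        \<bar>inner a (blk12 (blinfun_apply W) b - blk12 Q b)\<bar>
          \<le> \<eta> / 2 * (inner a (D1 a) + inner b (D2 b))"
    and sigma_pos: "\<sigma> > 0" and tau_pos: "\<tau> > 0"
    and S_psd: "psd_op S" and T_psd: "psd_op T"
    and sol_nonempty: "\<exists>u' v'. is_optimal p q \<phi> A B c u' v'"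
    and slater: "\<exists>uh vh. (uh, vh) \<in> rel_interior (edom p \<times> edom q) \<and>
                         adjoint A uh + adjoint B vh = c"
    and pd1: "pd_op (\<lambda>a. blk11 Q a + \<sigma> *\<^sub>R A (adjoint A a) + S a)"
    and pd2: "pd_op (\<lambda>b. blk22 Q b + \<sigma> *\<^sub>R B (adjoint B b) + T b)"
    and init: "u 0 \<in> edom p" "v 0 \<in> edom q"
    and u_step: "\<forall>k. \<forall>u'.
        Lhat p q \<phi> g Q H A B c \<sigma> (u (Suc k)) (v k) (x k) (u k, v k)
          + ereal (1/2 * inner (u (Suc k) - u k) (S (u (Suc k) - u k)))
        \<le> Lhat p q \<phi> g Q H A B c \<sigma> u' (v k) (x k) (u k, v k)
          + ereal (1/2 * inner (u' - u k) (S (u' - u k)))"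
    and v_step: "\<forall>k. \<forall>v'.
        Lhat p q \<phi> g Q H A B c \<sigma> (u (Suc k)) (v (Suc k)) (x k) (u k, v k)
          + ereal (1/2 * inner (v (Suc k) - v k) (T (v (Suc k) - v k)))
        \<le> Lhat p q \<phi> g Q H A B c \<sigma> (u (Suc k)) v' (x k) (u k, v k)
          + ereal (1/2 * inner (v' - v k) (T (v' - v k)))"
    and x_step: "\<forall>k. x (Suc k) = x k + (\<tau> * \<sigma>) *\<^sub>R
                       (adjoint A (u (Suc k)) + adjoint B (v (Suc k)) - c)"
  shows "(\<tau> \<le> 1 \<and>
          (\<forall>a b. inner (a, b) (Q (a, b) +
               Diag (\<lambda>a'. S a' + ((1 - \<tau>) * \<sigma>) *\<^sub>R A (adjoint A a'))
                    (\<lambda>b'. T b' + ((1 - \<tau>) * \<sigma>) *\<^sub>R B (adjoint B b')) (a, b)) = 0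
             \<longrightarrow> norm a * norm b = 0)
          \<longrightarrow> converges_to_KKT p q \<phi> g A B c u v x)
       \<and> (let M = (\<lambda>z. (1/4) *\<^sub>R Q z + Diag (\<lambda>a. S a - \<eta> *\<^sub>R D1 a) (\<lambda>b. T b - \<eta> *\<^sub>R D2 b) z) in
          \<tau> < (1 + sqrt 5) / 2 \<and>
          psd_op M \<and>
          pd_op (\<lambda>a. (1/4) *\<^sub>R blk11 Q a + S a + \<sigma> *\<^sub>R A (adjoint A a) - \<eta> *\<^sub>R D1 a) \<and>
          pd_op (\<lambda>b. (1/4) *\<^sub>R blk22 Q b + T b + \<sigma> *\<^sub>R B (adjoint B b) - \<eta> *\<^sub>R D2 b) \<and>
          (\<forall>a b. inner (a, b) (M (a, b) +
               \<sigma> *\<^sub>R Diag (\<lambda>a'. A (adjoint A a')) (\<lambda>b'. B (adjoint B b')) (a, b)) = 0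
             \<longrightarrow> norm a * norm b = 0)
          \<longrightarrow> converges_to_KKT p q \<phi> g A B c u v x)"
proof -
  interpret majorized_admm p q \<phi> g A B c Q H D1 S D2 T \<eta> \<sigma> \<tau> u v x
    by (rule majorized_admm.intro; fact assms)
  show ?thesis
    unfolding Let_def
  proof (intro conjI impI; elim conjE)
    assume tau: "\<tau> \<le> 1"
      and inj: "\<forall>a b. inner (a, b) (Q (a, b) +
               Diag (\<lambda>a'. S a' + ((1 - \<tau>) * \<sigma>) *\<^sub>R A (adjoint A a'))
                    (\<lambda>b'. T b' + ((1 - \<tau>) * \<sigma>) *\<^sub>R B (adjoint B b')) (a, b)) = 0
             \<longrightarrow> norm a * norm b = 0"
    show "converges_to_KKT p q \<phi> g A B c u v x"
    proof (rule convergence_small_step[OF tau])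
      fix a b
      assume "qf Q (a, b) + qf S a + qf T b + (1 - \<tau>) * \<sigma> * ((norm (adjoint A a))\<^sup>2 + (norm (adjoint B b))\<^sup>2) = 0"
      moreover have "inner (a, b) (Q (a, b) + Diag (\<lambda>a'. S a' + ((1 - \<tau>) * \<sigma>) *\<^sub>R A (adjoint A a'))
          (\<lambda>b'. T b' + ((1 - \<tau>) * \<sigma>) *\<^sub>R B (adjoint B b')) (a, b))
        = qf Q (a, b) + qf S a + qf T b + (1 - \<tau>) * \<sigma> * ((norm (adjoint A a))\<^sup>2 + (norm (adjoint B b))\<^sup>2)"
        by (simp add: Diag_def inner_add_right norm_adjoint_sq qf_def distrib_left)
      ultimately show "a = 0 \<or> b = 0" using inj by fastforce
    qed
  next
    let ?M = "\<lambda>z. (1/4) *\<^sub>R Q z + Diag (\<lambda>a. S a - \<eta> *\<^sub>R D1 a) (\<lambda>b. T b - \<eta> *\<^sub>R D2 b) z"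
    assume tau: "\<tau> < (1 + sqrt 5) / 2" and M: "psd_op ?M"
      and M_u: "pd_op (\<lambda>a. (1/4) *\<^sub>R blk11 Q a + S a + \<sigma> *\<^sub>R A (adjoint A a) - \<eta> *\<^sub>R D1 a)"
      and M_v: "pd_op (\<lambda>b. (1/4) *\<^sub>R blk22 Q b + T b + \<sigma> *\<^sub>R B (adjoint B b) - \<eta> *\<^sub>R D2 b)"
      and inj: "\<forall>a b. inner (a, b) (?M (a, b) +
               \<sigma> *\<^sub>R Diag (\<lambda>a'. A (adjoint A a')) (\<lambda>b'. B (adjoint B b')) (a, b)) = 0
             \<longrightarrow> norm a * norm b = 0"
    have M_eq: "inner w (?M w) = Mform w" for w
      by (cases w) (simp add: Mform_def Diag_def qf_def inner_add_right inner_diff_right)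
    show "converges_to_KKT p q \<phi> g A B c u v x"
    proof (rule convergence_large_step[OF tau])
      show "0 \<le> Mform w" for w using M unfolding M_eq[symmetric] by (simp only: psd_op_def)
      show "0 < Mform (a, 0) + \<sigma> * (norm (adjoint A a))\<^sup>2" if "a \<noteq> 0" for a
      proof -
        have "0 < inner a ((1/4) *\<^sub>R blk11 Q a + S a + \<sigma> *\<^sub>R A (adjoint A a) - \<eta> *\<^sub>R D1 a)"
          using M_u that unfolding pd_op_def by blast
        then show ?thesis
          by (simp add: Mform_def inner_add_right inner_diff_right norm_adjoint_sq inner_blk qf_def)
      qed
      show "0 < Mform (0, b) + \<sigma> * (norm (adjoint B b))\<^sup>2" if "b \<noteq> 0" for b
      proof -
        have "0 < inner b ((1/4) *\<^sub>R blk22 Q b + T b + \<sigma> *\<^sub>R B (adjoint B b) - \<eta> *\<^sub>R D2 b)"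
          using M_v that unfolding pd_op_def by blast
        then show ?thesis
          by (simp add: Mform_def inner_add_right inner_diff_right norm_adjoint_sq inner_blk qf_def)
      qed
      fix a b
      assume "Mform (a, b) + \<sigma> * ((norm (adjoint A a))\<^sup>2 + (norm (adjoint B b))\<^sup>2) = 0"
      moreover have "inner (a, b) (?M (a, b) + \<sigma> *\<^sub>R Diag (\<lambda>a'. A (adjoint A a')) (\<lambda>b'. B (adjoint B b')) (a, b))
        = Mform (a, b) + \<sigma> * ((norm (adjoint A a))\<^sup>2 + (norm (adjoint B b))\<^sup>2)"
        unfolding inner_add_right[of _ "?M (a, b)"] M_eq by (simp add: Diag_def norm_adjoint_sq distrib_left)
      ultimately show "a = 0 \<or> b = 0" using inj by fastforce
    qed
  qed
qed

end
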